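(* Let $G=Sp_{2n}$ and $N=2n$. Start from the seed for $\mathrm{Conf}_3\mathcal A_{Sp_{2n}}$ described in the context and perform the following mutations: for $r=n-1,n-2,\dots,1$ in turn, and for each such $r$ for $m=1,2,\dots,r$ in turn, mutate all vertices $x_{ij}$ ($1\le i,j\le n-1$) with $\max(i,j)=m$ (the order among these being immaterial). Then a vertex $x_{ij}$ with $\max(i,j)=k$ is mutated $n-k$ times in total, and the function attached to it transforms as follows. (1) If $i\ge j$: for $0\le t\le n-i$, after $t$ mutations the function is $[2n-t,\,n-i-t;\;n+i-j+t;\;j+t]$. Thus it starts as $[n-i;n+i-j;j]$ and ends as $[n+i;2n-j;n-i+j]=[n-i;j;n+i-j]$. (2) If $i<j$ and $i\ne0$: for $0\le t\le n-j$, after $t$ mutations the function is $[n-i-t,\,2n+i-j-t;\;n+t;\;j+t]$. Thus it starts as $[n-i,2n+i-j;n;j]$ and ends as $[j-i,n+i;2n-j;n]=[n-i,2n+i-j;j;n]$.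
   Context: **Flags.** $V=\mathbb C^{N}$, $N=2n$, with symplectic form $\langle e_i,e_{2n+1-i}\rangle=(-1)^{i-1}$ ($1\le i\le n$), other pairings of basis vectors zero up to skew-symmetry. A point of $\mathcal A_{Sp_{2n}}=Sp_{2n}/U$ is given by vectors $v_1,\dots,v_n$ spanning isotropic subspaces $\langle v_1,\dots,v_i\rangle$, each $v_i$ mattering only modulo the span of the previous ones; complete to a symplectic basis $v_1,\dots,v_{2n}$ with $\langle v_i,v_{2n+1-i}\rangle=(-1)^{i-1}$ ($i\le n$), other pairings zero. This gives $\mathcal A_{Sp_{2n}}\hookrightarrow\mathcal A_{SL_{2n}}$ and $\mathrm{Conf}_3\mathcal A_{Sp_{2n}}\hookrightarrow\mathrm{Conf}_3\mathcal A_{SL_{2n}}$ ($\mathrm{Conf}_3\mathcal A_G=G\backslash(G/U)^3$); functions below are pulled back along this. Write $V_a=v_1\wedge\dots\wedge v_a$, $V_0=1$. **Three-flag functions.** Identify $\bigwedge^NV=\mathbb C$; $\phi_{p,q}:\bigwedge^{p+q}V\to\bigwedge^pV\otimes\bigwedge^qV$ is the natural (signed shuffle) comultiplication. For three flags with forms $U_\bullet,V_\bullet,W_\bullet$ (first, second, third): (i) if $a+b+c=N$, $[a;b;c]=U_a\wedge V_b\wedge W_c$; (ii) if $a+b+c=2N$, $[a;b;c]$ is obtained by applying $V_b\wedge-$ and $W_c\wedge-$ to the two factors of $\phi_{N-b,N-c}(U_a)$ and multiplying; (iii) if $a+b+c+d=2N$ and $b\le N-c,N-d\le a$, then $[a,b;c;d]=[b,a;c;d]$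 is obtained by applying $U_b\wedge-\wedge W_d$ and $U_a\wedge-$ to the two factors of $\phi_{a+c-N,N-a}(V_c)$ and multiplying. Convention: $[2n,a;b;c]=[a;b;c]=[a,0;b;c]$. **Seed.** Vertices $x_{ij}$ ($0\le i\le n$, $1\le j\le n$), $y_k$ ($1\le k\le n$); frozen: all $y_k$, $x_{0j}$, $x_{nj}$. The vertices $x_{in}$ and $y_n$ are white, the others black. Solid arrows: $x_{ij}\to x_{i-1,j}$ ($1\le i\le n$); $x_{ij}\to x_{i,j-1}$ ($1\le i\le n-1$, $j\ge2$); $x_{i1}\to y_{n-i}$ ($1\le i\le n-1$); $y_n\to x_{1n}$; $x_{ij}\to x_{i+1,j+1}$ ($0\le i\le n-1$, $j\le n-1$); $x_{0n}\to y_n$; $y_k\to x_{n-k+1,1}$ ($1\le k\le n-1$). Dotted arrows: $x_{0j}\to x_{0,j-1}$, $x_{nj}\to x_{n,j-1}$, $y_k\to y_{k+1}$. An arrow $p\to q$ means $b_{pq}>0>b_{qp}$; $|b_{pq}|=2$ if $p$ is white and $q$ is black, $|b_{pq}|=1$ otherwise; dotted arrows have half these values. Functions: $y_k$: $U_k\wedge V_{2n-k}$; $x_{0j}$: $[2n-j;0;j]$; $x_{ij}$ with $i\ge j$: $[n-i;n+i-j;j]$; $x_{ij}$ with $0<i<j$: $[n-i,2n+i-j;n;j]$. **Mutation at unfrozen $k$.** The function $A_k$ is replaced by $A_k'$ with $A_kA_k'=\prod_{b_{kj}>0}A_j^{b_{kj}}+\prod_{b_{kj}<0}A_j^{-b_{kj}}$,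 and $b'_{ij}=-b_{ij}$ if $k\in\{i,j\}$, $b'_{ij}=b_{ij}$ if $b_{ik}b_{kj}\le0$, $b'_{ij}=b_{ij}+|b_{ik}|b_{kj}$ otherwise.
   Formalization: In rule (ii), for a+b+c=2N, [a;b;c] is taken with an extra factor (-1)^a; without it rule (ii) contradicts rule (iii) under the convention [a;b;c]=[a,0;b;c], and [n+i;2n-j;n-i+j]=[n-i;j;n+i-j] fails by a sign when n+i is odd. *)

theory Defs
  imports Complex_Main
begin

section \<open>Exterior algebra of \<open>\<complex>\<^sup>N\<close>\<close>

text \<open>
  The dimension \<open>N\<close> varies with the statement, so everything is written in the standard basis
  \<open>e 1, \<dots>, e N\<close>: a form is the family of its coefficients, \<open>\<alpha> S\<close> being the coefficient of
  \<open>e s1 \<and> \<dots> \<and> e sp\<close> for \<open>S = {s1 < \<dots> < sp}\<close>.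
\<close>

type_synonym ext = "nat set \<Rightarrow> complex"

definition shuffle_sign :: "nat set \<Rightarrow> nat set \<Rightarrow> complex" where
  "shuffle_sign S T = (-1) ^ card {(i, j). i \<in> S \<and> j \<in> T \<and> j < i}"

definition wedge :: "ext \<Rightarrow> ext \<Rightarrow> ext"  (infixr "\<^bold>\<and>" 70) where
  "(\<alpha> \<^bold>\<and> \<beta>) S = (\<Sum>T\<in>Pow S. shuffle_sign T (S - T) * \<alpha> T * \<beta> (S - T))"

definition ext_basis :: "nat set \<Rightarrow> ext" where
  "ext_basis T = (\<lambda>S. if S = T then 1 else 0)"

definition ext_vec :: "nat \<Rightarrow> (nat \<Rightarrow> complex) \<Rightarrow> ext" where
  "ext_vec N v = (\<lambda>S. \<Sum>k=1..N. v k * ext_basis {k} S)"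

text \<open>The identification of the top exterior power with \<open>\<complex>\<close> sends \<open>e 1 \<and> \<dots> \<and> e N\<close> to 1.\<close>

definition vol :: "nat \<Rightarrow> ext \<Rightarrow> complex" where
  "vol N \<omega> = \<omega> {1..N}"

text \<open>
  The component of bidegree \<open>(p, q)\<close> of the comultiplication:
  \<open>e S\<close> is sent to the sum, over \<open>T \<subseteq> S\<close> with \<open>p\<close> elements, of
  \<open>shuffle_sign T (S - T)\<close> times \<open>e T \<otimes> e (S - T)\<close>. Elements of the tensor product are again
  given by their coefficients.
\<close>

definition comult :: "nat \<Rightarrow> nat \<Rightarrow> ext \<Rightarrow> nat set \<Rightarrow> nat set \<Rightarrow> complex" where
  "comult p q \<omega> T R =
     (if T \<inter> R = {} \<and> card T = p \<and> card R = q then shuffle_sign T R * \<omega> (T \<union> R) else 0)"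

text \<open>Apply linear forms \<open>f\<close>, \<open>g\<close> to the two factors of a tensor and multiply.\<close>

definition tensor_apply ::
    "nat \<Rightarrow> (ext \<Rightarrow> complex) \<Rightarrow> (ext \<Rightarrow> complex) \<Rightarrow> (nat set \<Rightarrow> nat set \<Rightarrow> complex) \<Rightarrow> complex" where
  "tensor_apply N f g \<tau> =
     (\<Sum>T\<in>Pow {1..N}. \<Sum>R\<in>Pow {1..N}. \<tau> T R * f (ext_basis T) * g (ext_basis R))"

section \<open>Triples of symplectic flags and their functions\<close>

definition symp_form :: "nat \<Rightarrow> (nat \<Rightarrow> complex) \<Rightarrow> (nat \<Rightarrow> complex) \<Rightarrow> complex" where
  "symp_form n x y =
     (\<Sum>i=1..n. (-1) ^ (i - 1) * (x i * y (2 * n + 1 - i) - x (2 * n + 1 - i) * y i))"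

definition unit_vec :: "nat \<Rightarrow> nat \<Rightarrow> complex" where
  "unit_vec i = (\<lambda>k. if k = i then 1 else 0)"

text \<open>
  A point of \<open>Sp\<^sub>2\<^sub>n / U\<close> is represented by a completion \<open>v 1, \<dots>, v (2n)\<close> to a symplectic basis;
  \<open>v i k\<close> is the \<open>k\<close>-th coordinate of the \<open>i\<close>-th vector. Only \<open>1 \<le> i, k \<le> 2n\<close> matters.
\<close>

type_synonym flag_basis = "nat \<Rightarrow> nat \<Rightarrow> complex"

type_synonym triple = "flag_basis \<times> flag_basis \<times> flag_basis"

definition symp_basis :: "nat \<Rightarrow> flag_basis \<Rightarrow> bool" where
  "symp_basis n v \<longleftrightarrow>
     (\<forall>i\<in>{1..2*n}. \<forall>j\<in>{1..2*n}. symp_form n (v i) (v j) = symp_form n (unit_vec i) (unit_vec j))"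

definition symp_triples :: "nat \<Rightarrow> triple set" where
  "symp_triples n = {(U, V, W). symp_basis n U \<and> symp_basis n V \<and> symp_basis n W}"

text \<open>The form \<open>v 1 \<and> \<dots> \<and> v a\<close>.\<close>

primrec flag_form :: "nat \<Rightarrow> flag_basis \<Rightarrow> nat \<Rightarrow> ext" where
  "flag_form N v 0 = ext_basis {}"
| "flag_form N v (Suc a) = flag_form N v a \<^bold>\<and> ext_vec N (v (Suc a))"

text \<open>
  \<open>[a;b;c]\<close>, for \<open>a + b + c = N\<close> and for \<open>a + b + c = 2N\<close>, where \<open>N = 2n\<close>.

  The factor \<open>(-1)\<^sup>a\<close> in the second case fixes the sign of \<open>[a;b;c]\<close> so that the convention
  \<open>[a,0;b;c] = [a;b;c]\<close> agrees with the formula for \<open>[a,b;c;d]\<close> below at \<open>b = 0\<close>: the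
  expression following that factor differs from that formula by \<open>(-1)\<^sup>a\<close>. (Smallest case, in
  \<open>\<complex>\<^sup>2\<close>: for \<open>[1;1;2]\<close> that expression is \<open>(v \<and> u) * vol W\<close>, the other formula gives
  \<open>vol W * (u \<and> v)\<close>.) This is also the sign for which \<open>[n+i;2n-j;n-i+j] = [n-i;j;n+i-j]\<close>.
\<close>

definition bracket3 :: "nat \<Rightarrow> nat \<Rightarrow> nat \<Rightarrow> nat \<Rightarrow> triple \<Rightarrow> complex" where
  "bracket3 n a b c = (\<lambda>(U, V, W).
     let N = 2 * n; U' = flag_form N U; V' = flag_form N V; W' = flag_form N W in
     if a + b + c = N then vol N (U' a \<^bold>\<and> V' b \<^bold>\<and> W' c)
     else if a + b + c = 2 * N then
       (-1) ^ a *
       tensor_apply N (\<lambda>x. vol N (V' b \<^bold>\<and> x)) (\<lambda>y. vol N (W' c \<^bold>\<and> y))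
         (comult (N - b) (N - c) (U' a))
     else 0)"

text \<open>
  \<open>[a1,a2;c;d] = [a2,a1;c;d]\<close>, used for \<open>a1 + a2 + c + d = 2N\<close> and
  \<open>b \<le> N - c, N - d \<le> a\<close>, where \<open>a\<close> is the larger and \<open>b\<close> the smaller of \<open>a1, a2\<close>.
  The first two branches are the convention \<open>[N,b;c;d] = [b;c;d]\<close>, \<open>[a,0;c;d] = [a;c;d]\<close>.
\<close>

definition bracket4 :: "nat \<Rightarrow> nat \<Rightarrow> nat \<Rightarrow> nat \<Rightarrow> nat \<Rightarrow> triple \<Rightarrow> complex" where
  "bracket4 n a1 a2 c d = (\<lambda>(U, V, W).
     let N = 2 * n; a = max a1 a2; b = min a1 a2;
         U' = flag_form N U; V' = flag_form N V; W' = flag_form N W in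
     if a = N then bracket3 n b c d (U, V, W)
     else if b = 0 then bracket3 n a c d (U, V, W)
     else tensor_apply N (\<lambda>x. vol N (U' b \<^bold>\<and> x \<^bold>\<and> W' d)) (\<lambda>y. vol N (U' a \<^bold>\<and> y))
         (comult (a + c - N) (N - a) (V' c)))"

section \<open>Rational functions\<close>

text \<open>
  Rational functions on \<open>Conf\<^sub>3\<close> are considered as (invariant) rational functions on the irreducible
  variety of triples of symplectic bases, i.e. on \<open>Sp\<^sub>2\<^sub>n \<times> Sp\<^sub>2\<^sub>n \<times> Sp\<^sub>2\<^sub>n\<close>. They are represented by
  total functions, the values outside some nonempty Zariski-open subset being irrelevant; equality
  of rational functions is equality on a nonempty Zariski-open subset.
\<close>

inductive_set poly_funs :: "nat \<Rightarrow> (triple \<Rightarrow> complex) set" for n :: nat where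
  const: "(\<lambda>_. c) \<in> poly_funs n"
| coord1: "i \<in> {1..2*n} \<Longrightarrow> k \<in> {1..2*n} \<Longrightarrow> (\<lambda>(U, V, W). U i k) \<in> poly_funs n"
| coord2: "i \<in> {1..2*n} \<Longrightarrow> k \<in> {1..2*n} \<Longrightarrow> (\<lambda>(U, V, W). V i k) \<in> poly_funs n"
| coord3: "i \<in> {1..2*n} \<Longrightarrow> k \<in> {1..2*n} \<Longrightarrow> (\<lambda>(U, V, W). W i k) \<in> poly_funs n"
| add: "f \<in> poly_funs n \<Longrightarrow> g \<in> poly_funs n \<Longrightarrow> (\<lambda>x. f x + g x) \<in> poly_funs n"
| mult: "f \<in> poly_funs n \<Longrightarrow> g \<in> poly_funs n \<Longrightarrow> (\<lambda>x. f x * g x) \<in> poly_funs n"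

definition generically :: "nat \<Rightarrow> (triple \<Rightarrow> bool) \<Rightarrow> bool" where
  "generically n P \<longleftrightarrow>
     (\<exists>f\<in>poly_funs n. (\<exists>x\<in>symp_triples n. f x \<noteq> 0) \<and> (\<forall>x\<in>symp_triples n. f x \<noteq> 0 \<longrightarrow> P x))"

definition rat_eq :: "nat \<Rightarrow> (triple \<Rightarrow> complex) \<Rightarrow> (triple \<Rightarrow> complex) \<Rightarrow> bool" where
  "rat_eq n f g \<longleftrightarrow> generically n (\<lambda>x. f x = g x)"

section \<open>The seed\<close>

datatype vertex = X nat nat | Y nat

definition vertices :: "nat \<Rightarrow> vertex set" where
  "vertices n = {X i j | i j. i \<le> n \<and> 1 \<le> j \<and> j \<le> n} \<union> {Y k | k. 1 \<le> k \<and> k \<le> n}"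

definition frozen :: "nat \<Rightarrow> vertex set" where
  "frozen n = {Y k | k. 1 \<le> k \<and> k \<le> n} \<union> {X 0 j | j. 1 \<le> j \<and> j \<le> n} \<union> {X n j | j. 1 \<le> j \<and> j \<le> n}"

definition white :: "nat \<Rightarrow> vertex set" where
  "white n = {X i n | i. i \<le> n} \<union> {Y n}"

definition solid_arrows :: "nat \<Rightarrow> (vertex \<times> vertex) set" where
  "solid_arrows n =
     {(X i j, X (i - 1) j) | i j. 1 \<le> i \<and> i \<le> n \<and> 1 \<le> j \<and> j \<le> n} \<union>
     {(X i j, X i (j - 1)) | i j. 1 \<le> i \<and> i \<le> n - 1 \<and> 2 \<le> j \<and> j \<le> n} \<union>
     {(X i 1, Y (n - i)) | i. 1 \<le> i \<and> i \<le> n - 1} \<union>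
     {(Y n, X 1 n)} \<union>
     {(X i j, X (i + 1) (j + 1)) | i j. i \<le> n - 1 \<and> 1 \<le> j \<and> j \<le> n - 1} \<union>
     {(X 0 n, Y n)} \<union>
     {(Y k, X (n - k + 1) 1) | k. 1 \<le> k \<and> k \<le> n - 1}"

definition dotted_arrows :: "nat \<Rightarrow> (vertex \<times> vertex) set" where
  "dotted_arrows n =
     {(X 0 j, X 0 (j - 1)) | j. 2 \<le> j \<and> j \<le> n} \<union>
     {(X n j, X n (j - 1)) | j. 2 \<le> j \<and> j \<le> n} \<union>
     {(Y k, Y (k + 1)) | k. 1 \<le> k \<and> k \<le> n - 1}"

definition init_exch :: "nat \<Rightarrow> vertex \<Rightarrow> vertex \<Rightarrow> rat" where
  "init_exch n p q =
     (let w = (if p \<in> white n \<and> q \<notin> white n then 2 else 1) in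
      if (p, q) \<in> solid_arrows n then w
      else if (q, p) \<in> solid_arrows n then - w
      else if (p, q) \<in> dotted_arrows n then w / 2
      else if (q, p) \<in> dotted_arrows n then - (w / 2)
      else 0)"

primrec init_func :: "nat \<Rightarrow> vertex \<Rightarrow> triple \<Rightarrow> complex" where
  "init_func n (X i j) =
     (if i = 0 then bracket3 n (2 * n - j) 0 j
      else if j \<le> i then bracket3 n (n - i) (n + i - j) j
      else bracket4 n (n - i) (2 * n + i - j) n j)"
| "init_func n (Y k) =
     (\<lambda>(U, V, W). vol (2 * n) (flag_form (2 * n) U k \<^bold>\<and> flag_form (2 * n) V (2 * n - k)))"

record seed =
  exch :: "vertex \<Rightarrow> vertex \<Rightarrow> rat"
  func :: "vertex \<Rightarrow> triple \<Rightarrow> complex"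

definition init_seed :: "nat \<Rightarrow> seed" where
  "init_seed n = \<lparr>exch = init_exch n, func = init_func n\<rparr>"

text \<open>
  Non-integral entries of the exchange matrix occur only between two frozen vertices, hence the
  exponents at an unfrozen \<open>k\<close> are integers and taking \<open>\<lfloor>_\<rfloor>\<close> only changes their type.
\<close>

definition mutate :: "nat \<Rightarrow> vertex \<Rightarrow> seed \<Rightarrow> seed" where
  "mutate n k S =
     (let b = exch S; A = func S in
      \<lparr>exch = (\<lambda>i j. if k = i \<or> k = j then - b i j
                     else if b i k * b k j \<le> 0 then b i j
                     else b i j + \<bar>b i k\<bar> * b k j),
       func = A(k := (\<lambda>x.
         ((\<Prod>j\<in>{j \<in> vertices n. b k j > 0}. A j x ^ nat \<lfloor>b k j\<rfloor>) +
          (\<Prod>j\<in>{j \<in> vertices n. b k j < 0}. A j x ^ nat \<lfloor>- b k j\<rfloor>)) / A k x))\<rparr>)"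

definition seed_after :: "nat \<Rightarrow> vertex list \<Rightarrow> seed" where
  "seed_after n ks = fold (mutate n) ks (init_seed n)"

text \<open>
  The orders of mutation: the \<open>m\<close>-th block for \<open>m = 1, \<dots>, r\<close>, for \<open>r = n-1, \<dots>, 1\<close>, the
  vertices of each block being listed in any order.
\<close>

definition block :: "nat \<Rightarrow> nat \<Rightarrow> vertex set" where
  "block n m = {X i j | i j. 1 \<le> i \<and> i \<le> n - 1 \<and> 1 \<le> j \<and> j \<le> n - 1 \<and> max i j = m}"

definition mutation_schedule :: "nat \<Rightarrow> vertex list \<Rightarrow> bool" where
  "mutation_schedule n ks \<longleftrightarrow>
     (\<exists>bs. ks = concat bs \<and>
        list_all2 (\<lambda>m b. distinct b \<and> set b = block n m)
          (concat (map (\<lambda>r. [1..<r + 1]) (rev [1..<n]))) bs)"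

end

theory Submission
  imports Defs "Jordan_Normal_Form.Determinant"
begin

text \<open>
  Identify the dual of \<open>\<complex>\<^sup>2\<^sup>n\<close> with \<open>\<complex>\<^sup>2\<^sup>n\<close> by the symplectic form. For a symplectic basis \<open>v\<close>,
  wedging with \<open>v\<^sub>1 \<and> \<dots> \<and> v\<^sub>d\<close> then becomes pairing with \<open>v\<^sub>1 \<and> \<dots> \<and> v\<^sub>2\<^sub>n\<^sub>-\<^sub>d\<close>. Hence, up to the sign
  \<open>(-1)\<^sup>a\<close>, the function \<open>[a,b;c;d]\<close> is the Gram determinant of \<open>u\<^sub>1, \<dots>, u\<^sub>b, v\<^sub>1, \<dots>, v\<^sub>c\<close> against
  \<open>w\<^sub>1, \<dots>, w\<^sub>2\<^sub>n\<^sub>-\<^sub>d, u\<^sub>1, \<dots>, u\<^sub>2\<^sub>n\<^sub>-\<^sub>a\<close>, and the Desnanot--Jacobi identity becomes the octahedron relation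
  \<open>[a,b;c;d] [a-1,b-1;c+1;d+1] = [a-1,b;c+1;d] [a,b-1;c;d+1] + [a-1,b;c;d+1] [a,b-1;c+1;d]\<close>.
  All exchange relations of the sequence are instances of it; at the border of the array the
  function with \<open>a + d = b + c = 2n\<close> is the product of two frozen ones.

  The vertices of a block are pairwise disconnected when they are mutated, so that a block acts as
  one simultaneous mutation, and after it the rows of the exchange matrix are again given by one
  local pattern.

  The functions along the sequence are generically nonzero because they are all nonzero on one
  explicit triple: the standard flag, the opposite flag, and a flag given by a moment matrix.
\<close>

text \<open>The brackets are defined by cases; the Gram determinant covers all of them, so one
  octahedron relation suffices. The price is that the signs in the duality must be exact, which
  requires that a symplectic basis have determinant 1. This is read off from the exponential of the
  bivector dual to the form: the bivector is the same for all symplectic bases, and the top part of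
  its exponential is the volume up to a universal sign. Since mutation divides and rational
  functions are encoded as total functions, the run is followed at one triple with numbers in place
  of functions; a single polynomial removes the zeros of the finitely many functions that are
  divided by. Only rows of the exchange matrix are followed, because mutation at \<open>k\<close>
  alters row \<open>p\<close> through its entry at \<open>k\<close> and row \<open>k\<close> alone.
  The mutated vertices are black, so the weights 2 never enter an exchange relation. Moments serve
  for the third flag because a symmetric matrix gives a Lagrangian subspace, and because the Gram
  structure keeps the solid minors in question nonzero.\<close>

lemma power_neg1_eq: "even (a + b) \<Longrightarrow> (-1::complex) ^ a = (-1) ^ b"
  by (cases "even a"; cases "even b") auto

subsection \<open>Signs of shuffles\<close>

text \<open>The sign of sorting \<open>e k\<close> into \<open>e S\<close>, that is
  \<open>shuffle_sign {k} S\<close>; whether \<open>k\<close> itself lies in \<open>S\<close> does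
  not affect it.\<close>

definition position_sign :: "nat \<Rightarrow> nat set \<Rightarrow> complex" where
  "position_sign k S = (-1) ^ card {j \<in> S. j < k}"

lemma position_sign_square [simp]: "position_sign k S * position_sign k S = 1"
  by (simp add: position_sign_def)

lemma position_sign_cancel [simp]: "position_sign k S * (position_sign k S * z) = z"
  by (simp add: position_sign_def)

lemma position_sign_remove [simp]: "position_sign k (S - {k}) = position_sign k S"
  unfolding position_sign_def by (rule arg_cong[where f="\<lambda>A. (-1) ^ card A"]) auto

lemma position_sign_insert_same [simp]: "position_sign k (insert k S) = position_sign k S"
  unfolding position_sign_def by (rule arg_cong[where f="\<lambda>A. (-1) ^ card A"]) auto

lemma position_sign_insert:
  assumes "finite S" "l \<notin> S"
  shows "position_sign k (insert l S) = (if l < k then - position_sign k S else position_sign k S)"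
proof -
  have "{j \<in> insert l S. j < k} = (if l < k then insert l {j \<in> S. j < k} else {j \<in> S. j < k})"
    by auto
  then show ?thesis
    using assms by (simp add: position_sign_def)
qed

lemma finite_inversions:
  assumes "finite A" "finite B"
  shows "finite {(i, j). i \<in> A \<and> j \<in> B \<and> j < (i::nat)}"
  by (rule finite_subset[of _ "A \<times> B"]) (use assms in auto)

lemma shuffle_sign_Un_left:
  assumes "finite A" "finite B" "finite C" "A \<inter> B = {}"
  shows "shuffle_sign (A \<union> B) C = shuffle_sign A C * shuffle_sign B C"
proof -
  have "{(i, j). i \<in> A \<union> B \<and> j \<in> C \<and> j < i} =
      {(i, j). i \<in> A \<and> j \<in> C \<and> j < i} \<union> {(i, j). i \<in> B \<and> j \<in> C \<and> j < i}"
    by auto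
  moreover have "card \<dots> = card {(i, j). i \<in> A \<and> j \<in> C \<and> j < i} + card {(i, j). i \<in> B \<and> j \<in> C \<and> j < i}"
    by (rule card_Un_disjoint) (use assms finite_inversions in auto)
  ultimately show ?thesis
    by (simp add: shuffle_sign_def power_add)
qed

lemma shuffle_sign_Un_right:
  assumes "finite A" "finite B" "finite C" "A \<inter> B = {}"
  shows "shuffle_sign C (A \<union> B) = shuffle_sign C A * shuffle_sign C B"
proof -
  have "{(i, j). i \<in> C \<and> j \<in> A \<union> B \<and> j < i} =
      {(i, j). i \<in> C \<and> j \<in> A \<and> j < i} \<union> {(i, j). i \<in> C \<and> j \<in> B \<and> j < i}"
    by auto
  moreover have "card \<dots> = card {(i, j). i \<in> C \<and> j \<in> A \<and> j < i} + card {(i, j). i \<in> C \<and> j \<in> B \<and> j < i}"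
    by (rule card_Un_disjoint) (use assms finite_inversions in auto)
  ultimately show ?thesis
    by (simp add: shuffle_sign_def power_add)
qed

text \<open>As \<open>A\<close> and \<open>B\<close> are disjoint, every pair in
  \<open>A \<times> B\<close> is an inversion for exactly one of the two orders, so the two
  inversion counts add up to \<open>card A * card B\<close>.\<close>

lemma shuffle_sign_commute:
  assumes "finite A" "finite B" "A \<inter> B = {}"
  shows "shuffle_sign A B = (-1) ^ (card A * card B) * shuffle_sign B A"
proof -
  let ?X = "{(i, j). i \<in> A \<and> j \<in> B \<and> j < i}" and ?Y = "{(i, j). i \<in> B \<and> j \<in> A \<and> j < i}"
  have "A \<times> B = ?X \<union> prod.swap ` ?Y"
    using assms(3) by (auto simp: image_iff)
  moreover have "card (?X \<union> prod.swap ` ?Y) = card ?X + card (prod.swap ` ?Y)"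
    by (rule card_Un_disjoint) (use assms finite_inversions in auto)
  moreover have "card (prod.swap ` ?Y) = card ?Y"
    by (rule card_image) (auto simp: inj_on_def)
  ultimately have "card A * card B = card ?X + card ?Y"
    by (simp flip: card_cartesian_product)
  then show ?thesis
    by (simp add: shuffle_sign_def power_add mult.assoc)
qed

lemma shuffle_sign_empty [simp]: "shuffle_sign {} S = 1" "shuffle_sign S {} = 1"
  by (simp_all add: shuffle_sign_def)

lemma shuffle_sign_singleton [simp]: "shuffle_sign {k} S = position_sign k S"
proof -
  have "{(i, j). i \<in> {k} \<and> j \<in> S \<and> j < i} = Pair k ` {j \<in> S. j < k}"
    by auto
  moreover have "card (Pair k ` {j \<in> S. j < k}) = card {j \<in> S. j < k}"
    by (rule card_image) (auto simp: inj_on_def)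
  ultimately show ?thesis
    by (simp add: shuffle_sign_def position_sign_def)
qed

lemma shuffle_sign_insert_left:
  assumes "finite A" "finite C" "k \<notin> A"
  shows "shuffle_sign (insert k A) C = position_sign k C * shuffle_sign A C"
  using shuffle_sign_Un_left[of "{k}" A C] assms by simp

lemma shuffle_sign_insert_right:
  assumes "finite A" "finite C" "k \<notin> A" "k \<notin> C"
  shows "shuffle_sign C (insert k A) = (-1) ^ card C * position_sign k C * shuffle_sign C A"
  using shuffle_sign_Un_right[of "{k}" A C] shuffle_sign_commute[of C "{k}"] assms by simp

lemma position_sign_Un:
  assumes "finite A" "finite B" "A \<inter> B = {}"
  shows "position_sign k (A \<union> B) = position_sign k A * position_sign k B"
  using shuffle_sign_Un_right[of A B "{k}"] assms by simp

subsection \<open>The wedge product\<close>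

lemma wedge_infinite: "infinite S \<Longrightarrow> (\<alpha> \<^bold>\<and> \<beta>) S = 0"
  by (simp add: wedge_def)

text \<open>Both sides are sums over the ordered partitions of \<open>S\<close> into three parts;
  the signs agree because \<open>shuffle_sign\<close> is multiplicative over disjoint unions in
  either argument.\<close>

lemma wedge_assoc: "(\<alpha> \<^bold>\<and> \<beta>) \<^bold>\<and> \<gamma> = \<alpha> \<^bold>\<and> \<beta> \<^bold>\<and> \<gamma>"
proof
  fix S :: "nat set"
  show "((\<alpha> \<^bold>\<and> \<beta>) \<^bold>\<and> \<gamma>) S = (\<alpha> \<^bold>\<and> \<beta> \<^bold>\<and> \<gamma>) S"
  proof (cases "finite S")
    case True
    have "((\<alpha> \<^bold>\<and> \<beta>) \<^bold>\<and> \<gamma>) S = (\<Sum>(T, R)\<in>Sigma (Pow S) Pow. shuffle_sign T (S - T) *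
        (shuffle_sign R (T - R) * \<alpha> R * \<beta> (T - R)) * \<gamma> (S - T))"
      using True unfolding wedge_def
      by (subst sum.Sigma[symmetric]) (auto simp: sum_distrib_left sum_distrib_right finite_subset)
    also have "\<dots> = (\<Sum>(R, Q)\<in>Sigma (Pow S) (\<lambda>R. Pow (S - R)). shuffle_sign R (S - R) * \<alpha> R *
        (shuffle_sign Q (S - R - Q) * \<beta> Q * \<gamma> (S - R - Q)))"
    proof (rule sum.reindex_bij_witness[where i="\<lambda>(R, Q). (R \<union> Q, R)" and j="\<lambda>(T, R). (R, T - R)"])
      fix p
      assume "p \<in> Sigma (Pow S) Pow"
      then obtain T R where p: "p = (T, R)" "T \<subseteq> S" "R \<subseteq> T"
        by auto
      have "finite T"
        using p True finite_subset by auto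
      then have fin: "finite T" "finite R" "finite (S - T)" "finite (T - R)"
        using p True finite_subset by auto
      have 1: "shuffle_sign T (S - T) = shuffle_sign R (S - T) * shuffle_sign (T - R) (S - T)"
        using shuffle_sign_Un_left[of R "T - R" "S - T"] fin p by (simp add: Un_absorb1)
      have 2: "shuffle_sign R (S - R) = shuffle_sign R (T - R) * shuffle_sign R (S - T)"
      proof -
        have "S - R = (T - R) \<union> (S - T)"
          using p by auto
        then show ?thesis
          using shuffle_sign_Un_right[of "T - R" "S - T" R] fin by auto
      qed
      have 3: "S - R - (T - R) = S - T"
        using p by auto
      show "(case case p of (T, R) \<Rightarrow> (R, T - R) of (R, Q) \<Rightarrow> shuffle_sign R (S - R) * \<alpha> R *
          (shuffle_sign Q (S - R - Q) * \<beta> Q * \<gamma> (S - R - Q))) =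
        (case p of (T, R) \<Rightarrow> shuffle_sign T (S - T) *
          (shuffle_sign R (T - R) * \<alpha> R * \<beta> (T - R)) * \<gamma> (S - T))"
        using p by (simp add: 1 2 3)
    qed auto
    also have "\<dots> = (\<alpha> \<^bold>\<and> \<beta> \<^bold>\<and> \<gamma>) S"
      using True unfolding wedge_def
      by (subst sum.Sigma[symmetric]) (auto simp: sum_distrib_left finite_subset)
    finally show ?thesis .
  qed (simp add: wedge_infinite)
qed

lemma wedge_add_left: "((\<lambda>S. \<alpha> S + \<beta> S) \<^bold>\<and> \<gamma>) = (\<lambda>S. (\<alpha> \<^bold>\<and> \<gamma>) S + (\<beta> \<^bold>\<and> \<gamma>) S)"
  by (rule ext) (simp add: wedge_def sum.distrib algebra_simps)

lemma wedge_add_right: "(\<gamma> \<^bold>\<and> (\<lambda>S. \<alpha> S + \<beta> S)) = (\<lambda>S. (\<gamma> \<^bold>\<and> \<alpha>) S + (\<gamma> \<^bold>\<and> \<beta>) S)"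
  by (rule ext) (simp add: wedge_def sum.distrib algebra_simps)

lemma wedge_scale_left: "((\<lambda>S. c * \<alpha> S) \<^bold>\<and> \<gamma>) = (\<lambda>S. c * (\<alpha> \<^bold>\<and> \<gamma>) S)"
  by (rule ext) (simp add: wedge_def sum_distrib_left algebra_simps)

lemma wedge_scale_right: "(\<gamma> \<^bold>\<and> (\<lambda>S. c * \<alpha> S)) = (\<lambda>S. c * (\<gamma> \<^bold>\<and> \<alpha>) S)"
  by (rule ext) (simp add: wedge_def sum_distrib_left algebra_simps)

lemma wedge_sum_left: "((\<lambda>S. \<Sum>i\<in>I. c i * \<alpha> i S) \<^bold>\<and> \<gamma>) = (\<lambda>S. \<Sum>i\<in>I. c i * (\<alpha> i \<^bold>\<and> \<gamma>) S)"
  unfolding wedge_def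
  by (rule ext, simp only: sum_distrib_left sum_distrib_right, subst sum.swap)
     (simp add: algebra_simps)

lemma wedge_zero_left [simp]: "((\<lambda>S. 0) \<^bold>\<and> \<gamma>) = (\<lambda>S. 0)"
  by (rule ext) (simp add: wedge_def)

lemma wedge_zero_right [simp]: "(\<gamma> \<^bold>\<and> (\<lambda>S. 0)) = (\<lambda>S. 0)"
  by (rule ext) (simp add: wedge_def)

text \<open>The type \<open>ext\<close> also contains families with coefficients at infinite sets or
  at sets outside \<open>{1..N}\<close>. Here the homogeneous elements of the exterior algebra
  proper are singled out; the degree is recorded because the sign rules depend on it.\<close>

definition form :: "nat \<Rightarrow> nat \<Rightarrow> ext \<Rightarrow> bool" where
  "form N p \<alpha> \<longleftrightarrow> (\<forall>S. \<alpha> S \<noteq> 0 \<longrightarrow> S \<subseteq> {1..N} \<and> card S = p)"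

lemma formD: "form N p \<alpha> \<Longrightarrow> \<alpha> S \<noteq> 0 \<Longrightarrow> S \<subseteq> {1..N} \<and> card S = p \<and> finite S"
  unfolding form_def using finite_subset by blast

lemma form_eq_0:
  assumes "form N p \<alpha>" "p > N"
  shows "\<alpha> = (\<lambda>S. 0)"
proof
  fix S
  have "card S \<le> N" if "S \<subseteq> {1..N}"
    using card_mono[OF _ that] by simp
  then show "\<alpha> S = 0"
    using assms unfolding form_def by fastforce
qed

lemma form_wedge:
  assumes "form N p \<alpha>" "form N q \<beta>"
  shows "form N (p + q) (\<alpha> \<^bold>\<and> \<beta>)"
  unfolding form_def
proof (intro allI impI)
  fix S
  assume nz: "(\<alpha> \<^bold>\<and> \<beta>) S \<noteq> 0"
  then have fin: "finite S"
    using wedge_infinite by blast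
  from nz obtain T where T: "T \<subseteq> S" "\<alpha> T \<noteq> 0" "\<beta> (S - T) \<noteq> 0"
    unfolding wedge_def by (metis (no_types, lifting) PowD mult_eq_0_iff sum.neutral)
  then have "card S = card T + card (S - T)"
    using fin by (simp add: card_Diff_subset card_mono finite_subset)
  then show "S \<subseteq> {1..N} \<and> card S = p + q"
    using formD[OF assms(1) T(2)] formD[OF assms(2) T(3)] T(1) by auto
qed

lemma form_zero [simp]: "form N p (\<lambda>S. 0)"
  by (simp add: form_def)

lemma form_add: "form N p \<alpha> \<Longrightarrow> form N p \<beta> \<Longrightarrow> form N p (\<lambda>S. \<alpha> S + \<beta> S)"
  unfolding form_def by (metis add_0)

lemma form_scale: "form N p \<alpha> \<Longrightarrow> form N p (\<lambda>S. c * \<alpha> S)"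
  unfolding form_def by auto

lemma form_basis: "S \<subseteq> {1..N} \<Longrightarrow> form N (card S) (ext_basis S)"
  by (simp add: form_def ext_basis_def)

lemma wedge_commute:
  assumes "form N p \<alpha>" "form N q \<beta>"
  shows "\<alpha> \<^bold>\<and> \<beta> = (\<lambda>S. (-1) ^ (p * q) * (\<beta> \<^bold>\<and> \<alpha>) S)"
proof
  fix S
  show "(\<alpha> \<^bold>\<and> \<beta>) S = (-1) ^ (p * q) * (\<beta> \<^bold>\<and> \<alpha>) S"
  proof (cases "finite S")
    case True
    have "(\<alpha> \<^bold>\<and> \<beta>) S = (\<Sum>T\<in>Pow S. (-1) ^ (p * q) * (shuffle_sign T (S - T) * \<beta> T * \<alpha> (S - T)))"
      unfolding wedge_def
    proof (rule sum.reindex_bij_witness[where i="\<lambda>T. S - T" and j="\<lambda>T. S - T"])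
      fix T
      assume T: "T \<in> Pow S"
      show "(-1) ^ (p * q) * (shuffle_sign (S - T) (S - (S - T)) * \<beta> (S - T) * \<alpha> (S - (S - T))) =
        shuffle_sign T (S - T) * \<alpha> T * \<beta> (S - T)"
      proof (cases "\<alpha> T = 0 \<or> \<beta> (S - T) = 0")
        case True
        with T show ?thesis by (auto simp: double_diff)
      next
        case nz: False
        then have "card T = p" "card (S - T) = q"
          using formD[OF assms(1)] formD[OF assms(2)] by blast+
        moreover have "finite T" "finite (S - T)"
          using T True finite_subset by auto
        ultimately have "shuffle_sign T (S - T) = (-1) ^ (p * q) * shuffle_sign (S - T) T"
          using shuffle_sign_commute[of T "S - T"] by auto
        then show ?thesis
          using T by (simp add: double_diff)
      qed
    qed (auto simp: double_diff)
    then show ?thesis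
      by (simp add: wedge_def sum_distrib_left)
  qed (simp add: wedge_infinite)
qed

lemma wedge_one_left_finite:
  assumes "\<And>S. infinite S \<Longrightarrow> \<alpha> S = 0"
  shows "ext_basis {} \<^bold>\<and> \<alpha> = \<alpha>"
proof
  fix S
  show "(ext_basis {} \<^bold>\<and> \<alpha>) S = \<alpha> S"
  proof (cases "finite S")
    case True
    have "(ext_basis {} \<^bold>\<and> \<alpha>) S = (\<Sum>T\<in>Pow S. if T = {} then \<alpha> S else 0)"
      unfolding wedge_def by (rule sum.cong) (auto simp: ext_basis_def)
    then show ?thesis
      using True by simp
  qed (simp add: assms wedge_infinite)
qed

lemma wedge_one_left:
  assumes "form N p \<alpha>"
  shows "ext_basis {} \<^bold>\<and> \<alpha> = \<alpha>"
  using formD[OF assms] by (intro wedge_one_left_finite) blast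

lemma wedge_one_right:
  assumes "form N p \<alpha>"
  shows "\<alpha> \<^bold>\<and> ext_basis {} = \<alpha>"
  using wedge_commute[OF assms form_basis[of "{}" N]] wedge_one_left[OF assms] by simp

lemma ext_vec_singleton: "ext_vec N x {k} = (if k \<in> {1..N} then x k else 0)"
proof -
  have "ext_vec N x {k} = (\<Sum>i=1..N. if k = i then x i else 0)"
    unfolding ext_vec_def ext_basis_def by (rule sum.cong) auto
  then show ?thesis
    by simp
qed

lemma form_ext_vec [simp]: "form N 1 (ext_vec N x)" "form N (Suc 0) (ext_vec N x)"
proof -
  show "form N 1 (ext_vec N x)"
    unfolding form_def
  proof (intro allI impI)
    fix S
    assume "ext_vec N x S \<noteq> 0"
    then obtain k where "k \<in> {1..N}" "ext_basis {k} S \<noteq> 0"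
      unfolding ext_vec_def by (metis (no_types, lifting) mult_eq_0_iff sum.neutral)
    then show "S \<subseteq> {1..N} \<and> card S = 1"
      by (auto simp: ext_basis_def split: if_splits)
  qed
  then show "form N (Suc 0) (ext_vec N x)"
    by simp
qed

lemma ext_vec_cong: "(\<And>k. k \<in> {1..N} \<Longrightarrow> x k = y k) \<Longrightarrow> ext_vec N x = ext_vec N y"
  unfolding ext_vec_def by (intro ext sum.cong) auto

lemma ext_vec_add: "ext_vec N (\<lambda>k. x k + y k) = (\<lambda>S. ext_vec N x S + ext_vec N y S)"
  by (rule ext) (simp add: ext_vec_def sum.distrib algebra_simps)

lemma ext_vec_scale: "ext_vec N (\<lambda>k. c * x k) = (\<lambda>S. c * ext_vec N x S)"
  by (rule ext) (simp add: ext_vec_def sum_distrib_left algebra_simps)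

lemma ext_vec_sum: "ext_vec N (\<lambda>k. \<Sum>i\<in>I. c i * x i k) = (\<lambda>S. \<Sum>i\<in>I. c i * ext_vec N (x i) S)"
  unfolding ext_vec_def
  by (rule ext, simp only: sum_distrib_left sum_distrib_right, subst sum.swap)
     (simp add: algebra_simps)

lemma wedge_vec_vec: "ext_vec N x \<^bold>\<and> ext_vec N y \<^bold>\<and> \<alpha> = (\<lambda>S. - (ext_vec N y \<^bold>\<and> ext_vec N x \<^bold>\<and> \<alpha>) S)"
proof -
  have "ext_vec N x \<^bold>\<and> ext_vec N y = (\<lambda>S. (-1) * (ext_vec N y \<^bold>\<and> ext_vec N x) S)"
    using wedge_commute[of N 1 "ext_vec N x" 1 "ext_vec N y"] by simp
  then have "(ext_vec N x \<^bold>\<and> ext_vec N y) \<^bold>\<and> \<alpha> = (\<lambda>S. (-1) * ((ext_vec N y \<^bold>\<and> ext_vec N x) \<^bold>\<and> \<alpha>) S)"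
    by (simp only: wedge_scale_left)
  then show ?thesis
    by (simp add: wedge_assoc)
qed

lemma wedge_vec_same [simp]: "ext_vec N x \<^bold>\<and> ext_vec N x \<^bold>\<and> \<alpha> = (\<lambda>S. 0)"
proof
  fix S
  show "(ext_vec N x \<^bold>\<and> ext_vec N x \<^bold>\<and> \<alpha>) S = 0"
    using fun_cong[OF wedge_vec_vec[of N x x \<alpha>], of S] by simp
qed

subsection \<open>Contraction and pairing\<close>

text \<open>The interior product with the \<open>k\<close>-th coordinate functional. In
  \<open>contract\<close>, vectors act as covectors by means of the bilinear \<open>dot\<close>, so
  that no dual space has to be introduced.\<close>

definition annihilate :: "nat \<Rightarrow> ext \<Rightarrow> ext" where
  "annihilate k \<alpha> = (\<lambda>S. if k \<in> S then 0 else position_sign k S * \<alpha> (insert k S))"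

definition contract :: "nat \<Rightarrow> (nat \<Rightarrow> complex) \<Rightarrow> ext \<Rightarrow> ext" where
  "contract N x \<alpha> = (\<lambda>S. \<Sum>k=1..N. x k * annihilate k \<alpha> S)"

definition pairing :: "nat \<Rightarrow> ext \<Rightarrow> ext \<Rightarrow> complex" where
  "pairing N \<alpha> \<beta> = (\<Sum>S\<in>Pow {1..N}. \<alpha> S * \<beta> S)"

definition dot :: "nat \<Rightarrow> (nat \<Rightarrow> complex) \<Rightarrow> (nat \<Rightarrow> complex) \<Rightarrow> complex" where
  "dot N x y = (\<Sum>k=1..N. x k * y k)"

lemma dot_commute: "dot N x y = dot N y x"
  by (simp add: dot_def mult.commute)

lemma pairing_commute: "pairing N \<alpha> \<beta> = pairing N \<beta> \<alpha>"
  by (simp add: pairing_def mult.commute)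

lemma pairing_scale_left: "pairing N (\<lambda>S. c * \<alpha> S) \<gamma> = c * pairing N \<alpha> \<gamma>"
  by (simp add: pairing_def algebra_simps sum_distrib_left)

lemma pairing_scale_right: "pairing N \<gamma> (\<lambda>S. c * \<alpha> S) = c * pairing N \<gamma> \<alpha>"
  by (simp add: pairing_def algebra_simps sum_distrib_left)

lemma pairing_sum_right: "pairing N \<gamma> (\<lambda>S. \<Sum>i\<in>I. c i * \<alpha> i S) = (\<Sum>i\<in>I. c i * pairing N \<gamma> (\<alpha> i))"
  unfolding pairing_def by (simp only: sum_distrib_left, subst sum.swap) (simp add: algebra_simps)

lemma pairing_basis: "S \<subseteq> {1..N} \<Longrightarrow> pairing N (ext_basis S) \<alpha> = \<alpha> S"
proof -
  assume S: "S \<subseteq> {1..N}"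
  have "pairing N (ext_basis S) \<alpha> = (\<Sum>T\<in>Pow {1..N}. if T = S then \<alpha> S else 0)"
    unfolding pairing_def ext_basis_def by (rule sum.cong) auto
  then show ?thesis
    using S by simp
qed

lemma vol_wedge:
  "vol N (\<alpha> \<^bold>\<and> \<beta>) = pairing N \<alpha> (\<lambda>T. shuffle_sign T ({1..N} - T) * \<beta> ({1..N} - T))"
  unfolding vol_def wedge_def pairing_def by (rule sum.cong) auto

lemma ext_vec_wedge:
  assumes "finite S"
  shows "(ext_vec N x \<^bold>\<and> \<alpha>) S = (\<Sum>k=1..N. if k \<in> S then position_sign k S * x k * \<alpha> (S - {k}) else 0)"
proof -
  have 1: "(ext_basis {k} \<^bold>\<and> \<alpha>) S = (if k \<in> S then position_sign k S * \<alpha> (S - {k}) else 0)" for k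
  proof -
    have "(ext_basis {k} \<^bold>\<and> \<alpha>) S =
        (\<Sum>T\<in>Pow S. if T = {k} then position_sign k S * \<alpha> (S - {k}) else 0)"
      unfolding wedge_def by (rule sum.cong) (auto simp: ext_basis_def)
    then show ?thesis
      using assms by simp
  qed
  have "(ext_vec N x \<^bold>\<and> \<alpha>) S = (\<Sum>k=1..N. x k * (ext_basis {k} \<^bold>\<and> \<alpha>) S)"
    unfolding ext_vec_def by (subst wedge_sum_left) simp
  also have "\<dots> = (\<Sum>k=1..N. if k \<in> S then position_sign k S * x k * \<alpha> (S - {k}) else 0)"
    by (rule sum.cong) (auto simp: 1)
  finally show ?thesis .
qed

text \<open>Wedging with a vector from the left and contraction are adjoint: removing
  \<open>k\<close> from \<open>S\<close> matches the terms with \<open>k \<in> S\<close> on one side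
  with those with \<open>k \<notin> S\<close> on the other.\<close>

lemma pairing_vec_wedge: "pairing N (ext_vec N x \<^bold>\<and> \<alpha>) \<beta> = pairing N \<alpha> (contract N x \<beta>)"
proof -
  have "pairing N (ext_vec N x \<^bold>\<and> \<alpha>) \<beta> = (\<Sum>S\<in>Pow {1..N}. \<Sum>k=1..N.
      if k \<in> S then position_sign k S * x k * \<alpha> (S - {k}) * \<beta> S else 0)"
    unfolding pairing_def
  proof (rule sum.cong[OF refl])
    fix S
    assume "S \<in> Pow {1..N}"
    then have "finite S"
      using finite_subset by auto
    then show "(ext_vec N x \<^bold>\<and> \<alpha>) S * \<beta> S =
        (\<Sum>k=1..N. if k \<in> S then position_sign k S * x k * \<alpha> (S - {k}) * \<beta> S else 0)"
      by (subst ext_vec_wedge) (auto simp: sum_distrib_right intro!: sum.cong)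
  qed
  also have "\<dots> = (\<Sum>k=1..N. \<Sum>S\<in>Pow {1..N}.
      if k \<in> S then position_sign k S * x k * \<alpha> (S - {k}) * \<beta> S else 0)"
    by (rule sum.swap)
  also have "\<dots> = (\<Sum>k=1..N. \<Sum>S\<in>Pow {1..N}. \<alpha> S * (x k * annihilate k \<beta> S))"
  proof (rule sum.cong[OF refl])
    fix k
    assume k: "k \<in> {1..N}"
    have "(\<Sum>S\<in>Pow {1..N}. if k \<in> S then position_sign k S * x k * \<alpha> (S - {k}) * \<beta> S else 0) =
        (\<Sum>S\<in>{S \<in> Pow {1..N}. k \<in> S}. position_sign k S * x k * \<alpha> (S - {k}) * \<beta> S)"
      by (rule sum.mono_neutral_cong_right) auto
    also have "\<dots> = (\<Sum>S\<in>{S \<in> Pow {1..N}. k \<notin> S}. \<alpha> S * (x k * annihilate k \<beta> S))"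
      by (rule sum.reindex_bij_witness[where i="insert k" and j="\<lambda>S. S - {k}"])
         (use k in \<open>auto simp: annihilate_def insert_absorb\<close>)
    also have "\<dots> = (\<Sum>S\<in>Pow {1..N}. \<alpha> S * (x k * annihilate k \<beta> S))"
      by (rule sum.mono_neutral_cong_left) (auto simp: annihilate_def)
    finally show "(\<Sum>S\<in>Pow {1..N}. if k \<in> S then position_sign k S * x k * \<alpha> (S - {k}) * \<beta> S else 0) =
        (\<Sum>S\<in>Pow {1..N}. \<alpha> S * (x k * annihilate k \<beta> S))" .
  qed
  also have "\<dots> = pairing N \<alpha> (contract N x \<beta>)"
    unfolding pairing_def contract_def by (subst sum.swap) (simp add: sum_distrib_left)
  finally show ?thesis .
qed

lemma sum_Pow_insert:
  assumes "finite S" "k \<notin> S"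
  shows "(\<Sum>T\<in>Pow (insert k S). f T) = (\<Sum>T\<in>Pow S. f T + f (insert k T) :: complex)"
proof -
  have "inj_on (insert k) (Pow S)"
    using assms(2) unfolding inj_on_def by (metis PowD insert_ident subsetD)
  then show ?thesis
    using assms by (subst Pow_insert, subst sum.union_disjoint)
      (auto simp: sum.reindex sum.distrib)
qed

text \<open>If \<open>k \<notin> S\<close>, the subsets of \<open>insert k S\<close> that contain
  \<open>k\<close> give the first term and the others give the second. If \<open>k \<in> S\<close>,
  the left side is 0, and on the right the terms of the first product with \<open>k\<close> in the
  second factor cancel those of the second product with \<open>k\<close> in the first
  factor.\<close>

lemma annihilate_wedge:
  assumes "form N p \<alpha>"
  shows "annihilate k (\<alpha> \<^bold>\<and> \<beta>) = (\<lambda>S. (annihilate k \<alpha> \<^bold>\<and> \<beta>) S + (-1) ^ p * (\<alpha> \<^bold>\<and> annihilate k \<beta>) S)"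
proof
  fix S
  consider "infinite S" | "finite S" "k \<notin> S" | Q where "finite Q" "k \<notin> Q" "S = insert k Q"
    by (metis finite_insert mk_disjoint_insert)
  then show "annihilate k (\<alpha> \<^bold>\<and> \<beta>) S = (annihilate k \<alpha> \<^bold>\<and> \<beta>) S + (-1) ^ p * (\<alpha> \<^bold>\<and> annihilate k \<beta>) S"
  proof cases
    case 1
    then show ?thesis
      by (simp add: annihilate_def wedge_infinite)
  next
    case 2
    have "annihilate k (\<alpha> \<^bold>\<and> \<beta>) S = position_sign k S * (\<Sum>T\<in>Pow S.
        shuffle_sign T (insert k S - T) * \<alpha> T * \<beta> (insert k S - T) +
        shuffle_sign (insert k T) (insert k S - insert k T) * \<alpha> (insert k T) * \<beta> (insert k S - insert k T))"
      using 2 by (simp add: annihilate_def wedge_def sum_Pow_insert)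
    also have "\<dots> = (\<Sum>T\<in>Pow S. shuffle_sign T (S - T) * annihilate k \<alpha> T * \<beta> (S - T) +
        (-1) ^ p * (shuffle_sign T (S - T) * \<alpha> T * annihilate k \<beta> (S - T)))"
      unfolding sum_distrib_left
    proof (rule sum.cong[OF refl])
      fix T
      assume "T \<in> Pow S"
      then have T: "T \<subseteq> S" "k \<notin> T" "k \<notin> S - T" "finite T" "finite (S - T)"
        using 2 finite_subset by auto
      have S: "position_sign k S = position_sign k T * position_sign k (S - T)"
        using position_sign_Un[of T "S - T" k] T by (simp add: Un_absorb1)
      have 1: "insert k S - T = insert k (S - T)" "insert k S - insert k T = S - T"
        using T 2 by auto
      have 3: "\<alpha> T \<noteq> 0 \<Longrightarrow> card T = p"
        using formD[OF assms] by blast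
      show "position_sign k S * (shuffle_sign T (insert k S - T) * \<alpha> T * \<beta> (insert k S - T) +
          shuffle_sign (insert k T) (insert k S - insert k T) * \<alpha> (insert k T) * \<beta> (insert k S - insert k T)) =
        shuffle_sign T (S - T) * annihilate k \<alpha> T * \<beta> (S - T) +
        (-1) ^ p * (shuffle_sign T (S - T) * \<alpha> T * annihilate k \<beta> (S - T))"
        unfolding 1 S using T 3
        by (cases "\<alpha> T = 0")
           (simp_all add: shuffle_sign_insert_left shuffle_sign_insert_right annihilate_def algebra_simps)
    qed
    also have "\<dots> = (annihilate k \<alpha> \<^bold>\<and> \<beta>) S + (-1) ^ p * (\<alpha> \<^bold>\<and> annihilate k \<beta>) S"
      by (simp add: wedge_def sum.distrib sum_distrib_left)
    finally show ?thesis .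
  next
    case 3
    have "(annihilate k \<alpha> \<^bold>\<and> \<beta>) S + (-1) ^ p * (\<alpha> \<^bold>\<and> annihilate k \<beta>) S =
      (\<Sum>T\<in>Pow Q. (shuffle_sign T (S - T) * annihilate k \<alpha> T * \<beta> (S - T) +
        shuffle_sign (insert k T) (S - insert k T) * annihilate k \<alpha> (insert k T) * \<beta> (S - insert k T)) +
        (-1) ^ p * (shuffle_sign T (S - T) * \<alpha> T * annihilate k \<beta> (S - T) +
        shuffle_sign (insert k T) (S - insert k T) * \<alpha> (insert k T) * annihilate k \<beta> (S - insert k T)))"
      unfolding wedge_def 3(3) using 3(1,2)
      by (simp add: sum_Pow_insert sum.distrib sum_distrib_left[symmetric])
    also have "\<dots> = (\<Sum>T\<in>Pow Q. 0)"
    proof (rule sum.cong[OF refl])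
      fix T
      assume "T \<in> Pow Q"
      then have T: "T \<subseteq> Q" "k \<notin> T" "k \<notin> Q - T" "finite T" "finite (Q - T)"
        using 3 finite_subset by auto
      have 1: "S - T = insert k (Q - T)" "S - insert k T = Q - T"
        using T 3 by auto
      have 2: "\<alpha> (insert k T) \<noteq> 0 \<Longrightarrow> p = Suc (card T)"
        using formD[OF assms] T by force
      show "(shuffle_sign T (S - T) * annihilate k \<alpha> T * \<beta> (S - T) +
        shuffle_sign (insert k T) (S - insert k T) * annihilate k \<alpha> (insert k T) * \<beta> (S - insert k T)) +
        (-1) ^ p * (shuffle_sign T (S - T) * \<alpha> T * annihilate k \<beta> (S - T) +
        shuffle_sign (insert k T) (S - insert k T) * \<alpha> (insert k T) * annihilate k \<beta> (S - insert k T)) = 0"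
        unfolding 1 using T 2
        by (cases "\<alpha> (insert k T) = 0")
           (simp_all add: shuffle_sign_insert_left shuffle_sign_insert_right annihilate_def algebra_simps)
    qed
    finally show ?thesis
      using 3 by (simp add: annihilate_def)
  qed
qed

lemma wedge_sum_right: "(\<gamma> \<^bold>\<and> (\<lambda>S. \<Sum>i\<in>I. c i * \<alpha> i S)) = (\<lambda>S. \<Sum>i\<in>I. c i * (\<gamma> \<^bold>\<and> \<alpha> i) S)"
  unfolding wedge_def
  by (rule ext, simp only: sum_distrib_left, subst sum.swap) (simp add: algebra_simps)

lemma contract_wedge:
  assumes "form N p \<alpha>"
  shows "contract M x (\<alpha> \<^bold>\<and> \<beta>) = (\<lambda>S. (contract M x \<alpha> \<^bold>\<and> \<beta>) S + (-1) ^ p * (\<alpha> \<^bold>\<and> contract M x \<beta>) S)"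
  unfolding contract_def annihilate_wedge[OF assms] wedge_sum_left wedge_sum_right
  by (rule ext) (simp add: sum.distrib sum_distrib_left algebra_simps)

lemma form_annihilate: "form N p \<alpha> \<Longrightarrow> form N (p - 1) (annihilate k \<alpha>)"
  unfolding form_def
proof (intro allI impI)
  fix S
  assume \<alpha>: "\<forall>S. \<alpha> S \<noteq> 0 \<longrightarrow> S \<subseteq> {1..N} \<and> card S = p" and "annihilate k \<alpha> S \<noteq> 0"
  then have "k \<notin> S" "\<alpha> (insert k S) \<noteq> 0"
    by (auto simp: annihilate_def split: if_splits)
  then have S: "insert k S \<subseteq> {1..N}" "card (insert k S) = p"
    using \<alpha> by auto
  then have "finite S"
    using finite_subset[OF S(1)] by auto
  then show "S \<subseteq> {1..N} \<and> card S = p - 1"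
    using S \<open>k \<notin> S\<close> by auto
qed

lemma form_sum: "(\<And>i. i \<in> I \<Longrightarrow> form N p (\<alpha> i)) \<Longrightarrow> form N p (\<lambda>S. \<Sum>i\<in>I. c i * \<alpha> i S)"
  unfolding form_def by (metis (no_types, lifting) mult_eq_0_iff sum.neutral)

lemma form_contract: "form N p \<alpha> \<Longrightarrow> form N (p - 1) (contract M x \<alpha>)"
  unfolding contract_def by (intro form_sum form_annihilate)

lemma contract_scale: "contract M x (\<lambda>S. c * \<alpha> S) = (\<lambda>S. c * contract M x \<alpha> S)"
  by (rule ext) (simp add: contract_def annihilate_def sum_distrib_left algebra_simps if_distrib cong: if_cong)

lemma contract_zero [simp]: "contract M x (\<lambda>S. 0) = (\<lambda>S. 0)"
  by (rule ext) (auto simp: contract_def annihilate_def intro: sum.neutral)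

lemma annihilate_anticommute:
  assumes "form N p \<alpha>"
  shows "annihilate k (annihilate l \<alpha>) S = - annihilate l (annihilate k \<alpha>) S"
proof (cases "finite S")
  case True
  then show ?thesis
    by (cases "k = l"; cases k l rule: linorder_cases)
       (auto simp: annihilate_def position_sign_insert insert_commute)
next
  case False
  then have "\<alpha> (insert k (insert l S)) = 0" "\<alpha> (insert l (insert k S)) = 0"
    using formD[OF assms] by (metis finite_insert)+
  then show ?thesis
    by (auto simp: annihilate_def)
qed

lemma contract_anticommute:
  assumes "form N p \<alpha>"
  shows "contract M x (contract M y \<alpha>) = (\<lambda>S. - contract M y (contract M x \<alpha>) S)"
proof -
  have 1: "contract M x (contract M y \<alpha>) S =
      (\<Sum>k=1..M. \<Sum>l=1..M. x k * y l * annihilate k (annihilate l \<alpha>) S)" for x y S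
    unfolding contract_def
    by (rule sum.cong[OF refl], subst annihilate_def)
       (auto simp: annihilate_def sum_distrib_left algebra_simps intro!: sum.cong)
  show ?thesis
  proof
    fix S
    show "contract M x (contract M y \<alpha>) S = - contract M y (contract M x \<alpha>) S"
      unfolding 1 by (subst (2) sum.swap, subst annihilate_anticommute[OF assms])
        (simp add: sum_negf algebra_simps)
  qed
qed

lemma contract_basis_empty [simp]: "contract M x (ext_basis {}) = (\<lambda>S. 0)"
  by (rule ext) (auto simp: contract_def annihilate_def ext_basis_def intro: sum.neutral)

lemma contract_ext_vec: "contract N x (ext_vec N y) = (\<lambda>S. dot N x y * ext_basis {} S)"
proof
  fix S
  have "annihilate k (ext_vec N y) S = (if k \<in> {1..N} then y k else 0) * ext_basis {} S" for k
  proof (cases "S = {}")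
    case True
    then show ?thesis
      using ext_vec_singleton[of N y k] by (simp add: annihilate_def ext_basis_def position_sign_def)
  next
    case False
    have "ext_vec N y (insert k S) = 0" if "k \<notin> S"
    proof (rule ccontr)
      assume "ext_vec N y (insert k S) \<noteq> 0"
      then have "card (insert k S) = 1" "finite (insert k S)"
        using formD[OF form_ext_vec(1), of N y "insert k S"] by simp_all
      with that False show False
        by auto
    qed
    with False show ?thesis
      by (auto simp: annihilate_def ext_basis_def)
  qed
  then show "contract N x (ext_vec N y) S = dot N x y * ext_basis {} S"
    by (auto simp: contract_def dot_def sum_distrib_right intro!: sum.cong)
qed

text \<open>Stated without a degree because it is applied to the inhomogeneous forms
  \<open>exp_pairs\<close>; vanishing on infinite sets is what lets \<open>ext_basis {}\<close> act
  as a unit.\<close>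

lemma contract_vec_wedge_finite:
  assumes "\<And>S. infinite S \<Longrightarrow> \<alpha> S = 0"
  shows "contract N x (ext_vec N y \<^bold>\<and> \<alpha>) = (\<lambda>S. dot N x y * \<alpha> S - (ext_vec N y \<^bold>\<and> contract N x \<alpha>) S)"
  using contract_wedge[OF form_ext_vec(1), of N x N y \<alpha>]
  by (simp add: contract_ext_vec wedge_scale_left wedge_one_left_finite[OF assms])

lemma contract_vec_wedge:
  assumes "form N p \<alpha>"
  shows "contract N x (ext_vec N y \<^bold>\<and> \<alpha>) = (\<lambda>S. dot N x y * \<alpha> S - (ext_vec N y \<^bold>\<and> contract N x \<alpha>) S)"
  using formD[OF assms] by (intro contract_vec_wedge_finite) blast

subsection \<open>Products of vectors\<close>

text \<open>Nested to the right, so that wedging and contracting from the left follow the recursion;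
  \<open>flag_form\<close> is nested to the left.\<close>

primrec wedges :: "nat \<Rightarrow> (nat \<Rightarrow> complex) list \<Rightarrow> ext" where
  "wedges N [] = ext_basis {}"
| "wedges N (x # xs) = ext_vec N x \<^bold>\<and> wedges N xs"

lemma form_wedges [simp]: "form N (length xs) (wedges N xs)"
proof (induction xs)
  case Nil
  show ?case
    using form_basis[of "{}" N] by simp
next
  case (Cons x xs)
  then show ?case
    using form_wedge[OF form_ext_vec(1) Cons] by simp
qed

lemma form_wedges_length: "length xs = p \<Longrightarrow> form N p (wedges N xs)"
  by (metis form_wedges)

lemma wedges_append: "wedges N (xs @ ys) = wedges N xs \<^bold>\<and> wedges N ys"
  by (induction xs) (simp_all add: wedge_one_left[OF form_wedges] wedge_assoc)

definition flag_vectors :: "flag_basis \<Rightarrow> nat \<Rightarrow> (nat \<Rightarrow> complex) list" where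
  "flag_vectors v a = map v [1..<Suc a]"

lemma length_flag_vectors [simp]: "length (flag_vectors v a) = a"
  by (simp add: flag_vectors_def)

lemma flag_vectors_Suc: "flag_vectors v (Suc a) = flag_vectors v a @ [v (Suc a)]"
  by (simp add: flag_vectors_def)

lemma nth_flag_vectors [simp]: "i < a \<Longrightarrow> flag_vectors v a ! i = v (Suc i)"
  by (simp add: flag_vectors_def del: upt_Suc)

lemma set_flag_vectors: "set (flag_vectors v a) = v ` {1..a}"
  by (auto simp: flag_vectors_def)

lemma flag_form_eq_wedges: "flag_form N v a = wedges N (flag_vectors v a)"
  by (induction a)
     (simp_all add: flag_vectors_Suc wedges_append wedge_one_right[OF form_ext_vec(1)],
      simp add: flag_vectors_def)

lemma wedges_repeated:
  assumes "x \<in> set xs"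
  shows "ext_vec N x \<^bold>\<and> wedges N xs = (\<lambda>S. 0)"
  using assms
proof (induction xs)
  case (Cons y ys)
  show ?case
  proof (cases "x = y")
    case False
    with Cons have "ext_vec N x \<^bold>\<and> wedges N ys = (\<lambda>S. 0)"
      by auto
    then show ?thesis
      by (simp add: wedge_vec_vec[of N x])
  qed simp
qed simp

lemma wedges_move:
  "wedges N (xs @ x # ys) = (\<lambda>S. (-1) ^ length xs * wedges N (x # xs @ ys) S)"
proof (induction xs)
  case (Cons z zs)
  have "wedges N ((z # zs) @ x # ys) = (\<lambda>S. (-1) ^ length zs * (ext_vec N z \<^bold>\<and> ext_vec N x \<^bold>\<and> wedges N (zs @ ys)) S)"
    by (simp add: Cons wedge_scale_right)
  then show ?case
    by (simp add: wedge_vec_vec[of N z x])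
qed simp

lemma contract_wedges_0:
  "(\<And>y. y \<in> set ys \<Longrightarrow> dot N x y = 0) \<Longrightarrow> contract N x (wedges N ys) = (\<lambda>S. 0)"
  by (induction ys) (simp_all add: contract_vec_wedge[OF form_wedges])

lemma contract_wedges_wedge:
  assumes "\<And>y. y \<in> set ys \<Longrightarrow> dot N x y = 0"
  shows "contract N x (wedges N ys \<^bold>\<and> \<alpha>) = (\<lambda>S. (-1) ^ length ys * (wedges N ys \<^bold>\<and> contract N x \<alpha>) S)"
  using contract_wedge[OF form_wedges, of N x N ys \<alpha>] contract_wedges_0[OF assms, of ys] by simp

lemma contract_wedges:
  "contract N x (wedges N ys) =
    (\<lambda>S. \<Sum>j<length ys. (-1) ^ j * dot N x (ys ! j) * wedges N (take j ys @ drop (Suc j) ys) S)"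
proof (induction ys)
  case (Cons y ys)
  have "contract N x (wedges N (y # ys)) = (\<lambda>S. dot N x y * wedges N ys S -
      (\<Sum>j<length ys. (-1) ^ j * dot N x (ys ! j) * wedges N (y # take j ys @ drop (Suc j) ys) S))"
    by (simp add: contract_vec_wedge[OF form_wedges] Cons wedge_sum_right)
  then show ?case
    by (simp only: length_Cons sum.lessThan_Suc_shift) (simp add: sum_negf)
qed simp

text \<open>Contracting with the first vector of \<open>xs\<close> is the Laplace expansion along
  the first row. The determinant is used where matrices say more than forms: for transposition and
  for kernel vectors.\<close>

lemma pairing_wedges_eq_det:
  assumes "length xs = k" "length ys = k"
  shows "pairing N (wedges N xs) (wedges N ys) = det (mat k k (\<lambda>(i, j). dot N (xs ! i) (ys ! j)))"
  using assms
proof (induction xs arbitrary: ys k)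
  case Nil
  then show ?case
    using pairing_basis[of "{}" N "ext_basis {}"] by (simp add: ext_basis_def)
next
  case (Cons x xs)
  define A where "A = mat k k (\<lambda>(i, j). dot N ((x # xs) ! i) (ys ! j))"
  have k: "k = Suc (length xs)"
    using Cons.prems by simp
  have "pairing N (wedges N (x # xs)) (wedges N ys) =
      (\<Sum>j<k. (-1) ^ j * dot N x (ys ! j) * pairing N (wedges N xs) (wedges N (take j ys @ drop (Suc j) ys)))"
    using Cons.prems by (simp add: pairing_vec_wedge contract_wedges pairing_sum_right)
  also have "\<dots> = (\<Sum>j<k. A $$ (0, j) * cofactor A 0 j)"
  proof (rule sum.cong[OF refl])
    fix j
    assume j: "j \<in> {..<k}"
    let ?ys = "take j ys @ drop (Suc j) ys"
    have "mat_delete A 0 j = mat (length xs) (length xs) (\<lambda>(i, j). dot N (xs ! i) (?ys ! j))"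
      using j k Cons.prems(2)
      by (intro eq_matI) (auto simp: A_def mat_delete_def nth_append min_def)
    moreover have "pairing N (wedges N xs) (wedges N ?ys) =
        det (mat (length xs) (length xs) (\<lambda>(i, j). dot N (xs ! i) (?ys ! j)))"
      by (rule Cons.IH) (use j k Cons.prems in auto)
    ultimately show "(-1) ^ j * dot N x (ys ! j) * pairing N (wedges N xs) (wedges N ?ys) =
        A $$ (0, j) * cofactor A 0 j"
      using j k by (simp add: cofactor_def A_def)
  qed
  also have "\<dots> = det A"
    by (rule laplace_expansion_row[symmetric]) (simp_all add: A_def k)
  finally show ?case
    by (simp add: A_def)
qed

section \<open>Contractions along a list of vectors\<close>

lemma pairing_fold_contract:
  "pairing N (wedges N xs \<^bold>\<and> \<alpha>) \<beta> = pairing N \<alpha> (fold (contract N) xs \<beta>)" if "form N p \<alpha>"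
proof (induction xs arbitrary: \<beta>)
  case Nil
  then show ?case
    by (simp add: wedge_one_left[OF that])
next
  case (Cons x xs)
  then show ?case
    by (simp add: wedge_assoc pairing_vec_wedge)
qed

text \<open>Contractions anticommute, so bringing the first one to the outermost place costs one
  sign for each of the others.\<close>

lemma fold_contract_Cons:
  assumes "form N p \<alpha>"
  shows "fold (contract M) xs (contract M x \<alpha>) = (\<lambda>S. (-1) ^ length xs * contract M x (fold (contract M) xs \<alpha>) S)"
  using assms
proof (induction xs arbitrary: \<alpha> p)
  case (Cons y ys)
  have scale: "fold (contract M) zs (\<lambda>S. c * \<beta> S) = (\<lambda>S. c * fold (contract M) zs \<beta> S)" for zs c \<beta>
    by (induction zs arbitrary: \<beta>) (simp_all add: contract_scale)
  have "contract M y (contract M x \<alpha>) = (\<lambda>S. (-1) * contract M x (contract M y \<alpha>) S)"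
    using contract_anticommute[OF Cons.prems, of M y x] by simp
  then have "fold (contract M) (y # ys) (contract M x \<alpha>) =
      (\<lambda>S. (-1) * fold (contract M) ys (contract M x (contract M y \<alpha>)) S)"
    by (simp only: fold_simps o_apply scale)
  then show ?case
    using Cons.IH[OF form_contract[OF Cons.prems]] by simp
qed simp

lemma form_fold_contract: "form N p \<alpha> \<Longrightarrow> form N (p - length xs) (fold (contract M) xs \<alpha>)"
proof (induction xs arbitrary: p \<alpha>)
  case (Cons x xs)
  then show ?case
    using Cons.IH[OF form_contract[OF Cons.prems]] by simp
qed simp

lemma fold_contract_wedges_wedge:
  assumes "\<And>x y. x \<in> set xs \<Longrightarrow> y \<in> set ys \<Longrightarrow> dot N x y = 0"
  shows "fold (contract N) xs (wedges N ys \<^bold>\<and> \<alpha>) =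
    (\<lambda>S. (-1) ^ (length xs * length ys) * (wedges N ys \<^bold>\<and> fold (contract N) xs \<alpha>) S)"
  using assms
proof (induction xs arbitrary: \<alpha>)
  case (Cons x xs)
  have scale: "fold (contract N) zs (\<lambda>S. c * \<beta> S) = (\<lambda>S. c * fold (contract N) zs \<beta> S)" for zs c \<beta>
    by (induction zs arbitrary: \<beta>) (simp_all add: contract_scale)
  show ?case
    using Cons by (simp add: contract_wedges_wedge scale power_add mult.assoc)
qed simp

lemma fold_contract_wedge_wedges:
  assumes "\<And>x y. x \<in> set xs \<Longrightarrow> y \<in> set ys \<Longrightarrow> dot N x y = 0" "form N p \<alpha>"
  shows "fold (contract N) xs (\<alpha> \<^bold>\<and> wedges N ys) = (fold (contract N) xs \<alpha> \<^bold>\<and> wedges N ys)"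
  using assms
proof (induction xs arbitrary: \<alpha> p)
  case (Cons x xs)
  have "contract N x (\<alpha> \<^bold>\<and> wedges N ys) = contract N x \<alpha> \<^bold>\<and> wedges N ys"
    using contract_wedge[OF Cons.prems(2), of N x] Cons.prems(1) by (simp add: contract_wedges_0)
  then show ?case
    using Cons.IH[OF _ form_contract[OF Cons.prems(2)]] Cons.prems(1) by simp
qed simp

text \<open>
  Contractions which kill \<open>\<beta>\<close> can be moved from \<open>\<alpha>\<close> to \<open>\<gamma>\<close>, because contracting the
  form \<open>\<beta> \<and> \<alpha> \<and> \<gamma>\<close>, whose degree exceeds \<open>N\<close>, gives 0.
\<close>

lemma wedge_contract_transfer:
  assumes "\<And>y. y \<in> set ys \<Longrightarrow> dot N x y = 0" "form N c \<alpha>" "form N d \<gamma>" "length ys + c + d > N"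
  shows "wedges N ys \<^bold>\<and> contract N x \<alpha> \<^bold>\<and> \<gamma> =
    (\<lambda>S. (-1) ^ Suc c * (wedges N ys \<^bold>\<and> \<alpha> \<^bold>\<and> contract N x \<gamma>) S)"
proof -
  have "wedges N ys \<^bold>\<and> \<alpha> \<^bold>\<and> \<gamma> = (\<lambda>S. 0)"
    by (rule form_eq_0[OF form_wedge[OF form_wedges form_wedge[OF assms(2,3)]]]) (use assms(4) in simp)
  then have "(\<lambda>S. (-1) ^ length ys * (wedges N ys \<^bold>\<and> contract N x (\<alpha> \<^bold>\<and> \<gamma>)) S) = (\<lambda>S. 0)"
    by (subst contract_wedges_wedge[OF assms(1), symmetric]) simp_all
  then have "(wedges N ys \<^bold>\<and> contract N x (\<alpha> \<^bold>\<and> \<gamma>)) S = 0" for S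
    by (metis mult_eq_0_iff power_eq_0_iff zero_neq_neg_one)
  then have "(wedges N ys \<^bold>\<and> contract N x \<alpha> \<^bold>\<and> \<gamma>) S + (-1) ^ c * (wedges N ys \<^bold>\<and> \<alpha> \<^bold>\<and> contract N x \<gamma>) S = 0" for S
    by (simp add: contract_wedge[OF assms(2)] wedge_add_right wedge_scale_right)
  then show ?thesis
    by (auto simp: eq_neg_iff_add_eq_0)
qed

text \<open>The contractions of \<alpha> are peeled off from the outside. The degrees are balanced
  so that at each single transfer the total degree is exactly \<open>N + 1\<close>, which is what
  makes the form to be contracted vanish.\<close>

lemma wedge_fold_contract_transfer:
  assumes "\<And>x y. x \<in> set xs \<Longrightarrow> y \<in> set ys \<Longrightarrow> dot N x y = 0"
    and "form N c \<alpha>" "form N d \<gamma>" "length xs \<le> c" "length xs \<le> d"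
    and "length ys + c + d = N + length xs"
  shows "wedges N ys \<^bold>\<and> fold (contract N) xs \<alpha> \<^bold>\<and> \<gamma> =
    (\<lambda>S. (-1) ^ (Suc c * length xs) * (wedges N ys \<^bold>\<and> \<alpha> \<^bold>\<and> fold (contract N) xs \<gamma>) S)"
  using assms(1,3-6)
proof (induction xs arbitrary: \<gamma> d)
  case (Cons x xs)
  define \<beta> where "\<beta> = fold (contract N) xs \<alpha>"
  have \<beta>: "form N (c - length xs) \<beta>"
    unfolding \<beta>_def by (rule form_fold_contract[OF assms(2)])
  have "wedges N ys \<^bold>\<and> fold (contract N) (x # xs) \<alpha> \<^bold>\<and> \<gamma> =
      (\<lambda>S. (-1) ^ length xs * (wedges N ys \<^bold>\<and> contract N x \<beta> \<^bold>\<and> \<gamma>) S)"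
    by (simp add: \<beta>_def fold_contract_Cons[OF assms(2)] wedge_scale_left wedge_scale_right)
  also have "\<dots> = (\<lambda>S. (-1) ^ length xs * ((-1) ^ Suc (c - length xs) *
      (wedges N ys \<^bold>\<and> \<beta> \<^bold>\<and> contract N x \<gamma>) S))"
    by (subst wedge_contract_transfer[OF _ \<beta> Cons.prems(2)]) (use Cons.prems in auto)
  also have "\<dots> = (\<lambda>S. (-1) ^ Suc c * (wedges N ys \<^bold>\<and> \<beta> \<^bold>\<and> contract N x \<gamma>) S)"
    using Cons.prems(3) by (simp flip: mult.assoc power_add)
  also have "\<dots> = (\<lambda>S. (-1) ^ Suc c * ((-1) ^ (Suc c * length xs) *
      (wedges N ys \<^bold>\<and> \<alpha> \<^bold>\<and> fold (contract N) xs (contract N x \<gamma>)) S))"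
    unfolding \<beta>_def
    by (subst Cons.IH[OF _ form_contract[OF Cons.prems(2)]]) (use Cons.prems in auto)
  finally show ?case
    by (simp add: power_add algebra_simps)
qed simp

subsection \<open>Desnanot--Jacobi identity\<close>

text \<open>The coefficients are cofactors and do not depend on \<zeta>. They can therefore serve as
  the coefficients of a linear combination of \<open>x # as\<close> whose product with any \<zeta>
  is the bordered Gram determinant.\<close>

lemma pairing_wedges_expand:
  "\<exists>c. c 0 = pairing N (wedges N xs) \<theta> \<and>
    (\<forall>\<zeta>. pairing N (wedges N (x # xs)) (ext_vec N \<zeta> \<^bold>\<and> \<theta>) = (\<Sum>j<Suc (length xs). c j * dot N \<zeta> ((x # xs) ! j)))"
proof (intro exI conjI allI)
  let ?c = "\<lambda>j. (-1) ^ j * pairing N \<theta> (wedges N (take j (x # xs) @ drop (Suc j) (x # xs)))"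
  show "?c 0 = pairing N (wedges N xs) \<theta>"
    by (simp add: pairing_commute)
  fix \<zeta>
  show "pairing N (wedges N (x # xs)) (ext_vec N \<zeta> \<^bold>\<and> \<theta>) =
      (\<Sum>j<Suc (length xs). ?c j * dot N \<zeta> ((x # xs) ! j))"
    by (subst pairing_commute, subst pairing_vec_wedge, subst contract_wedges, subst pairing_sum_right)
       (simp add: algebra_simps)
qed

text \<open>
  The vector \<open>z\<close> below is the projection of \<open>x\<close> along the span of \<open>as\<close> to the common kernel
  of \<open>ts\<close>, scaled by the pairing of \<open>as\<close> and \<open>ts\<close> so that no division is needed.
\<close>

lemma desnanot_jacobi_front:
  fixes N :: nat and as ts :: "(nat \<Rightarrow> complex) list"
  defines "P \<equiv> \<lambda>xs ys. pairing N (wedges N xs) (wedges N ys)"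
  shows "P as ts * P (x # y # as) (\<xi> # \<eta> # ts) =
    P (x # as) (\<xi> # ts) * P (y # as) (\<eta> # ts) - P (x # as) (\<eta> # ts) * P (y # as) (\<xi> # ts)"
proof -
  obtain c where c0: "c 0 = P as ts"
    and c: "\<And>\<zeta>. P (x # as) (\<zeta> # ts) = (\<Sum>j<Suc (length as). c j * dot N \<zeta> ((x # as) ! j))"
    using pairing_wedges_expand[of N as "wedges N ts" x] unfolding P_def wedges.simps(2)[of N _ ts] by blast
  define z where "z = (\<lambda>k. \<Sum>j<Suc (length as). c j * ((x # as) ! j) k)"
  have dot_z: "dot N z \<zeta> = P (x # as) (\<zeta> # ts)" for \<zeta>
    unfolding c dot_def z_def
    by (simp only: sum_distrib_left sum_distrib_right, subst sum.swap) (simp add: algebra_simps)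
  \<comment> \<open>The product of \<open>z\<close> with \<open>t\<close> is a Gram determinant in
    which \<open>t\<close> occurs twice.\<close>
  have "P (x # as) (t # ts) = 0" if "t \<in> set ts" for t
    unfolding P_def using wedges_repeated[OF that] by (simp add: pairing_def)
  then have z0: "contract N z (wedges N ts) = (\<lambda>S. 0)"
    by (intro contract_wedges_0) (simp add: dot_z)
  \<comment> \<open>All vectors in the combination \<open>z\<close> except \<open>x\<close> occur in
    \<open>as\<close>, so the wedge kills them.\<close>
  have "ext_vec N z \<^bold>\<and> wedges N (y # as) =
      (\<lambda>S. \<Sum>j<Suc (length as). c j * (ext_vec N ((x # as) ! j) \<^bold>\<and> wedges N (y # as)) S)"
    unfolding z_def ext_vec_sum wedge_sum_left ..
  also have "\<dots> = (\<lambda>S. \<Sum>j<Suc (length as). if j = 0 then c 0 * wedges N (x # y # as) S else 0)"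
  proof (rule ext, rule sum.cong[OF refl])
    fix S j
    assume j: "j \<in> {..<Suc (length as)}"
    show "c j * (ext_vec N ((x # as) ! j) \<^bold>\<and> wedges N (y # as)) S =
        (if j = 0 then c 0 * wedges N (x # y # as) S else 0)"
    proof (cases j)
      case (Suc i)
      then have "(x # as) ! j \<in> set (y # as)"
        using j by auto
      then have "ext_vec N ((x # as) ! j) \<^bold>\<and> wedges N (y # as) = (\<lambda>S. 0)"
        by (rule wedges_repeated)
      then show ?thesis
        using Suc by (simp only:) simp
    qed simp
  qed
  finally have "ext_vec N z \<^bold>\<and> wedges N (y # as) = (\<lambda>S. P as ts * wedges N (x # y # as) S)"
    by (simp add: c0 del: sum.lessThan_Suc)
  then have "P as ts * P (x # y # as) (\<xi> # \<eta> # ts) =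
      pairing N (ext_vec N z \<^bold>\<and> wedges N (y # as)) (wedges N (\<xi> # \<eta> # ts))"
    by (simp add: P_def pairing_scale_left)
  \<comment> \<open>Moved to the other side, \<open>z\<close> kills \<open>ts\<close> and meets only
    \<xi> and \<eta>; these two terms are the two products of the claim.\<close>
  also have "\<dots> = pairing N (wedges N (y # as)) (contract N z (ext_vec N \<xi> \<^bold>\<and> wedges N (\<eta> # ts)))"
    by (simp only: pairing_vec_wedge wedges.simps(2)[of N \<xi>])
  also have "contract N z (ext_vec N \<xi> \<^bold>\<and> wedges N (\<eta> # ts)) =
      (\<lambda>S. dot N z \<xi> * wedges N (\<eta> # ts) S - dot N z \<eta> * wedges N (\<xi> # ts) S)"
    unfolding contract_vec_wedge[OF form_wedges]
    by (simp add: contract_vec_wedge[OF form_wedges] z0 wedge_scale_right)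
  also have "pairing N (wedges N (y # as)) \<dots> =
      dot N z \<xi> * P (y # as) (\<eta> # ts) - dot N z \<eta> * P (y # as) (\<xi> # ts)"
    unfolding P_def by (simp add: pairing_def sum_subtractf sum_distrib_left algebra_simps)
  finally show ?thesis
    by (simp add: dot_z)
qed

text \<open>The shape in which flags supply it: a longer flag appends the new vector to its own
  list, hence \<open>x\<close> and \<xi> stand in the middle, \<open>y\<close> and \<eta> at the
  end.\<close>

lemma desnanot_jacobi:
  fixes N :: nat and as bs ss ts :: "(nat \<Rightarrow> complex) list"
  defines "P \<equiv> \<lambda>xs ys. pairing N (wedges N xs) (wedges N ys)"
  shows "P (as @ bs) (ss @ ts) * P (as @ x # bs @ [y]) (ss @ \<xi> # ts @ [\<eta>]) =
    P (as @ x # bs) (ss @ \<xi> # ts) * P (as @ bs @ [y]) (ss @ ts @ [\<eta>]) -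
    P (as @ x # bs) (ss @ ts @ [\<eta>]) * P (as @ bs @ [y]) (ss @ \<xi> # ts)"
proof -
  have 1: "wedges N (as @ x # bs) = (\<lambda>S. (-1) ^ length as * wedges N (x # as @ bs) S)" for as bs x
    by (rule wedges_move)
  have 2: "wedges N (as @ bs @ [y]) = (\<lambda>S. (-1) ^ (length as + length bs) * wedges N (y # as @ bs) S)" for as bs y
    using wedges_move[of N "as @ bs" y "[]"] by simp
  have 3: "wedges N (as @ x # bs @ [y]) =
      (\<lambda>S. (-1) ^ (length as + (length as + length bs)) * wedges N (x # y # as @ bs) S)" for as bs x y
  proof -
    have "wedges N (as @ x # bs @ [y]) = (\<lambda>S. (-1) ^ length as * (ext_vec N x \<^bold>\<and> wedges N (as @ bs @ [y])) S)"
      using 1[of as x "bs @ [y]"] by simp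
    then show ?thesis
      unfolding 2[of as bs y] wedge_scale_right by (simp add: power_add algebra_simps)
  qed
  show ?thesis
    \<comment> \<open>Moving the special vectors to the front multiplies all three products by the
      same sign, \<open>(-1) ^ (length bs + length ts)\<close>.\<close>
    unfolding P_def 3 unfolding 2 unfolding 1 pairing_scale_left pairing_scale_right
    using arg_cong[OF desnanot_jacobi_front[of N "as @ bs" "ss @ ts" x y \<xi> \<eta>],
        of "\<lambda>z. (-1) ^ length bs * ((-1) ^ length ts * z)"]
    by (simp add: power_add algebra_simps)
qed

subsection \<open>Symplectic bases\<close>

text \<open>The vector that represents the functional \<open>\<langle>-, u\<rangle>\<close> with
  respect to \<open>dot\<close>. The single sign \<open>(-1) ^ (k - 1)\<close> serves both halves of
  the coordinates: as \<open>N\<close> is even, it changes under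
  \<open>k \<mapsto> N + 1 - k\<close>, which is the skew-symmetry.\<close>

definition sharp :: "nat \<Rightarrow> (nat \<Rightarrow> complex) \<Rightarrow> nat \<Rightarrow> complex" where
  "sharp N u = (\<lambda>k. (-1) ^ (k - 1) * u (N + 1 - k))"

lemma symp_form_eq_dot: "symp_form n x u = dot (2 * n) x (sharp (2 * n) u)"
proof -
  have "{1..2 * n} = {1..n} \<union> {n + 1..2 * n}"
    by auto
  then have "dot (2 * n) x (sharp (2 * n) u) =
      (\<Sum>k=1..n. x k * ((-1) ^ (k - 1) * u (2 * n + 1 - k))) +
      (\<Sum>k=n + 1..2 * n. x k * ((-1) ^ (k - 1) * u (2 * n + 1 - k)))"
    unfolding dot_def sharp_def by (simp add: sum.union_disjoint)
  also have "(\<Sum>k=n + 1..2 * n. x k * ((-1) ^ (k - 1) * u (2 * n + 1 - k))) =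
      (\<Sum>i=1..n. - (x (2 * n + 1 - i) * ((-1) ^ (i - 1) * u i)))"
  proof (rule sum.reindex_bij_witness[where i="\<lambda>i. 2 * n + 1 - i" and j="\<lambda>i. 2 * n + 1 - i"])
    fix k
    assume k: "k \<in> {n + 1..2 * n}"
    have "(-1::complex) ^ (2 * n + 1 - k - 1) = (-1) ^ k"
      by (rule power_neg1_eq) (use k in auto)
    also have "\<dots> = - ((-1) ^ (k - 1))"
      using k by (cases k) auto
    finally show "- (x (2 * n + 1 - (2 * n + 1 - k)) * ((-1) ^ (2 * n + 1 - k - 1) * u (2 * n + 1 - k))) =
        x k * ((-1) ^ (k - 1) * u (2 * n + 1 - k))"
      using k by simp
  qed auto
  finally show ?thesis
    unfolding symp_form_def by (simp add: algebra_simps sum.distrib sum_negf sum_subtractf)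
qed

lemma symp_form_antisym: "symp_form n x y = - symp_form n y x"
  unfolding symp_form_def sum_negf[symmetric] by (rule sum.cong) (simp_all add: algebra_simps)

lemma dot_unit_vec: "i \<in> {1..N} \<Longrightarrow> dot N (Defs.unit_vec i) y = y i"
proof -
  assume "i \<in> {1..N}"
  moreover have "dot N (Defs.unit_vec i) y = (\<Sum>k=1..N. if k = i then y i else 0)"
    unfolding dot_def Defs.unit_vec_def by (rule sum.cong) auto
  ultimately show ?thesis
    by simp
qed

lemma symp_form_unit_vec:
  assumes "i \<in> {1..2 * n}" "j \<in> {1..2 * n}"
  shows "symp_form n (Defs.unit_vec i) (Defs.unit_vec j) = (if i + j = 2 * n + 1 then (-1) ^ (i - 1) else 0)"
  unfolding symp_form_eq_dot dot_unit_vec[OF assms(1)] using assms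
  by (auto simp: sharp_def Defs.unit_vec_def)

lemma symp_basis_unit_vec: "symp_basis n Defs.unit_vec"
  by (simp add: symp_basis_def)

lemma symp_basis_dot:
  assumes "symp_basis n v" "i \<in> {1..2 * n}" "j \<in> {1..2 * n}"
  shows "dot (2 * n) (v i) (sharp (2 * n) (v j)) = (if i + j = 2 * n + 1 then (-1) ^ (i - 1) else 0)"
proof -
  have "symp_form n (v i) (v j) = symp_form n (Defs.unit_vec i) (Defs.unit_vec j)"
    using assms unfolding symp_basis_def by blast
  then show ?thesis
    unfolding symp_form_eq_dot[symmetric] by (simp only: symp_form_unit_vec[OF assms(2,3)])
qed

text \<open>If the rows of a matrix form a symplectic basis, so do its columns: the relations
  exhibit a right inverse, and for square matrices this is also a left inverse.\<close>

lemma symp_basis_transpose: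
  assumes "symp_basis n v" "m \<in> {1..2 * n}" "k \<in> {1..2 * n}"
  shows "symp_form n (\<lambda>i. v i m) (\<lambda>i. v i k) = (if m + k = 2 * n + 1 then (-1) ^ (m - 1) else 0)"
proof -
  define N where "N = 2 * n"
  define A where "A = mat N N (\<lambda>(i, j). v (Suc i) (Suc j))"
  \<comment> \<open>The candidate for the inverse: \<open>v (Suc i)\<close> has a nonzero product
    only with \<open>v (N - i)\<close>, and \<open>(-1) ^ i\<close> normalises the value to
    1.\<close>
  define B where "B = mat N N (\<lambda>(j, i). (-1) ^ i * sharp N (v (N - i)) (Suc j))"
  have dot_eq: "(\<Sum>j=0..<N. f (Suc j) * g (Suc j)) = dot N f g" for f g
    unfolding dot_def
    by (rule sum.reindex_bij_witness[where i="\<lambda>j. j - 1" and j=Suc]) auto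
  have "A * B = 1\<^sub>m N"
  proof (rule eq_matI)
    fix i i'
    assume ii: "i < dim_row (1\<^sub>m N)" "i' < dim_col (1\<^sub>m N)"
    then have "(A * B) $$ (i, i') =
        (\<Sum>j=0..<N. v (Suc i) (Suc j) * ((-1) ^ i' * sharp N (v (N - i')) (Suc j)))"
      by (simp add: A_def B_def scalar_prod_def)
    also have "\<dots> = (-1) ^ i' * (\<Sum>j=0..<N. v (Suc i) (Suc j) * sharp N (v (N - i')) (Suc j))"
      by (simp add: sum_distrib_left algebra_simps)
    also have "\<dots> = (-1) ^ i' * dot N (v (Suc i)) (sharp N (v (N - i')))"
      by (simp only: dot_eq)
    also have "\<dots> = (-1) ^ i' * (if i = i' then (-1) ^ i else 0)"
      unfolding N_def by (subst symp_basis_dot[OF assms(1)]) (use ii N_def in auto)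
    also have "\<dots> = 1\<^sub>m N $$ (i, i')"
      using ii by simp
    finally show "(A * B) $$ (i, i') = 1\<^sub>m N $$ (i, i')" .
  qed (simp_all add: A_def B_def)
  then have "B * A = 1\<^sub>m N"
    by (intro mat_mult_left_right_inverse[of A N B]) (simp_all add: A_def B_def)
  moreover have "N - k < N" "m - 1 < N"
    using assms(2,3) by (auto simp: N_def)
  ultimately have "(B * A) $$ (N - k, m - 1) = (if N - k = m - 1 then 1 else 0)"
    by simp
  moreover have "(B * A) $$ (N - k, m - 1) =
      (\<Sum>i=0..<N. (-1) ^ i * ((-1) ^ (N - k) * v (N - i) k) * v (Suc i) m)"
    using assms(2,3) by (auto simp: A_def B_def scalar_prod_def sharp_def N_def Suc_diff_le intro!: sum.cong)
  moreover have "\<dots> = (-1) ^ (N - k) * (\<Sum>i=0..<N. v (Suc i) m * sharp N (\<lambda>i. v i k) (Suc i))"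
    by (simp add: sharp_def sum_distrib_left algebra_simps)
  moreover have "\<dots> = (-1) ^ (N - k) * symp_form n (\<lambda>i. v i m) (\<lambda>i. v i k)"
    unfolding symp_form_eq_dot N_def[symmetric] by (subst dot_eq[of "\<lambda>i. v i m"]) simp
  ultimately have "(-1) ^ (N - k) * symp_form n (\<lambda>i. v i m) (\<lambda>i. v i k) = (if N - k = m - 1 then 1 else 0)"
    by simp
  then have "(-1) ^ (N - k) * ((-1) ^ (N - k) * symp_form n (\<lambda>i. v i m) (\<lambda>i. v i k)) =
      (-1) ^ (N - k) * (if N - k = m - 1 then 1 else 0)"
    by simp
  moreover have "N - k = m - 1 \<longleftrightarrow> m + k = N + 1"
    using assms(2,3) by (auto simp: N_def)
  ultimately show ?thesis
    by (auto simp: N_def)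
qed

subsection \<open>Symplectic bases are unimodular\<close>

text \<open>The product of the factors \<open>1 + x \<and> y\<close>. Since
  \<open>x \<and> y\<close> squares to 0 and bivectors commute, it is the exponential of the sum of
  the bivectors.\<close>

primrec exp_pairs :: "nat \<Rightarrow> ((nat \<Rightarrow> complex) \<times> (nat \<Rightarrow> complex)) list \<Rightarrow> ext" where
  "exp_pairs N [] = ext_basis {}"
| "exp_pairs N (p # ps) = (\<lambda>S. exp_pairs N ps S + (ext_vec N (fst p) \<^bold>\<and> ext_vec N (snd p) \<^bold>\<and> exp_pairs N ps) S)"

text \<open>The vector obtained by contracting \<open>z\<close> into the bivector that is the sum of
  \<open>fst p \<and> snd p\<close>; through all \<open>z\<close> it determines the
  bivector.\<close>

definition contract_pairs ::
    "nat \<Rightarrow> (nat \<Rightarrow> complex) \<Rightarrow> ((nat \<Rightarrow> complex) \<times> (nat \<Rightarrow> complex)) list \<Rightarrow> nat \<Rightarrow> complex" where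
  "contract_pairs N z ps k = (\<Sum>p\<leftarrow>ps. dot N z (fst p) * snd p k - dot N z (snd p) * fst p k)"

lemma exp_pairs_infinite: "infinite S \<Longrightarrow> exp_pairs N ps S = 0"
  by (induction ps) (auto simp: ext_basis_def wedge_infinite)

lemma contract_add: "contract M x (\<lambda>S. \<alpha> S + \<beta> S) = (\<lambda>S. contract M x \<alpha> S + contract M x \<beta> S)"
  unfolding contract_def sum.distrib[symmetric]
  by (rule ext, rule sum.cong) (simp_all add: annihilate_def algebra_simps)

text \<open>The derivative rule of the exponential. Bivectors are even, so the contracted vector can
  be moved to the front, and products in which it repeats a vector of its own pair vanish.\<close>

lemma contract_exp_pairs:
  "contract N z (exp_pairs N ps) = ext_vec N (contract_pairs N z ps) \<^bold>\<and> exp_pairs N ps"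
proof (induction ps)
  case Nil
  have "ext_vec N (contract_pairs N z []) = (\<lambda>S. 0)"
    by (rule ext) (simp add: contract_pairs_def ext_vec_def)
  then show ?case
    by simp
next
  case (Cons p ps)
  obtain x y where p: "p = (x, y)"
    by fastforce
  define E where "E = exp_pairs N ps"
  define q where "q = contract_pairs N z ps"
  have fin: "infinite S \<Longrightarrow> E S = 0" for S
    by (simp add: E_def exp_pairs_infinite)
  have "ext_vec N (contract_pairs N z (p # ps)) =
      ext_vec N (\<lambda>k. (dot N z x * y k + (- dot N z y) * x k) + q k)"
    by (intro ext_vec_cong) (simp add: contract_pairs_def q_def p)
  also have "\<dots> = (\<lambda>S. (dot N z x * ext_vec N y S + (- dot N z y) * ext_vec N x S) + ext_vec N q S)"
    unfolding ext_vec_add ext_vec_scale ..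
  finally have v: "ext_vec N (contract_pairs N z (p # ps)) =
      (\<lambda>S. (dot N z x * ext_vec N y S + (- dot N z y) * ext_vec N x S) + ext_vec N q S)" .
  have IH: "contract N z E = ext_vec N q \<^bold>\<and> E"
    using Cons by (simp add: E_def q_def)
  have 1: "contract N z (ext_vec N x \<^bold>\<and> ext_vec N y \<^bold>\<and> E) S =
      dot N z x * (ext_vec N y \<^bold>\<and> E) S - dot N z y * (ext_vec N x \<^bold>\<and> E) S +
      (ext_vec N x \<^bold>\<and> ext_vec N y \<^bold>\<and> ext_vec N q \<^bold>\<and> E) S" for S
  proof -
    have "contract N z (ext_vec N y \<^bold>\<and> E) = (\<lambda>S. dot N z y * E S + (-1) * (ext_vec N y \<^bold>\<and> ext_vec N q \<^bold>\<and> E) S)"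
      by (simp add: contract_vec_wedge_finite[OF fin] IH)
    moreover have "contract N z (ext_vec N x \<^bold>\<and> ext_vec N y \<^bold>\<and> E) =
        (\<lambda>S. dot N z x * (ext_vec N y \<^bold>\<and> E) S - (ext_vec N x \<^bold>\<and> contract N z (ext_vec N y \<^bold>\<and> E)) S)"
      by (rule contract_vec_wedge_finite) (rule wedge_infinite)
    ultimately show ?thesis
      by (simp only: wedge_add_right wedge_scale_right) (simp add: algebra_simps)
  qed
  have 2: "(ext_vec N q \<^bold>\<and> ext_vec N x \<^bold>\<and> ext_vec N y \<^bold>\<and> E) S =
      (ext_vec N x \<^bold>\<and> ext_vec N y \<^bold>\<and> ext_vec N q \<^bold>\<and> E) S" for S
  proof -
    have "ext_vec N q \<^bold>\<and> ext_vec N y \<^bold>\<and> E = (\<lambda>S. (-1) * (ext_vec N y \<^bold>\<and> ext_vec N q \<^bold>\<and> E) S)"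
      using wedge_vec_vec[of N q y E] by simp
    then show ?thesis
      by (simp only: wedge_vec_vec[of N q x] wedge_scale_right) simp
  qed
  have 3: "(ext_vec N y \<^bold>\<and> ext_vec N x \<^bold>\<and> ext_vec N y \<^bold>\<and> E) S = 0" for S
    by (simp add: wedge_vec_vec[of N y x])
  show ?case
    unfolding v[folded p] exp_pairs.simps E_def[symmetric] contract_add IH unfolding p fst_conv snd_conv
    by (rule ext) (simp only: 1 2 3 wedge_add_left wedge_add_right wedge_scale_left wedge_vec_same,
        simp add: algebra_simps)
qed

lemma exp_pairs_empty: "exp_pairs N ps {} = 1"
proof (induction ps)
  case (Cons p ps)
  have "(ext_vec N x \<^bold>\<and> \<alpha>) {} = 0" for x \<alpha>
    using ext_vec_wedge[of "{}" N x \<alpha>] by simp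
  with Cons show ?case
    by simp
qed (simp add: ext_basis_def)

lemma wedge_eqI:
  assumes "form N p \<alpha>" "\<And>T. T \<subseteq> S \<Longrightarrow> card T = p \<Longrightarrow> finite S \<Longrightarrow> \<beta> (S - T) = \<gamma> (S - T)"
  shows "(\<alpha> \<^bold>\<and> \<beta>) S = (\<alpha> \<^bold>\<and> \<gamma>) S"
proof (cases "finite S")
  case True
  show ?thesis
    unfolding wedge_def
  proof (rule sum.cong[OF refl])
    fix T
    assume "T \<in> Pow S"
    then show "shuffle_sign T (S - T) * \<alpha> T * \<beta> (S - T) = shuffle_sign T (S - T) * \<alpha> T * \<gamma> (S - T)"
      using assms(2)[of T] formD[OF assms(1), of T] True by (cases "\<alpha> T = 0") auto
  qed
qed (simp add: wedge_infinite)

text \<open>The derivative rule acts as a differential equation: contraction with the unit vector of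
  some \<open>m \<in> S\<close> expresses the coefficient at \<open>S\<close> by coefficients at
  smaller sets, and the bivector fixes the recursion.\<close>

lemma exp_pairs_unique:
  assumes "\<And>z k. k \<in> {1..N} \<Longrightarrow> contract_pairs N z ps k = contract_pairs N z qs k" "S \<subseteq> {1..N}"
  shows "exp_pairs N ps S = exp_pairs N qs S"
  using assms(2)
proof (induction "card S" arbitrary: S rule: less_induct)
  case less
  have fin: "finite S"
    using less.prems finite_subset by auto
  show ?case
  proof (cases "S = {}")
    case False
    then obtain m where m: "m \<in> S"
      by auto
    define T where "T = S - {m}"
    have T: "S = insert m T" "m \<notin> T" "finite T" "m \<in> {1..N}" "T \<subseteq> {1..N}"
      using m fin less.prems by (auto simp: T_def)
    have ann: "contract N (Defs.unit_vec m) \<alpha> T = position_sign m T * \<alpha> S" for \<alpha>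
      using dot_unit_vec[OF T(4), of "\<lambda>k. annihilate k \<alpha> T"] T(1,2)
      by (simp add: contract_def dot_def annihilate_def)
    have "position_sign m T * exp_pairs N ps S = (ext_vec N (contract_pairs N (Defs.unit_vec m) ps) \<^bold>\<and> exp_pairs N ps) T"
      by (simp flip: ann add: contract_exp_pairs)
    also have "ext_vec N (contract_pairs N (Defs.unit_vec m) ps) = ext_vec N (contract_pairs N (Defs.unit_vec m) qs)"
      by (rule ext_vec_cong) (rule assms(1))
    also have "(\<dots> \<^bold>\<and> exp_pairs N ps) T = (\<dots> \<^bold>\<and> exp_pairs N qs) T"
    proof (rule wedge_eqI[OF form_ext_vec(1)])
      fix R
      assume "R \<subseteq> T"
      have "card (T - R) \<le> card T"
        using T by (intro card_mono) auto
      also have "\<dots> < card S"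
        using T by simp
      finally show "exp_pairs N ps (T - R) = exp_pairs N qs (T - R)"
        by (rule less.hyps) (use T in auto)
    qed
    also have "\<dots> = position_sign m T * exp_pairs N qs S"
      by (simp flip: ann add: contract_exp_pairs)
    finally show ?thesis
      by (metis position_sign_cancel)
  qed (simp add: exp_pairs_empty)
qed

text \<open>In the top degree only the product of all pairs survives. Sorting it as all first
  vectors followed by the second ones in reverse order costs no sign, because each second vector
  moves past an even form.\<close>

lemma exp_pairs_top:
  assumes "card S \<ge> 2 * length ps" "finite S"
  shows "exp_pairs N ps S =
    (if card S = 2 * length ps then wedges N (map fst ps @ rev (map snd ps)) S else 0)"
  using assms
proof (induction ps arbitrary: S)
  case Nil
  then show ?case
    by (auto simp: ext_basis_def)
next
  case (Cons p ps)
  obtain x y where p: "p = (x, y)"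
    by fastforce
  define \<omega> where "\<omega> = wedges N (map fst ps @ rev (map snd ps))"
  have \<omega>: "form N (2 * length ps) \<omega>"
    unfolding \<omega>_def by (rule form_wedges_length) simp
  have xy: "form N 2 (ext_vec N x \<^bold>\<and> ext_vec N y)"
    using form_wedge[OF form_ext_vec(1) form_ext_vec(1)] by (simp add: numeral_2_eq_2)
  have "exp_pairs N ps S = 0"
    using Cons.IH[of S] Cons.prems by simp
  moreover have "((ext_vec N x \<^bold>\<and> ext_vec N y) \<^bold>\<and> exp_pairs N ps) S =
      ((ext_vec N x \<^bold>\<and> ext_vec N y) \<^bold>\<and> (if card S = 2 * length (p # ps) then \<omega> else (\<lambda>S. 0))) S"
  proof (rule wedge_eqI[OF xy])
    fix T
    assume "T \<subseteq> S" "card T = 2" "finite S"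
    then have "card (S - T) = card S - 2"
      by (simp add: card_Diff_subset finite_subset)
    then show "exp_pairs N ps (S - T) = (if card S = 2 * length (p # ps) then \<omega> else (\<lambda>S. 0)) (S - T)"
      using Cons.IH[of "S - T"] Cons.prems by (auto simp: \<omega>_def)
  qed
  moreover have "ext_vec N y \<^bold>\<and> \<omega> = \<omega> \<^bold>\<and> ext_vec N y"
    using wedge_commute[OF form_ext_vec(1) \<omega>, of y] by simp
  ultimately show ?case
    by (simp add: p wedge_assoc \<omega>_def wedges_append wedge_one_right[OF form_ext_vec(1)])
qed

lemma wedges_scale:
  "wedges N (map (\<lambda>i k. c i * v i k) is @ ys) = (\<lambda>S. prod_list (map c is) * wedges N (map v is @ ys) S)"
  by (induction "is") (simp_all add: ext_vec_scale wedge_scale_left wedge_scale_right algebra_simps)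

lemma ext_vec_unit_vec: "k \<in> {1..N} \<Longrightarrow> ext_vec N (Defs.unit_vec k) = ext_basis {k}"
proof
  fix S
  assume "k \<in> {1..N}"
  moreover have "ext_vec N (Defs.unit_vec k) S = (\<Sum>i=1..N. if i = k then ext_basis {k} S else 0)"
    unfolding ext_vec_def Defs.unit_vec_def by (rule sum.cong) auto
  ultimately show "ext_vec N (Defs.unit_vec k) S = ext_basis {k} S"
    by simp
qed

lemma flag_form_unit_vec: "a \<le> N \<Longrightarrow> flag_form N Defs.unit_vec a = ext_basis {1..a}"
proof (induction a)
  case (Suc a)
  have "ext_basis {1..a} \<^bold>\<and> ext_basis {Suc a} = ext_basis {1..Suc a}"
  proof
    fix S
    have "{j \<in> {1..a}. j < Suc a} = {1..a}"
      by auto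
    then have s: "shuffle_sign {1..a} {Suc a} = 1"
      using shuffle_sign_commute[of "{1..a}" "{Suc a}"] by (simp add: position_sign_def)
    have "(ext_basis {1..a} \<^bold>\<and> ext_basis {Suc a}) S =
        (\<Sum>T\<in>Pow S. if T = {1..a} \<and> S = {1..Suc a} then 1 else 0)"
      unfolding wedge_def
      using s by (intro sum.cong[OF refl]) (auto simp: ext_basis_def)
    also have "\<dots> = (if S = {1..Suc a} then 1 else 0)"
      by auto
    finally show "(ext_basis {1..a} \<^bold>\<and> ext_basis {Suc a}) S = ext_basis {1..Suc a} S"
      by (simp add: ext_basis_def)
  qed
  then show ?case
    using Suc by (simp add: ext_vec_unit_vec)
qed simp

text \<open>The exponential of the same bivector is computed from \<open>v\<close> and from the
  standard basis; in the top degree both equal the volume times the same product of signs.\<close>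

lemma symp_basis_vol:
  assumes "symp_basis n v"
  shows "vol (2 * n) (flag_form (2 * n) v (2 * n)) = 1"
proof -
  let ?N = "2 * n"
  define s where "s i = (-1::complex) ^ (i - 1)" for i :: nat
  define ps where "ps v = map (\<lambda>i. (\<lambda>k. s i * v i k, v (2 * n + 1 - i))) [1..<Suc n]" for v :: flag_basis
  have top: "exp_pairs ?N (ps v) {1..?N} = prod_list (map s [1..<Suc n]) * vol ?N (flag_form ?N v ?N)" for v
  proof -
    have "rev (map snd (ps v)) = map v [Suc n..<Suc ?N]"
      by (rule nth_equalityI) (auto simp: ps_def rev_nth simp del: upt_Suc)
    then have "map fst (ps v) @ rev (map snd (ps v)) =
        map (\<lambda>i k. s i * v i k) [1..<Suc n] @ map v [Suc n..<Suc ?N]"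
      by (simp add: ps_def comp_def)
    then have "wedges ?N (map fst (ps v) @ rev (map snd (ps v))) =
        (\<lambda>S. prod_list (map s [1..<Suc n]) * wedges ?N (map v [1..<Suc n] @ map v [Suc n..<Suc ?N]) S)"
      by (simp only: wedges_scale)
    moreover have "map v [1..<Suc n] @ map v [Suc n..<Suc ?N] = flag_vectors v ?N"
      unfolding flag_vectors_def map_append[symmetric]
      using upt_add_eq_append[of 1 "Suc n" n] by (simp add: mult_2 del: upt_Suc)
    ultimately show ?thesis
      using exp_pairs_top[of "ps v" "{1..?N}" ?N]
      by (simp add: vol_def flag_form_eq_wedges ps_def del: upt_Suc)
  qed
  \<comment> \<open>The coefficients of the bivector are the symplectic products of the columns of
    \<open>v\<close>, hence the same for every symplectic basis.\<close>
  have pairs: "contract_pairs ?N z (ps v) k = (\<Sum>m=1..?N. z m * symp_form n (\<lambda>i. v i m) (\<lambda>i. v i k))" for z k v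
  proof -
    have d: "dot ?N z (\<lambda>k. s i * v i k) = s i * dot ?N z (v i)" for i
      by (simp add: dot_def sum_distrib_left algebra_simps)
    have "contract_pairs ?N z (ps v) k = (\<Sum>i\<leftarrow>[1..<Suc n]. s i * (dot ?N z (v i) * v (2 * n + 1 - i) k -
        dot ?N z (v (2 * n + 1 - i)) * v i k))"
      unfolding contract_pairs_def ps_def map_map comp_def fst_conv snd_conv d
      by (simp add: algebra_simps del: upt_Suc)
    also have "\<dots> = (\<Sum>i=1..n. s i * (dot ?N z (v i) * v (2 * n + 1 - i) k -
        dot ?N z (v (2 * n + 1 - i)) * v i k))"
      by (simp add: interv_sum_list_conv_sum_set_nat atLeastLessThanSuc_atLeastAtMost del: upt_Suc)
    also have "\<dots> = (\<Sum>i=1..n. \<Sum>m=1..?N. z m * (s i * (v i m * v (2 * n + 1 - i) k -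
        v (2 * n + 1 - i) m * v i k)))"
      by (rule sum.cong[OF refl])
         (simp add: dot_def sum_distrib_left sum_distrib_right right_diff_distrib sum_subtractf algebra_simps)
    also have "\<dots> = (\<Sum>m=1..?N. z m * symp_form n (\<lambda>i. v i m) (\<lambda>i. v i k))"
      unfolding symp_form_def s_def by (subst sum.swap) (simp add: sum_distrib_left)
    finally show ?thesis .
  qed
  have "exp_pairs ?N (ps v) {1..?N} = exp_pairs ?N (ps Defs.unit_vec) {1..?N}"
  proof (rule exp_pairs_unique)
    fix z and k :: nat
    assume "k \<in> {1..?N}"
    then show "contract_pairs ?N z (ps v) k = contract_pairs ?N z (ps Defs.unit_vec) k"
      unfolding pairs
      by (intro sum.cong[OF refl] arg_cong2[of _ _ _ _ "(*)"])
         (simp_all add: symp_basis_transpose[OF assms] symp_basis_transpose[OF symp_basis_unit_vec])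
  qed simp
  moreover have "vol ?N (flag_form ?N Defs.unit_vec ?N) = 1"
    by (simp add: flag_form_unit_vec vol_def ext_basis_def)
  moreover have "prod_list (map s [1..<Suc n]) \<noteq> 0"
    by (auto simp: s_def)
  ultimately show ?thesis
    unfolding top by (metis mult_cancel_left)
qed

subsection \<open>Duality of symplectic flags\<close>

text \<open>The complement for which \<open>vol N (\<alpha> \<and> \<beta>)\<close> is the pairing
  of \<alpha> with \<open>star N \<beta>\<close>.\<close>

definition star :: "nat \<Rightarrow> ext \<Rightarrow> ext" where
  "star N \<alpha> T = (if T \<subseteq> {1..N} then shuffle_sign T ({1..N} - T) * \<alpha> ({1..N} - T) else 0)"

lemma vol_wedge_eq_pairing: "vol N (\<alpha> \<^bold>\<and> \<beta>) = pairing N \<alpha> (star N \<beta>)"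
  unfolding vol_wedge pairing_def star_def by (rule sum.cong) auto

lemma form_star:
  assumes "form N d \<alpha>" "d \<le> N"
  shows "form N (N - d) (star N \<alpha>)"
  unfolding form_def
proof (intro allI impI)
  fix T
  assume "star N \<alpha> T \<noteq> 0"
  then have T: "T \<subseteq> {1..N}" "\<alpha> ({1..N} - T) \<noteq> 0"
    by (auto simp: star_def split: if_splits)
  then have "card ({1..N} - T) = d"
    using formD[OF assms(1)] by auto
  moreover have "card ({1..N} - T) = N - card T" "card T \<le> N"
    using T(1) card_mono[OF _ T(1)] by (auto simp: card_Diff_subset finite_subset)
  ultimately show "T \<subseteq> {1..N} \<and> card T = N - d"
    using T(1) by auto
qed

text \<open>The new vector is moved to the front past \<open>N - 1\<close> others, an odd number;
  there it is adjoint to contraction.\<close>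

lemma star_wedge_vec:
  assumes "even N" "form N d \<alpha>" "d < N"
  shows "star N (\<alpha> \<^bold>\<and> ext_vec N w) = (\<lambda>T. - contract N w (star N \<alpha>) T)"
proof
  fix T
  have L: "form N (N - Suc d) (star N (\<alpha> \<^bold>\<and> ext_vec N w))"
    using form_star[OF form_wedge[OF assms(2) form_ext_vec(1)]] assms(3) by simp
  have R: "form N (N - Suc d) (contract N w (star N \<alpha>))"
    using form_contract[OF form_star[OF assms(2)]] assms(3) by simp
  show "star N (\<alpha> \<^bold>\<and> ext_vec N w) T = - contract N w (star N \<alpha>) T"
  proof (cases "T \<subseteq> {1..N} \<and> card T = N - Suc d")
    case True
    then have T: "form N (N - Suc d) (ext_basis T)"
      using form_basis[of T N] by simp
    have "(ext_basis T \<^bold>\<and> \<alpha>) \<^bold>\<and> ext_vec N w = (\<lambda>S. (-1) * (ext_vec N w \<^bold>\<and> ext_basis T \<^bold>\<and> \<alpha>) S)"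
    proof -
      have "(-1::complex) ^ ((N - Suc d + d) * 1) = - 1"
        using assms(1,3) by simp
      then show ?thesis
        using wedge_commute[OF form_wedge[OF T assms(2)] form_ext_vec(1), of w] by (simp only:)
    qed
    then have "vol N (ext_basis T \<^bold>\<and> \<alpha> \<^bold>\<and> ext_vec N w) = - vol N (ext_vec N w \<^bold>\<and> ext_basis T \<^bold>\<and> \<alpha>)"
      by (simp add: wedge_assoc vol_def)
    then have "pairing N (ext_basis T) (star N (\<alpha> \<^bold>\<and> ext_vec N w)) =
        - pairing N (ext_basis T) (contract N w (star N \<alpha>))"
      using vol_wedge_eq_pairing[of N "ext_vec N w \<^bold>\<and> ext_basis T" \<alpha>]
      by (simp add: vol_wedge_eq_pairing wedge_assoc pairing_vec_wedge)
    then show ?thesis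
      using True by (simp add: pairing_basis)
  next
    case False
    then have "star N (\<alpha> \<^bold>\<and> ext_vec N w) T = 0" "contract N w (star N \<alpha>) T = 0"
      using formD[OF L, of T] formD[OF R, of T] by blast+
    then show ?thesis
      by simp
  qed
qed

definition dual_vectors :: "nat \<Rightarrow> flag_basis \<Rightarrow> nat \<Rightarrow> (nat \<Rightarrow> complex) list" where
  "dual_vectors N v a = map (sharp N) (flag_vectors v a)"

lemma length_dual_vectors [simp]: "length (dual_vectors N v a) = a"
  by (simp add: dual_vectors_def)

lemma dual_vectors_Suc: "dual_vectors N v (Suc a) = dual_vectors N v a @ [sharp N (v (Suc a))]"
  by (simp add: dual_vectors_def flag_vectors_Suc)

lemma dual_vectors_0 [simp]: "dual_vectors N v 0 = []"
  by (simp add: dual_vectors_def flag_vectors_def)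

lemma flag_vectors_0 [simp]: "flag_vectors v 0 = []"
  by (simp add: flag_vectors_def)

lemma nth_dual_vectors [simp]: "i < a \<Longrightarrow> dual_vectors N v a ! i = sharp N (v (Suc i))"
  by (simp add: dual_vectors_def)

lemma set_dual_vectors: "set (dual_vectors N v a) = (\<lambda>i. sharp N (v i)) ` {1..a}"
  by (auto simp: dual_vectors_def set_flag_vectors)

lemma form_flag_form: "form N a (flag_form N v a)"
  unfolding flag_form_eq_wedges by (rule form_wedges_length) simp

lemma dot_dual_eq_0:
  assumes "symp_basis n v" "i \<in> {1..a}" "j \<in> {1..b}" "a + b \<le> 2 * n"
  shows "dot (2 * n) (v i) (sharp (2 * n) (v j)) = 0"
  using assms by (subst symp_basis_dot[OF assms(1)]) auto

text \<open>Both sides obey the same recursion in \<open>d\<close>: one more vector on the right is,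
  up to sign, a contraction of the complement, and contracting the dual vectors with
  \<open>v (Suc d)\<close> removes the last of them.\<close>

lemma star_flag_form:
  assumes v: "symp_basis n v" and d: "d \<le> 2 * n"
  shows "star (2 * n) (flag_form (2 * n) v d) = wedges (2 * n) (dual_vectors (2 * n) v (2 * n - d))"
proof -
  let ?N = "2 * n"
  let ?D = "\<lambda>k. wedges ?N (dual_vectors ?N v k)"
  \<comment> \<open>The recursion starts at \<open>d = 0\<close>, where both sides are top forms and
    differ by the unknown scalar \<open>c\<close>; the other end, \<open>d = 2n\<close>, gives
    \<open>c = 1\<close> because the basis is unimodular.\<close>
  define c where "c = ?D ?N {1..?N}"
  have main: "?D (?N - d) = (\<lambda>T. c * star ?N (flag_form ?N v d) T)" if "d \<le> ?N" for d
    using that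
  proof (induction d)
    case 0
    have f: "form ?N ?N (?D ?N)"
      by (rule form_wedges_length) simp
    show ?case
    proof
      fix T
      show "?D (?N - 0) T = c * star ?N (flag_form ?N v 0) T"
      proof (cases "T = {1..?N}")
        case False
        have "\<not> (T \<subseteq> {1..?N} \<and> card T = ?N)"
          using False card_subset_eq[of "{1..?N}" T] by auto
        then have "?D ?N T = 0"
          using formD[OF f, of T] by auto
        moreover have "star ?N (ext_basis {}) T = 0"
          using False by (auto simp: star_def ext_basis_def)
        ultimately show ?thesis
          by simp
      qed (simp add: star_def ext_basis_def c_def)
    qed
  next
    case (Suc d)
    have N: "?N - d = Suc (?N - Suc d)"
      using Suc.prems by simp
    have "contract ?N (v (Suc d)) (?D (?N - d)) =
        contract ?N (v (Suc d)) (?D (?N - Suc d) \<^bold>\<and> ext_vec ?N (sharp ?N (v (Suc (?N - Suc d)))))"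
      unfolding N dual_vectors_Suc
      by (simp add: wedges_append wedge_one_right[OF form_ext_vec(1)])
    also have "\<dots> = (\<lambda>S. (-1) ^ (?N - Suc d) *
        (?D (?N - Suc d) \<^bold>\<and> (\<lambda>S. dot ?N (v (Suc d)) (sharp ?N (v (Suc (?N - Suc d)))) * ext_basis {} S)) S)"
      unfolding contract_ext_vec[symmetric]
      by (subst contract_wedges_wedge)
         (use Suc.prems in \<open>auto simp: set_dual_vectors symp_basis_dot[OF v]\<close>)
    also have "dot ?N (v (Suc d)) (sharp ?N (v (Suc (?N - Suc d)))) = (-1) ^ d"
      using Suc.prems by (subst symp_basis_dot[OF v]) auto
    also have "(\<lambda>S. (-1) ^ (?N - Suc d) * (?D (?N - Suc d) \<^bold>\<and> (\<lambda>S. (-1) ^ d * ext_basis {} S)) S) =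
        (\<lambda>S. (-1) ^ (?N - Suc d + d) * ?D (?N - Suc d) S)"
      by (simp add: wedge_scale_right wedge_one_right[OF form_wedges] power_add mult.assoc)
    also have "(-1::complex) ^ (?N - Suc d + d) = - 1"
      using Suc.prems by (simp add: power_neg1_eq[of "?N - 1" 1])
    finally have "?D (?N - Suc d) = (\<lambda>S. - contract ?N (v (Suc d)) (?D (?N - d)) S)"
      by (simp add: fun_eq_iff)
    also have "\<dots> = (\<lambda>S. c * - contract ?N (v (Suc d)) (star ?N (flag_form ?N v d)) S)"
      using Suc by (simp add: contract_scale)
    also have "\<dots> = (\<lambda>S. c * star ?N (flag_form ?N v (Suc d)) S)"
      using star_wedge_vec[OF _ form_flag_form, of ?N d v "v (Suc d)"] Suc.prems by simp
    finally show ?case .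
  qed
  have "star ?N (flag_form ?N v ?N) {} = vol ?N (flag_form ?N v ?N)"
    by (simp add: star_def vol_def)
  then have "c = 1"
    using fun_cong[OF main[of ?N], of "{}"] symp_basis_vol[OF v] by (simp add: ext_basis_def)
  then show ?thesis
    using main[OF d] by simp
qed

lemma vol_wedge_flag_form:
  assumes "symp_basis n v" "d \<le> 2 * n"
  shows "vol (2 * n) (\<alpha> \<^bold>\<and> flag_form (2 * n) v d) =
    pairing (2 * n) \<alpha> (wedges (2 * n) (dual_vectors (2 * n) v (2 * n - d)))"
  by (simp add: vol_wedge_eq_pairing star_flag_form[OF assms])

text \<open>The form is skew, so exchanging the sides replaces the Gram matrix by minus its
  transpose.\<close>

lemma pairing_dual_symmetric:
  assumes "length xs = k" "length ys = k"
  shows "pairing (2 * n) (wedges (2 * n) xs) (wedges (2 * n) (map (sharp (2 * n)) ys)) =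
    (-1) ^ k * pairing (2 * n) (wedges (2 * n) ys) (wedges (2 * n) (map (sharp (2 * n)) xs))"
proof -
  define A where "A = mat k k (\<lambda>(i, j). dot (2 * n) (ys ! i) (map (sharp (2 * n)) xs ! j))"
  have A: "A \<in> carrier_mat k k"
    by (simp add: A_def)
  have "mat k k (\<lambda>(i, j). dot (2 * n) (xs ! i) (map (sharp (2 * n)) ys ! j)) = (-1) \<cdot>\<^sub>m A\<^sup>T"
  proof (rule eq_matI)
    fix i j
    assume "i < dim_row ((-1) \<cdot>\<^sub>m A\<^sup>T)" "j < dim_col ((-1) \<cdot>\<^sub>m A\<^sup>T)"
    then show "mat k k (\<lambda>(i, j). dot (2 * n) (xs ! i) (map (sharp (2 * n)) ys ! j)) $$ (i, j) =
        ((-1) \<cdot>\<^sub>m A\<^sup>T) $$ (i, j)"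
      using assms symp_form_antisym[of n "xs ! i" "ys ! j"] by (simp add: A_def symp_form_eq_dot)
  qed (simp_all add: A_def)
  then have "pairing (2 * n) (wedges (2 * n) xs) (wedges (2 * n) (map (sharp (2 * n)) ys)) = (-1) ^ k * det A"
    using A assms by (subst pairing_wedges_eq_det[of _ k]) (simp_all add: det_transpose[OF A])
  then show ?thesis
    using assms by (subst (2) pairing_wedges_eq_det[of _ k]) (simp_all add: A_def)
qed

text \<open>Exchanging the sides of the pairing gives \<open>(-1) ^ b\<close>, commuting the two
  forms gives \<open>(-1) ^ (b * c)\<close>; these agree because \<open>b + c\<close> is
  even.\<close>

lemma vol_flag_forms_swap:
  assumes v: "symp_basis n v" and w: "symp_basis n w" and bc: "b + c = 2 * n"
  shows "vol (2 * n) (flag_form (2 * n) v b \<^bold>\<and> flag_form (2 * n) w c) =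
    vol (2 * n) (flag_form (2 * n) v c \<^bold>\<and> flag_form (2 * n) w b)"
proof -
  let ?N = "2 * n"
  have c: "?N - c = b"
    using bc by simp
  have "vol ?N (flag_form ?N v b \<^bold>\<and> flag_form ?N w c) =
      pairing ?N (wedges ?N (flag_vectors v b)) (wedges ?N (dual_vectors ?N w b))"
    using vol_wedge_flag_form[OF w, of c "flag_form ?N v b"] bc
    unfolding c by (simp add: flag_form_eq_wedges)
  also have "\<dots> = (-1) ^ b * pairing ?N (wedges ?N (flag_vectors w b)) (wedges ?N (dual_vectors ?N v b))"
    unfolding dual_vectors_def by (rule pairing_dual_symmetric) simp_all
  also have "pairing ?N (wedges ?N (flag_vectors w b)) (wedges ?N (dual_vectors ?N v b)) =
      vol ?N (flag_form ?N w b \<^bold>\<and> flag_form ?N v c)"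
    using vol_wedge_flag_form[OF v, of c "flag_form ?N w b"] bc
    unfolding c by (simp add: flag_form_eq_wedges)
  also have "\<dots> = (-1) ^ (b * c) * vol ?N (flag_form ?N v c \<^bold>\<and> flag_form ?N w b)"
    by (subst wedge_commute[OF form_flag_form form_flag_form]) (simp add: vol_def)
  also have "(-1::complex) ^ (b * c) = (-1) ^ b"
  proof (rule power_neg1_eq)
    have "even (b + c)"
      using bc by simp
    then show "even (b * c + b)"
      by auto
  qed
  finally show ?thesis
    by simp
qed

lemma pairing_top:
  assumes "form N N \<alpha>"
  shows "pairing N \<alpha> \<beta> = vol N \<alpha> * vol N \<beta>"
proof -
  have "\<alpha> S = 0" if "S \<in> Pow {1..N}" "S \<noteq> {1..N}" for S
    using formD[OF assms, of S] card_subset_eq[of "{1..N}" S] that by auto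
  then have "pairing N \<alpha> \<beta> = (\<Sum>S\<in>Pow {1..N}. if S = {1..N} then \<alpha> S * \<beta> S else 0)"
    unfolding pairing_def by (intro sum.cong) auto
  then show ?thesis
    by (simp add: vol_def)
qed

text \<open>\<open>sharp\<close> has determinant 1. In the even degree \<open>2n\<close> the sides
  of the pairing can be exchanged without sign, and a pairing of top forms is a product of volumes,
  so the standard basis decides.\<close>

lemma vol_wedges_sharp:
  assumes "length ys = 2 * n"
  shows "vol (2 * n) (wedges (2 * n) (map (sharp (2 * n)) ys)) = vol (2 * n) (wedges (2 * n) ys)"
proof -
  let ?N = "2 * n" and ?e = "flag_vectors Defs.unit_vec (2 * n)"
  have "star ?N (flag_form ?N Defs.unit_vec 0) {1..?N} = 1"
    by (simp add: star_def ext_basis_def)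
  then have 1: "vol ?N (wedges ?N (map (sharp ?N) ?e)) = 1"
    using star_flag_form[OF symp_basis_unit_vec, of 0 n] by (simp add: vol_def dual_vectors_def)
  have 2: "vol ?N (wedges ?N ?e) = 1"
    using symp_basis_vol[OF symp_basis_unit_vec] by (simp add: flag_form_eq_wedges)
  have "pairing ?N (wedges ?N ?e) (wedges ?N (map (sharp ?N) ys)) =
      pairing ?N (wedges ?N ys) (wedges ?N (map (sharp ?N) ?e))"
    using pairing_dual_symmetric[of ?e ?N ys n] assms by simp
  then show ?thesis
    using assms by (simp add: pairing_top form_wedges_length 1 2)
qed

subsection \<open>The bracket functions as Gram determinants\<close>

text \<open>Comultiplication is adjoint to the wedge product. \<open>F\<close> and \<open>G\<close>
  represent \<open>f\<close> and \<open>g\<close> on basis elements of degrees \<open>p\<close> and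
  \<open>q\<close>, the only ones at which the tensor has coefficients.\<close>

lemma tensor_apply_comult:
  assumes F: "\<And>T. T \<subseteq> {1..N} \<Longrightarrow> card T = p \<Longrightarrow> f (ext_basis T) = F T" "form N p F"
    and G: "\<And>T. T \<subseteq> {1..N} \<Longrightarrow> card T = q \<Longrightarrow> g (ext_basis T) = G T" "form N q G"
  shows "tensor_apply N f g (comult p q \<omega>) = pairing N \<omega> (F \<^bold>\<and> G)"
proof -
  let ?P = "Pow {1..N}"
  have "tensor_apply N f g (comult p q \<omega>) =
      (\<Sum>T\<in>?P. \<Sum>R\<in>?P. if T \<inter> R = {} then \<omega> (T \<union> R) * (shuffle_sign T R * F T * G R) else 0)"
    unfolding tensor_apply_def
  proof (intro sum.cong refl)
    fix T R
    assume TR: "T \<in> ?P" "R \<in> ?P"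
    show "comult p q \<omega> T R * f (ext_basis T) * g (ext_basis R) =
        (if T \<inter> R = {} then \<omega> (T \<union> R) * (shuffle_sign T R * F T * G R) else 0)"
    proof (cases "card T = p \<and> card R = q")
      case True
      then show ?thesis
        using TR F(1)[of T] G(1)[of R] by (simp add: comult_def)
    next
      case False
      then have "F T = 0 \<or> G R = 0"
        using formD[OF F(2)] formD[OF G(2)] by blast
      with False show ?thesis
        by (auto simp: comult_def)
    qed
  qed
  also have "\<dots> = (\<Sum>(T, R)\<in>?P \<times> ?P. if T \<inter> R = {} then \<omega> (T \<union> R) * (shuffle_sign T R * F T * G R) else 0)"
    by (rule sum.cartesian_product)
  also have "\<dots> = (\<Sum>(T, R)\<in>{(T, R) \<in> ?P \<times> ?P. T \<inter> R = {}}. \<omega> (T \<union> R) * (shuffle_sign T R * F T * G R))"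
    by (rule sum.mono_neutral_cong_right) (auto split: if_splits)
  also have "\<dots> = (\<Sum>(S, T)\<in>Sigma ?P Pow. \<omega> S * (shuffle_sign T (S - T) * F T * G (S - T)))"
    by (rule sum.reindex_bij_witness[where i="\<lambda>(S, T). (T, S - T)" and j="\<lambda>(T, R). (T \<union> R, T)"])
       (auto simp: Un_Diff Diff_triv Int_commute Un_absorb1)
  also have "\<dots> = pairing N \<omega> (F \<^bold>\<and> G)"
    unfolding pairing_def wedge_def
    by (subst sum.Sigma[symmetric]) (auto simp: sum_distrib_left finite_subset)
  finally show ?thesis .
qed

lemma vol_wedge_left:
  assumes "symp_basis n v" "a \<le> 2 * n" "T \<subseteq> {1..2 * n}" "card T = 2 * n - a"
  shows "vol (2 * n) (flag_form (2 * n) v a \<^bold>\<and> ext_basis T) =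
    (-1) ^ a * wedges (2 * n) (dual_vectors (2 * n) v (2 * n - a)) T"
proof -
  have "form (2 * n) (2 * n - a) (ext_basis T)"
    using form_basis[OF assms(3)] assms(4) by simp
  from wedge_commute[OF form_flag_form this]
  have "vol (2 * n) (flag_form (2 * n) v a \<^bold>\<and> ext_basis T) =
      (-1) ^ (a * (2 * n - a)) * vol (2 * n) (ext_basis T \<^bold>\<and> flag_form (2 * n) v a)"
    by (simp add: vol_def)
  moreover have "(-1::complex) ^ (a * (2 * n - a)) = (-1) ^ a"
    using assms(2) by (intro power_neg1_eq) auto
  ultimately show ?thesis
    using assms(3) by (simp add: vol_wedge_flag_form[OF assms(1,2)] pairing_basis)
qed

text \<open>For \<open>a + b + c + d = 4 * n\<close> both lists have \<open>b + c\<close> entries.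
  At \<open>b = 0\<close> and at \<open>a = 2 * n\<close> one part of a list is empty, which matches
  the conventions for three indices.\<close>

definition gram :: "nat \<Rightarrow> nat \<Rightarrow> nat \<Rightarrow> nat \<Rightarrow> nat \<Rightarrow> triple \<Rightarrow> complex" where
  "gram n a b c d = (\<lambda>(U, V, W). pairing (2 * n) (wedges (2 * n) (flag_vectors U b @ flag_vectors V c))
     (wedges (2 * n) (dual_vectors (2 * n) W (2 * n - d) @ dual_vectors (2 * n) U (2 * n - a))))"

context
  fixes n :: nat and U V W :: flag_basis
  assumes symp: "symp_basis n U" "symp_basis n V" "symp_basis n W"
begin

private abbreviation (input) N where "N \<equiv> 2 * n"

lemma bracket3_eq_pairing:
  assumes "a + b + c = N"
  shows "bracket3 n a b c (U, V, W) =
    pairing N (wedges N (flag_vectors U a @ flag_vectors V b)) (wedges N (dual_vectors N W (N - c)))"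
  using assms vol_wedge_flag_form[OF symp(3), of c "flag_form N U a \<^bold>\<and> flag_form N V b"]
  by (simp add: bracket3_def Let_def wedge_assoc wedges_append flag_form_eq_wedges)

text \<open>The signs are \<open>(-1) ^ (b + c)\<close> from wedging on the left, and three times
  \<open>(-1) ^ a\<close>: from exchanging the sides of the pairing, from the cyclic rotation and
  from the definition. They cancel because \<open>a + b + c\<close> is even.\<close>

lemma bracket3_dual:
  assumes "n \<ge> 1" "a + b + c = 2 * N" "a \<le> N" "b \<le> N" "c \<le> N"
  shows "bracket3 n a b c (U, V, W) = bracket3 n (N - a) (N - b) (N - c) (U, V, W)"
proof -
  let ?DV = "wedges N (dual_vectors N V (N - b))" and ?DW = "wedges N (dual_vectors N W (N - c))"
  have FV: "form N (N - b) (\<lambda>S. (-1) ^ b * ?DV S)"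
    by (intro form_scale form_wedges_length) simp
  have FW: "form N (N - c) (\<lambda>S. (-1) ^ c * ?DW S)"
    by (intro form_scale form_wedges_length) simp
  have "bracket3 n a b c (U, V, W) = (-1) ^ a *
      tensor_apply N (\<lambda>x. vol N (flag_form N V b \<^bold>\<and> x)) (\<lambda>y. vol N (flag_form N W c \<^bold>\<and> y))
         (comult (N - b) (N - c) (flag_form N U a))"
    using assms by (simp add: bracket3_def Let_def)
  also have "tensor_apply N (\<lambda>x. vol N (flag_form N V b \<^bold>\<and> x)) (\<lambda>y. vol N (flag_form N W c \<^bold>\<and> y))
      (comult (N - b) (N - c) (flag_form N U a)) =
      pairing N (flag_form N U a) ((\<lambda>S. (-1) ^ b * ?DV S) \<^bold>\<and> (\<lambda>S. (-1) ^ c * ?DW S))"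
    by (rule tensor_apply_comult[OF _ FV _ FW])
       (simp_all add: vol_wedge_left symp assms)
  also have "\<dots> = (-1) ^ (b + c) * pairing N (wedges N (flag_vectors U a))
      (wedges N (map (sharp N) (flag_vectors V (N - b) @ flag_vectors W (N - c))))"
    by (simp add: wedge_scale_left wedge_scale_right pairing_scale_right power_add wedges_append
        flag_form_eq_wedges dual_vectors_def algebra_simps)
  also have "\<dots> = (-1) ^ (b + c) * ((-1) ^ a * pairing N (wedges N (flag_vectors V (N - b) @ flag_vectors W (N - c)))
      (wedges N (dual_vectors N U a)))"
    using assms by (subst pairing_dual_symmetric[where k=a]) (simp_all add: dual_vectors_def)
  also have "pairing N (wedges N (flag_vectors V (N - b) @ flag_vectors W (N - c)))
      (wedges N (dual_vectors N U a)) =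
      vol N ((flag_form N V (N - b) \<^bold>\<and> flag_form N W (N - c)) \<^bold>\<and> flag_form N U (N - a))"
    using vol_wedge_flag_form[OF symp(1), of "N - a"] assms
    by (simp add: wedges_append flag_form_eq_wedges)
  also have "(flag_form N V (N - b) \<^bold>\<and> flag_form N W (N - c)) \<^bold>\<and> flag_form N U (N - a) =
      (\<lambda>S. (-1) ^ a * (flag_form N U (N - a) \<^bold>\<and> flag_form N V (N - b) \<^bold>\<and> flag_form N W (N - c)) S)"
  proof -
    have "N - b + (N - c) = a"
      using assms by simp
    then have "(-1::complex) ^ ((N - b + (N - c)) * (N - a)) = (-1) ^ a"
      using assms(3) by (intro power_neg1_eq) simp
    then show ?thesis
      using wedge_commute[OF form_wedge[OF form_flag_form form_flag_form] form_flag_form,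
          of N V "N - b" W "N - c" U "N - a"] by simp
  qed
  finally have "bracket3 n a b c (U, V, W) = (-1) ^ (a + b + c) * ((-1) ^ a * ((-1) ^ a *
      vol N (flag_form N U (N - a) \<^bold>\<and> flag_form N V (N - b) \<^bold>\<and> flag_form N W (N - c))))"
    by (simp add: vol_def power_add algebra_simps)
  then show ?thesis
    using assms by (simp add: bracket3_def Let_def)
qed

lemma bracket3_swap_two:
  assumes "b + c = N"
  shows "bracket3 n 0 b c (U, V, W) = bracket3 n 0 c b (U, V, W)"
  using vol_flag_forms_swap[OF symp(2,3) assms] assms
    wedge_one_left[OF form_wedge[OF form_flag_form form_flag_form], of N V b W c]
    wedge_one_left[OF form_wedge[OF form_flag_form form_flag_form], of N V c W b]
  by (simp add: bracket3_def Let_def)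

text \<open>The cases are the branches of the definition. In the last one
  \<open>b + d \<le> 2 * n\<close> ensures that the difference \<open>a + c - 2 * n\<close> is not
  truncated.\<close>

lemma bracket4_eq_gram:
  assumes "n \<ge> 1" "a + b + c + d = 2 * N" "b \<le> a" "a \<le> N" "c \<le> N" "d \<le> N" "b + c \<le> N" "b + d \<le> N"
  shows "bracket4 n a b c d (U, V, W) = (-1) ^ a * gram n a b c d (U, V, W)"
proof -
  have max: "max a b = a" "min a b = b"
    using assms by auto
  consider "a = N" | "a \<noteq> N" "b = 0" | "a \<noteq> N" "b \<noteq> 0"
    by blast
  then show ?thesis
  proof cases
    case 1
    then show ?thesis
      using assms bracket3_eq_pairing[of b c d] by (simp add: bracket4_def Let_def gram_def max)
  next
    case 2
    have "bracket4 n a b c d (U, V, W) = bracket3 n (N - a) (N - c) (N - d) (U, V, W)"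
      using 2 assms bracket3_dual[of a c d] by (simp add: bracket4_def Let_def max)
    also have "\<dots> = vol N (flag_form N U (N - a) \<^bold>\<and> flag_form N V (N - c) \<^bold>\<and> flag_form N W (N - d))"
      using 2 assms by (simp add: bracket3_def Let_def)
    also have "flag_form N U (N - a) \<^bold>\<and> flag_form N V (N - c) \<^bold>\<and> flag_form N W (N - d) =
        (\<lambda>S. (-1) ^ d * (flag_form N W (N - d) \<^bold>\<and> flag_form N U (N - a) \<^bold>\<and> flag_form N V (N - c)) S)"
    proof -
      have "N - a + (N - c) = d"
        using 2 assms by simp
      then have "(-1::complex) ^ ((N - a + (N - c)) * (N - d)) = (-1) ^ d"
        using assms(6) by (intro power_neg1_eq) simp
      then show ?thesis
        using wedge_commute[OF form_wedge[OF form_flag_form form_flag_form] form_flag_form,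
            of N U "N - a" V "N - c" W "N - d"] by (simp add: wedge_assoc)
    qed
    also have "vol N \<dots> = (-1) ^ d * pairing N (wedges N (flag_vectors W (N - d) @ flag_vectors U (N - a)))
        (wedges N (map (sharp N) (flag_vectors V c)))"
      using vol_wedge_flag_form[OF symp(2), of "N - c" "flag_form N W (N - d) \<^bold>\<and> flag_form N U (N - a)"] assms
      by (simp add: vol_def wedge_assoc wedges_append flag_form_eq_wedges dual_vectors_def)
    also have "\<dots> = (-1) ^ d * ((-1) ^ c * gram n a b c d (U, V, W))"
      using 2 assms by (subst pairing_dual_symmetric[where k=c]) (simp_all add: gram_def dual_vectors_def)
    also have "\<dots> = (-1) ^ (c + d) * gram n a b c d (U, V, W)"
      by (simp add: power_add)
    also have "(-1::complex) ^ (c + d) = (-1) ^ a"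
      using 2 assms by (intro power_neg1_eq) presburger
    finally show ?thesis .
  next
    case 3
    let ?DU = "wedges N (dual_vectors N U (N - a))" and ?DW = "wedges N (dual_vectors N W (N - d))"
    \<comment> \<open>Represents the functional that wedges with the form of \<open>U\<close> of
      degree \<open>b\<close> on the left and with that of \<open>W\<close> on the right: the latter
      is dualised, the former becomes a contraction.\<close>
    let ?F = "fold (contract N) (flag_vectors U b) ?DW"
    have FU: "form N (N - a) (\<lambda>S. (-1) ^ a * ?DU S)"
      by (intro form_scale form_wedges_length) simp
    have "form N (N - d - length (flag_vectors U b)) ?F"
      by (intro form_fold_contract form_wedges_length) simp
    moreover have "N - d - length (flag_vectors U b) = a + c - N"
      using assms by simp
    ultimately have FW: "form N (a + c - N) ?F"
      by simp
    have "bracket4 n a b c d (U, V, W) = tensor_apply N (\<lambda>x. vol N (flag_form N U b \<^bold>\<and> x \<^bold>\<and> flag_form N W d))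
        (\<lambda>y. vol N (flag_form N U a \<^bold>\<and> y)) (comult (a + c - N) (N - a) (flag_form N V c))"
      using 3 by (simp add: bracket4_def Let_def max)
    also have "\<dots> = pairing N (flag_form N V c) (?F \<^bold>\<and> (\<lambda>S. (-1) ^ a * ?DU S))"
    proof (rule tensor_apply_comult[OF _ FW _ FU])
      fix T
      assume T: "T \<subseteq> {1..N}" "card T = a + c - N"
      have "vol N ((flag_form N U b \<^bold>\<and> ext_basis T) \<^bold>\<and> flag_form N W d) =
          pairing N (flag_form N U b \<^bold>\<and> ext_basis T) ?DW"
        using assms by (rule_tac vol_wedge_flag_form[OF symp(3)])
      then show "vol N (flag_form N U b \<^bold>\<and> ext_basis T \<^bold>\<and> flag_form N W d) = ?F T"
        using T pairing_fold_contract[OF form_basis[OF T(1)], where xs="flag_vectors U b" and \<beta>="?DW"]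
        by (simp add: wedge_assoc flag_form_eq_wedges pairing_basis)
    next
      fix T
      assume "T \<subseteq> {1..N}" "card T = N - a"
      then show "vol N (flag_form N U a \<^bold>\<and> ext_basis T) = (-1) ^ a * ?DU T"
        using assms by (intro vol_wedge_left[OF symp(1)])
    qed
    also have "\<dots> = (-1) ^ a * pairing N (flag_form N V c) (?F \<^bold>\<and> ?DU)"
      by (simp add: wedge_scale_right pairing_scale_right)
    \<comment> \<open>As \<open>b \<le> a\<close>, the first \<open>b\<close> vectors of
      \<open>U\<close> are orthogonal to the first \<open>2n - a\<close>, so the contractions may be
      extended over the second factor.\<close>
    also have "?F \<^bold>\<and> ?DU = fold (contract N) (flag_vectors U b) (?DW \<^bold>\<and> ?DU)"
    proof (rule fold_contract_wedge_wedges[symmetric])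
      fix x y
      assume "x \<in> set (flag_vectors U b)" "y \<in> set (dual_vectors N U (N - a))"
      then show "dot N x y = 0"
        using assms by (auto simp: set_flag_vectors set_dual_vectors intro!: dot_dual_eq_0[OF symp(1), of _ b _ "N - a"])
    qed (rule form_wedges)
    also have "pairing N (flag_form N V c) \<dots> = gram n a b c d (U, V, W)"
      using pairing_fold_contract[OF form_flag_form, where xs="flag_vectors U b" and \<beta>="?DW \<^bold>\<and> ?DU"]
      by (simp add: gram_def wedges_append flag_form_eq_wedges)
    finally show ?thesis .
  qed
qed

text \<open>In each of the three products exactly one factor has first index \<open>Suc a\<close>,
  so the signs relating brackets to Gram determinants are common to all of them.\<close>

lemma bracket4_octahedron:
  assumes "n \<ge> 1" "Suc a + Suc b + c + d = 2 * N" "Suc b \<le> a" "a < N" "c < N" "d < N"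
    and "b + c + 2 \<le> N" "b + d + 2 \<le> N"
  shows "bracket4 n (Suc a) (Suc b) c d (U, V, W) * bracket4 n a b (Suc c) (Suc d) (U, V, W) =
    bracket4 n a (Suc b) (Suc c) d (U, V, W) * bracket4 n (Suc a) b c (Suc d) (U, V, W) +
    bracket4 n a (Suc b) c (Suc d) (U, V, W) * bracket4 n (Suc a) b (Suc c) d (U, V, W)"
proof -
  define P where "P = (\<lambda>xs ys. pairing N (wedges N xs) (wedges N ys))"
  \<comment> \<open>The vectors by which the six brackets differ: \<open>x\<close> and
    \<open>y\<close> enter when \<open>b\<close> and \<open>c\<close> are raised, while \<xi> and
    \<eta> leave when \<open>d\<close> and \<open>a\<close> are raised, since the dual lists have
    lengths \<open>2n - d\<close> and \<open>2n - a\<close>.\<close>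
  define x y \<xi> \<eta> where "x = U (Suc b)" "y = V (Suc c)" "\<xi> = sharp N (W (N - d))" "\<eta> = sharp N (U (N - a))"
  define as bs where "as = flag_vectors U b" "bs = flag_vectors V c"
  define ss ts where "ss = dual_vectors N W (N - Suc d)" "ts = dual_vectors N U (N - Suc a)"
  note defs = x_y_\<xi>_\<eta>_def as_bs_def ss_ts_def
  have W: "dual_vectors N W (N - d) = ss @ [\<xi>]"
    using dual_vectors_Suc[of N W "N - Suc d"] assms(6) by (simp add: defs Suc_diff_Suc)
  have U: "dual_vectors N U (N - a) = ts @ [\<eta>]"
    using dual_vectors_Suc[of N U "N - Suc a"] assms(4) by (simp add: defs Suc_diff_Suc)
  have "gram n (Suc a) (Suc b) c d (U, V, W) = P (as @ x # bs) (ss @ \<xi> # ts)"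
    "gram n a b (Suc c) (Suc d) (U, V, W) = P (as @ bs @ [y]) (ss @ ts @ [\<eta>])"
    "gram n a (Suc b) (Suc c) d (U, V, W) = P (as @ x # bs @ [y]) (ss @ \<xi> # ts @ [\<eta>])"
    "gram n (Suc a) b c (Suc d) (U, V, W) = P (as @ bs) (ss @ ts)"
    "gram n a (Suc b) c (Suc d) (U, V, W) = P (as @ x # bs) (ss @ ts @ [\<eta>])"
    "gram n (Suc a) b (Suc c) d (U, V, W) = P (as @ bs @ [y]) (ss @ \<xi> # ts)"
    unfolding gram_def P_def prod.case U W by (simp_all add: defs flag_vectors_Suc)
  note gram = this
  have bracket:
    "bracket4 n (Suc a) (Suc b) c d (U, V, W) = (-1) ^ Suc a * gram n (Suc a) (Suc b) c d (U, V, W)"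
    "bracket4 n a b (Suc c) (Suc d) (U, V, W) = (-1) ^ a * gram n a b (Suc c) (Suc d) (U, V, W)"
    "bracket4 n a (Suc b) (Suc c) d (U, V, W) = (-1) ^ a * gram n a (Suc b) (Suc c) d (U, V, W)"
    "bracket4 n (Suc a) b c (Suc d) (U, V, W) = (-1) ^ Suc a * gram n (Suc a) b c (Suc d) (U, V, W)"
    "bracket4 n a (Suc b) c (Suc d) (U, V, W) = (-1) ^ a * gram n a (Suc b) c (Suc d) (U, V, W)"
    "bracket4 n (Suc a) b (Suc c) d (U, V, W) = (-1) ^ Suc a * gram n (Suc a) b (Suc c) d (U, V, W)"
    by (rule bracket4_eq_gram; use assms in simp)+
  have "P (as @ bs) (ss @ ts) * P (as @ x # bs @ [y]) (ss @ \<xi> # ts @ [\<eta>]) =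
    P (as @ x # bs) (ss @ \<xi> # ts) * P (as @ bs @ [y]) (ss @ ts @ [\<eta>]) -
    P (as @ x # bs) (ss @ ts @ [\<eta>]) * P (as @ bs @ [y]) (ss @ \<xi> # ts)"
    unfolding P_def by (rule desnanot_jacobi)
  then show ?thesis
    unfolding bracket gram by (simp add: algebra_simps)
qed

text \<open>Each side of the pairing consists of \<open>2n\<close> vectors, so it is a pairing of
  top forms and splits into two volumes.\<close>

lemma bracket4_factor:
  assumes "n \<ge> 1" "b + c = N" "a + d = N" "b \<le> a"
  shows "bracket4 n a b c d (U, V, W) = bracket3 n a 0 d (U, V, W) * vol N (flag_form N U b \<^bold>\<and> flag_form N V c)"
proof -
  have N: "N - d = a" "N - a = d"
    using assms by auto
  have "bracket4 n a b c d (U, V, W) = (-1) ^ a * gram n a b c d (U, V, W)"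
    using assms by (intro bracket4_eq_gram) auto
  also have "gram n a b c d (U, V, W) = vol N (flag_form N U b \<^bold>\<and> flag_form N V c) *
      vol N (wedges N (map (sharp N) (flag_vectors W a @ flag_vectors U d)))"
    using assms pairing_top[OF form_wedges_length[of "flag_vectors U b @ flag_vectors V c" N N]]
    by (simp add: gram_def N wedges_append flag_form_eq_wedges dual_vectors_def)
  also have "vol N (wedges N (map (sharp N) (flag_vectors W a @ flag_vectors U d))) =
      vol N (flag_form N W a \<^bold>\<and> flag_form N U d)"
    using assms by (subst vol_wedges_sharp) (auto simp: wedges_append flag_form_eq_wedges)
  also have "\<dots> = (-1) ^ (a * d) * vol N (flag_form N U d \<^bold>\<and> flag_form N W a)"
    by (subst wedge_commute[OF form_flag_form form_flag_form]) (simp add: vol_def)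
  also have "(-1::complex) ^ (a * d) = (-1) ^ a"
  proof (rule power_neg1_eq)
    have "even (a + d)"
      using assms by simp
    then show "even (a * d + a)"
      by auto
  qed
  also have "vol N (flag_form N U d \<^bold>\<and> flag_form N W a) = vol N (flag_form N U a \<^bold>\<and> flag_form N W d)"
    using assms by (intro vol_flag_forms_swap symp) auto
  finally show ?thesis
    using assms by (simp add: bracket3_def Let_def wedge_one_left[OF form_flag_form])
qed

text \<open>Both sides are brought to the volume of the forms of \<open>U\<close> and
  \<open>V\<close> of degrees \<open>b\<close> and \<open>c\<close> wedged with \<open>?Y\<close>,
  the form of \<open>W\<close> contracted with \<open>2n - a\<close> dual vectors of
  \<open>U\<close>. On the right these contractions fall on \<open>W\<close> at once; on the left
  they fall on \<open>V\<close> and are transferred.\<close>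

lemma bracket4_dual:
  assumes "n \<ge> 1" "a + b + c + d = 2 * N" "b \<le> a" "a \<le> N" "c \<le> N" "d \<le> N" "b + c \<le> N" "b + d \<le> N"
  shows "bracket4 n a b c d (U, V, W) = bracket4 n (N - b) (N - a) (N - c) (N - d) (U, V, W)"
proof -
  define m where "m = N - a"
  let ?U = "flag_vectors U" and ?V = "flag_vectors V" and ?W = "flag_vectors W"
  let ?DU = "dual_vectors N U" and ?DV = "dual_vectors N V" and ?DW = "dual_vectors N W"
  let ?Y = "fold (contract N) (?DU m) (wedges N (?W d))"
  have dims: "N - (N - d) = d" "N - (N - b) = b" "m \<le> c" "m \<le> d" "b + c + d = N + m" "m + b \<le> N"
    using assms by (auto simp: m_def)
  have kill: "dot N x y = 0" if "x \<in> set (?DU m)" "y \<in> set (?U b)" for x y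
    using that dims by (auto simp: set_flag_vectors set_dual_vectors dot_commute[of _ "sharp _ _"]
        intro!: dot_dual_eq_0[OF symp(1), of _ b _ m])
  have "form N (d - length (?DU m)) ?Y"
    by (intro form_fold_contract form_wedges_length) simp
  then have Y: "form N (d - m) ?Y"
    by simp
  have "gram n a b c d (U, V, W) =
      pairing N (wedges N (?DW (N - d)) \<^bold>\<and> wedges N (?DU m)) (wedges N (?U b) \<^bold>\<and> wedges N (?V c))"
    by (simp add: gram_def m_def pairing_commute wedges_append)
  also have "wedges N (?DW (N - d)) \<^bold>\<and> wedges N (?DU m) =
      (\<lambda>S. (-1) ^ ((N - d) * m) * (wedges N (?DU m) \<^bold>\<and> wedges N (?DW (N - d))) S)"
    by (rule wedge_commute[of N]) (simp_all add: form_wedges_length)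
  also have "pairing N \<dots> (wedges N (?U b) \<^bold>\<and> wedges N (?V c)) = (-1) ^ ((N - d) * m) *
      pairing N (wedges N (?DW (N - d))) (fold (contract N) (?DU m) (wedges N (?U b) \<^bold>\<and> wedges N (?V c)))"
    by (simp add: pairing_scale_left pairing_fold_contract[OF form_wedges])
  also have "fold (contract N) (?DU m) (wedges N (?U b) \<^bold>\<and> wedges N (?V c)) =
      (\<lambda>S. (-1) ^ (m * b) * (wedges N (?U b) \<^bold>\<and> fold (contract N) (?DU m) (wedges N (?V c))) S)"
    using fold_contract_wedges_wedge[OF kill, where \<alpha>="wedges N (?V c)"] by simp
  also have "pairing N (wedges N (?DW (N - d))) \<dots> = (-1) ^ (m * b) *
      vol N ((wedges N (?U b) \<^bold>\<and> fold (contract N) (?DU m) (wedges N (?V c))) \<^bold>\<and> flag_form N W d)"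
    using assms by (subst vol_wedge_flag_form[OF symp(3)]) (simp_all add: pairing_scale_right pairing_commute)
  also have "(wedges N (?U b) \<^bold>\<and> fold (contract N) (?DU m) (wedges N (?V c))) \<^bold>\<and> flag_form N W d =
      (\<lambda>S. (-1) ^ (Suc c * m) * (wedges N (?U b) \<^bold>\<and> wedges N (?V c) \<^bold>\<and> ?Y) S)"
    unfolding wedge_assoc flag_form_eq_wedges
    by (subst wedge_fold_contract_transfer[OF kill form_wedges form_wedges]) (use dims in simp_all)
  finally have "gram n a b c d (U, V, W) = (-1) ^ ((N - d) * m + m * b + Suc c * m) *
      vol N (wedges N (?U b) \<^bold>\<and> wedges N (?V c) \<^bold>\<and> ?Y)"
    by (simp add: vol_def power_add)
  also have "(-1::complex) ^ ((N - d) * m + m * b + Suc c * m) = (-1) ^ 0"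
  proof (rule power_neg1_eq)
    \<comment> \<open>Since \<open>b + c = N - d + m\<close>, the exponent is
      \<open>m * (2 * (N - d) + m + 1)\<close>, even because \<open>m * (m + 1)\<close> is.\<close>
    have "(N - d) * m + m * b + Suc c * m + 0 = m * (N - d + (b + c) + 1)"
      by (simp add: algebra_simps)
    also have "b + c = N - d + m"
      using dims assms by simp
    finally have e: "(N - d) * m + m * b + Suc c * m + 0 = m * (N - d + (N - d + m) + 1)" .
    show "even ((N - d) * m + m * b + Suc c * m + 0)"
      unfolding e by auto
  qed
  finally have L: "gram n a b c d (U, V, W) = vol N (wedges N (?U b) \<^bold>\<and> wedges N (?V c) \<^bold>\<and> ?Y)"
    by simp
  have "gram n (N - b) m (N - c) (N - d) (U, V, W) =
      pairing N (wedges N (?U m @ ?V (N - c))) (wedges N (map (sharp N) (?W d @ ?U b)))"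
    by (simp add: gram_def dims dual_vectors_def)
  also have "\<dots> = (-1) ^ (d + b) * pairing N (wedges N (?W d @ ?U b))
      (wedges N (map (sharp N) (?U m @ ?V (N - c))))"
    using dims assms by (intro pairing_dual_symmetric) simp_all
  also have "pairing N (wedges N (?W d @ ?U b)) (wedges N (map (sharp N) (?U m @ ?V (N - c)))) =
      pairing N (wedges N (?DU m) \<^bold>\<and> wedges N (?DV (N - c))) (wedges N (?W d) \<^bold>\<and> wedges N (?U b))"
    by (simp add: pairing_commute wedges_append dual_vectors_def)
  also have "\<dots> = pairing N (wedges N (?DV (N - c))) (?Y \<^bold>\<and> wedges N (?U b))"
    by (subst pairing_fold_contract[OF form_wedges], subst fold_contract_wedge_wedges[OF kill form_wedges]) simp_all
  also have "\<dots> = vol N ((?Y \<^bold>\<and> wedges N (?U b)) \<^bold>\<and> flag_form N V c)"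
    using assms by (subst vol_wedge_flag_form[OF symp(2)]) (simp_all add: pairing_commute)
  also have "(?Y \<^bold>\<and> wedges N (?U b)) \<^bold>\<and> flag_form N V c = ?Y \<^bold>\<and> wedges N (?U b @ ?V c)"
    by (simp add: wedge_assoc flag_form_eq_wedges wedges_append)
  also have "\<dots> = (\<lambda>S. (-1) ^ ((d - m) * (b + c)) * (wedges N (?U b @ ?V c) \<^bold>\<and> ?Y) S)"
    by (rule wedge_commute[OF Y]) (rule form_wedges_length, simp)
  finally have R: "gram n (N - b) m (N - c) (N - d) (U, V, W) = (-1) ^ (d + b + (d - m) * (b + c)) *
      vol N (wedges N (?U b) \<^bold>\<and> wedges N (?V c) \<^bold>\<and> ?Y)"
    by (simp add: vol_def power_add wedge_assoc wedges_append)
  have "(-1::complex) ^ a = (-1) ^ (N - b + (d + b + (d - m) * (b + c)))"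
  proof (rule power_neg1_eq)
    have "b + c = N - (d - m)"
      using dims assms by simp
    then have "even ((d - m) * (b + c) + (d - m))"
      using dims assms by (auto simp: m_def)
    moreover have "N - b + d + b + a + (d - m) = 2 * (d + a)"
      using dims assms by (simp add: m_def)
    ultimately show "even (a + (N - b + (d + b + (d - m) * (b + c))))"
      by presburger
  qed
  moreover have "bracket4 n (N - b) m (N - c) (N - d) (U, V, W) =
      (-1) ^ (N - b) * gram n (N - b) m (N - c) (N - d) (U, V, W)"
    using assms by (intro bracket4_eq_gram) (auto simp: m_def)
  ultimately have "bracket4 n (N - b) m (N - c) (N - d) (U, V, W) = (-1) ^ a * gram n a b c d (U, V, W)"
    unfolding L R by (simp add: power_add)
  then show ?thesis
    using bracket4_eq_gram[OF assms] by (simp add: m_def)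
qed

end

subsection \<open>Simultaneous mutations\<close>

text \<open>The result of mutating at all vertices of \<open>B\<close>, in any order, when no arrows
  join them: every contribution is then computed from the original matrix.\<close>

definition mutate_set :: "vertex set \<Rightarrow> (vertex \<Rightarrow> vertex \<Rightarrow> rat) \<Rightarrow> vertex \<Rightarrow> vertex \<Rightarrow> rat" where
  "mutate_set B b i j = (if i \<in> B \<or> j \<in> B then - b i j
     else b i j + (\<Sum>k\<in>B. if b i k * b k j \<le> 0 then 0 else \<bar>b i k\<bar> * b k j))"

definition mutate_func ::
    "nat \<Rightarrow> (vertex \<Rightarrow> vertex \<Rightarrow> rat) \<Rightarrow> (vertex \<Rightarrow> triple \<Rightarrow> complex) \<Rightarrow> vertex \<Rightarrow> triple \<Rightarrow> complex" where
  "mutate_func n b A k = (\<lambda>x.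
     ((\<Prod>j\<in>{j \<in> vertices n. b k j > 0}. A j x ^ nat \<lfloor>b k j\<rfloor>) +
      (\<Prod>j\<in>{j \<in> vertices n. b k j < 0}. A j x ^ nat \<lfloor>- b k j\<rfloor>)) / A k x)"

lemma func_mutate: "func (mutate n k S) = (func S)(k := mutate_func n (exch S) (func S) k)"
  by (simp add: mutate_def Let_def mutate_func_def)

text \<open>The earlier mutations at \<open>L\<close> have left row \<open>k\<close>, and column
  \<open>k\<close> outside of \<open>L\<close>, as they were in \<open>b\<close>.\<close>

lemma exch_mutate:
  assumes "exch S = mutate_set L b" "finite L" "k \<notin> L"
    and "\<And>i j. i \<in> insert k L \<Longrightarrow> j \<in> insert k L \<Longrightarrow> b i j = 0"
  shows "exch (mutate n k S) = mutate_set (insert k L) b"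
proof (intro ext)
  fix i j
  have row: "mutate_set L b k j = b k j" for j
    using assms(3,4) by (auto simp: mutate_set_def intro!: sum.neutral)
  have col: "mutate_set L b i k = (if i \<in> L then 0 else b i k)" for i
    using assms(3,4) by (auto simp: mutate_set_def intro!: sum.neutral)
  have "exch (mutate n k S) i j = (if k = i \<or> k = j then - mutate_set L b i j
      else if mutate_set L b i k * b k j \<le> 0 then mutate_set L b i j
      else mutate_set L b i j + \<bar>mutate_set L b i k\<bar> * b k j)"
    by (simp add: mutate_def Let_def assms(1) row)
  also have "\<dots> = mutate_set (insert k L) b i j"
    using assms(2,3) assms(4)[of i k] row[of j] col[of i]
    by (auto simp: mutate_set_def assms(4))
  finally show "exch (mutate n k S) i j = mutate_set (insert k L) b i j" .
qed

lemma fold_mutate: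
  assumes "distinct bs" "\<And>i j. i \<in> set bs \<Longrightarrow> j \<in> set bs \<Longrightarrow> exch S i j = 0"
  shows "exch (fold (mutate n) bs S) = mutate_set (set bs) (exch S)"
    and "func (fold (mutate n) bs S) =
      (\<lambda>v. if v \<in> set bs then mutate_func n (exch S) (func S) v else func S v)"
  using assms
proof (induction bs rule: rev_induct)
  case Nil
  {
    case 1
    show ?case
      by (simp add: mutate_set_def fun_eq_iff)
  next
    case 2
    show ?case
      by simp
  }
next
  case (snoc k ks)
  {
    case 1
    then show ?case
      using exch_mutate[of "fold (mutate n) ks S" "set ks" "exch S" k n] snoc by simp
  next
    case 2
    let ?A = "\<lambda>v. if v \<in> set ks then mutate_func n (exch S) (func S) v else func S v"
    have row: "mutate_set (set ks) (exch S) k = exch S k"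
      using 2 by (auto simp: mutate_set_def fun_eq_iff intro!: sum.neutral)
    have "mutate_func n (mutate_set (set ks) (exch S)) ?A k = mutate_func n (exch S) (func S) k"
    proof
      fix x
      have "(\<Prod>j\<in>{j \<in> vertices n. exch S k j > 0}. ?A j x ^ nat \<lfloor>exch S k j\<rfloor>) =
          (\<Prod>j\<in>{j \<in> vertices n. exch S k j > 0}. func S j x ^ nat \<lfloor>exch S k j\<rfloor>)"
        using 2(2)[of k] by (intro prod.cong refl) auto
      moreover have "(\<Prod>j\<in>{j \<in> vertices n. exch S k j < 0}. ?A j x ^ nat \<lfloor>- exch S k j\<rfloor>) =
          (\<Prod>j\<in>{j \<in> vertices n. exch S k j < 0}. func S j x ^ nat \<lfloor>- exch S k j\<rfloor>)"
        using 2(2)[of k] by (intro prod.cong refl) auto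
      ultimately show "mutate_func n (mutate_set (set ks) (exch S)) ?A k x = mutate_func n (exch S) (func S) k x"
        using 2(1) unfolding mutate_func_def row by simp
    qed
    moreover have "exch (fold (mutate n) ks S) = mutate_set (set ks) (exch S)"
      "func (fold (mutate n) ks S) = ?A"
      using snoc 2 by auto
    ultimately show ?case
      by (simp only: fold_append o_apply fold_simps func_mutate) auto
  }
qed

definition unit_row :: "vertex \<Rightarrow> vertex \<Rightarrow> rat" where
  "unit_row v q = (if q = v then 1 else 0)"

text \<open>Row \<open>p\<close> is split into a part \<open>A\<close> away from \<open>B\<close>
  and entries \<sigma> at the vertices of \<open>K\<close>. An entry 1 at \<open>k\<close> adds the
  positive part of row \<open>k\<close>, an entry -1 its negative part; the entry itself changes
  sign.\<close>

lemma mutate_set_row: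
  assumes B: "finite B" "p \<notin> B" "K \<subseteq> B"
    and bp: "\<And>q. b p q = A q + (\<Sum>k\<in>K. \<sigma> k * unit_row k q)"
    and A: "\<And>q. q \<in> B \<Longrightarrow> A q = 0" and \<sigma>: "\<And>k. k \<in> K \<Longrightarrow> \<sigma> k = 1 \<or> \<sigma> k = -1"
    and row: "\<And>k q. k \<in> K \<Longrightarrow> b k q = P k q - M k q"
    and PM: "\<And>k q. k \<in> K \<Longrightarrow> P k q \<ge> 0 \<and> M k q \<ge> 0 \<and> (P k q = 0 \<or> M k q = 0)"
    and PB: "\<And>k q. k \<in> K \<Longrightarrow> q \<in> B \<Longrightarrow> P k q = 0 \<and> M k q = 0"
  shows "mutate_set B b p q =
    A q + (\<Sum>k\<in>K. (if \<sigma> k = 1 then P k q else - M k q) - \<sigma> k * unit_row k q)"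
proof (cases "q \<in> B")
  case True
  have "(\<Sum>k\<in>K. (if \<sigma> k = 1 then P k q else - M k q) - \<sigma> k * unit_row k q) =
      (\<Sum>k\<in>K. - (\<sigma> k * unit_row k q))"
    by (rule sum.cong) (use PB[OF _ True] in auto)
  then show ?thesis
    using True A by (simp add: mutate_set_def bp sum_negf)
next
  case False
  have fin: "finite K"
    using B finite_subset by blast
  have bpk: "b p k = (if k \<in> K then \<sigma> k else 0)" if "k \<in> B" for k
  proof -
    have "(\<Sum>l\<in>K. \<sigma> l * unit_row l k) = (\<Sum>l\<in>K. if l = k then \<sigma> k else 0)"
      by (rule sum.cong) (auto simp: unit_row_def)
    then show ?thesis
      using fin A[OF that] by (simp add: bp)
  qed
  have "(\<Sum>k\<in>B. if b p k * b k q \<le> 0 then 0 else \<bar>b p k\<bar> * b k q) =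
      (\<Sum>k\<in>K. (if \<sigma> k = 1 then P k q else - M k q) - \<sigma> k * unit_row k q)"
  proof (rule sum.mono_neutral_cong_right[OF B(1,3)])
    show "\<forall>k\<in>B - K. (if b p k * b k q \<le> 0 then 0 else \<bar>b p k\<bar> * b k q) = 0"
      using bpk by auto
    fix k
    assume k: "k \<in> K"
    then have "b p k = \<sigma> k" "unit_row k q = 0"
      using bpk[of k] B(3) False by (auto simp: unit_row_def)
    then show "(if b p k * b k q \<le> 0 then 0 else \<bar>b p k\<bar> * b k q) =
        (if \<sigma> k = 1 then P k q else - M k q) - \<sigma> k * unit_row k q"
      using \<sigma>[OF k] PM[OF k, of q] by (auto simp: row[OF k])
  qed
  moreover have "(\<Sum>k\<in>K. \<sigma> k * unit_row k q) = 0"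
    using B(3) False by (intro sum.neutral) (auto simp: unit_row_def)
  ultimately show ?thesis
    using False B(2) by (simp add: mutate_set_def bp)
qed

subsection \<open>The exchange matrices along the mutation sequence\<close>

text \<open>
  Where the exchange relations involve a position \<open>(i, 0)\<close> or \<open>(0, j)\<close> outside of the triangle of
  mutable vertices, the function there splits into two frozen factors, which depend on the number
  \<open>t\<close> of mutations that the position would have undergone. Hence the two summands.
\<close>

definition vertex_row :: "nat \<Rightarrow> nat \<Rightarrow> nat \<Rightarrow> nat \<Rightarrow> vertex \<Rightarrow> rat" where
  "vertex_row n t i j q = (if i = 0 \<or> j = 0 then unit_row (X 0 (j + t)) q + unit_row (Y (n - (i + t))) q
     else unit_row (X i j) q)"

text \<open>The six arrows at a vertex of a triangular grid, the shape away from the block in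
  progress. For \<open>j = 1\<close> and \<open>t = 0\<close> the positions \<open>(i, 0)\<close>
  and \<open>(i - 1, 0)\<close> both contribute \<open>X 0 0\<close>, which is no vertex; the two
  contributions cancel.\<close>

definition hexagon_row :: "nat \<Rightarrow> nat \<Rightarrow> nat \<Rightarrow> nat \<Rightarrow> vertex \<Rightarrow> rat" where
  "hexagon_row n t i j q =
     vertex_row n t (i - 1) j q + vertex_row n t i (j - 1) q + vertex_row n t (i + 1) (j + 1) q -
     vertex_row n t (i + 1) j q - vertex_row n t i (j + 1) q - vertex_row n t (i - 1) (j - 1) q"

text \<open>With \<open>in_row\<close> it gives the arrows at the moment of mutation: four of the
  six neighbours remain, and which pair is incoming depends on the side of the diagonal.\<close>

definition out_row :: "nat \<Rightarrow> nat \<Rightarrow> nat \<Rightarrow> nat \<Rightarrow> vertex \<Rightarrow> rat" where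
  "out_row n t i j q = vertex_row n t (i - 1) (j - 1) q + vertex_row n t (i + 1) (j + 1) q"

definition in_row :: "nat \<Rightarrow> nat \<Rightarrow> nat \<Rightarrow> nat \<Rightarrow> vertex \<Rightarrow> rat" where
  "in_row n t i j q =
     (if j < i then vertex_row n t (i - 1) j q + vertex_row n t (i + 1) j q
      else if i < j then vertex_row n t i (j - 1) q + vertex_row n t i (j + 1) q
      else vertex_row n t i (j + 1) q + vertex_row n t (i + 1) j q)"

text \<open>The row of \<open>X i j\<close> after the blocks \<open>1, \<dots>, m\<close> of stage \<open>r = n - T\<close>, for \<open>max i j \<le> r\<close>.\<close>

definition stage_row :: "nat \<Rightarrow> nat \<Rightarrow> nat \<Rightarrow> nat \<Rightarrow> nat \<Rightarrow> vertex \<Rightarrow> rat" where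
  "stage_row n T m i j q =
     (if max i j < m then hexagon_row n T i j q
      else if max i j = m then in_row n T i j q - out_row n T i j q
      else if max i j = Suc m then out_row n T i j q - in_row n T i j q
      else hexagon_row n (T - 1) i j q)"

section \<open>Supports and signs of the local rows\<close>

lemma unit_row_eq_vertex_row: "0 < i \<Longrightarrow> 0 < j \<Longrightarrow> unit_row (X i j) = vertex_row n t i j"
  by (simp add: vertex_row_def fun_eq_iff)

lemma vertex_row_inner: "0 < i \<Longrightarrow> 0 < j \<Longrightarrow> vertex_row n t i j = vertex_row n s i j"
  by (simp add: vertex_row_def fun_eq_iff)

lemma vertex_row_nonneg: "vertex_row n t i j q \<ge> 0"
  by (simp add: vertex_row_def unit_row_def)

lemma finite_block [simp]: "finite (block n m)"
  by (rule finite_subset[of _ "(\<lambda>(i, j). X i j) ` ({..n} \<times> {..n})"]) (auto simp: block_def)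

lemma blockE:
  assumes "q \<in> block n m"
  obtains a c where "q = X a c" "0 < a" "0 < c" "a < n" "c < n" "max a c = m"
proof -
  obtain a c where *: "q = X a c" "1 \<le> a" "a \<le> n - 1" "1 \<le> c" "c \<le> n - 1" "max a c = m"
    using assms unfolding block_def mem_Collect_eq by blast
  show thesis
    by (rule that[of a c]) (use * in linarith)+
qed

lemma vertex_row_block:
  assumes "q \<in> block n m" "(i < m \<and> j < m) \<or> m < i \<or> m < j \<or> i = 0 \<or> j = 0"
  shows "vertex_row n t i j q = 0"
proof -
  obtain a c where q: "q = X a c" "0 < a" "0 < c" "max a c = m"
    using assms(1) by (rule blockE)
  then have "a \<noteq> 0" "i = 0 \<or> j = 0 \<or> (a, c) \<noteq> (i, j)"
    using assms(2) by auto
  then show ?thesis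
    unfolding q(1) vertex_row_def unit_row_def by auto
qed

lemma in_row_real:
  assumes "0 < i" "0 < j"
  shows "in_row n t i j q = (\<Sum>v\<in>(if j < i then {X (i - 1) j, X (i + 1) j}
    else if i < j then {X i (j - 1), X i (j + 1)} else {X i (j + 1), X (i + 1) j}). unit_row v q)"
  using assms by (auto simp: in_row_def vertex_row_def)

lemma sum_unit_row: "finite A \<Longrightarrow> (\<Sum>v\<in>A. unit_row v q) = (if q \<in> A then 1 else 0)"
  by (simp add: unit_row_def)

text \<open>Ensures that \<open>out_row\<close> and \<open>in_row\<close> are the positive and
  negative parts of their difference, as the mutation rule requires.\<close>

lemma out_in_disjoint:
  assumes "0 < i" "0 < j"
  shows "out_row n t i j q = 0 \<or> in_row n t i j q = 0"
proof (cases "in_row n t i j q = 0")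
  case False
  then have "q \<in> (if j < i then {X (i - 1) j, X (i + 1) j}
      else if i < j then {X i (j - 1), X i (j + 1)} else {X i (j + 1), X (i + 1) j})"
    unfolding in_row_real[OF assms] by (subst (asm) sum_unit_row) (simp_all del: One_nat_def split: if_split_asm)
  then have "vertex_row n t (i - 1) (j - 1) q = 0" "vertex_row n t (i + 1) (j + 1) q = 0"
    using assms by (auto simp: vertex_row_def unit_row_def split: if_splits)
  then show ?thesis
    by (simp add: out_row_def)
qed simp

lemma out_row_nonneg: "out_row n t i j q \<ge> 0"
  by (simp add: out_row_def vertex_row_nonneg)

lemma in_row_nonneg: "in_row n t i j q \<ge> 0"
  by (simp add: in_row_def vertex_row_nonneg)

text \<open>All neighbours lie on other levels of \<open>max i j\<close> or are frozen, so no arrow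
  joins two vertices of the block being mutated.\<close>

lemma out_in_block:
  assumes "q \<in> block n (max i j)" "0 < i" "0 < j"
  shows "out_row n t i j q = 0 \<and> in_row n t i j q = 0"
proof -
  have "vertex_row n t (i - 1) (j - 1) q = 0" "vertex_row n t (i + 1) (j + 1) q = 0"
    using assms by (auto intro!: vertex_row_block)
  moreover have "in_row n t i j q = 0"
    using assms unfolding in_row_def by (auto simp: vertex_row_block)
  ultimately show ?thesis
    by (simp add: out_row_def)
qed

text \<open>At the corner the three border positions of the hexagon combine to the split position
  \<open>(0, 0)\<close> with index \<open>t + 1\<close>, so a stage can begin there without a
  preceding block.\<close>

lemma hexagon_row_first: "hexagon_row n t (Suc 0) (Suc 0) q = out_row n (Suc t) (Suc 0) (Suc 0) q - in_row n (Suc t) (Suc 0) (Suc 0) q"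
  by (simp add: hexagon_row_def out_row_def in_row_def vertex_row_def)

lemma solid_arrows_simps:
  "(X a c, X i j) \<in> solid_arrows n \<longleftrightarrow> (1 \<le> a \<and> a \<le> n \<and> 1 \<le> c \<and> c \<le> n \<and> i = a - 1 \<and> j = c) \<or>
    (1 \<le> a \<and> a \<le> n - 1 \<and> 2 \<le> c \<and> c \<le> n \<and> i = a \<and> j = c - 1) \<or>
    (a \<le> n - 1 \<and> 1 \<le> c \<and> c \<le> n - 1 \<and> i = a + 1 \<and> j = c + 1)"
  "(X i j, Y k) \<in> solid_arrows n \<longleftrightarrow> (1 \<le> i \<and> i \<le> n - 1 \<and> j = 1 \<and> k = n - i) \<or> (i = 0 \<and> j = n \<and> k = n)"
  "(Y k, X i j) \<in> solid_arrows n \<longleftrightarrow> (k = n \<and> i = 1 \<and> j = n) \<or> (1 \<le> k \<and> k \<le> n - 1 \<and> i = n - k + 1 \<and> j = 1)"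
  unfolding solid_arrows_def Un_iff mem_Collect_eq by simp_all blast+

text \<open>\<open>X i j\<close> is black for \<open>j < n\<close>, so its row has no weight 2;
  dotted arrows join frozen vertices and are absent from it.\<close>

lemma init_exch_row:
  assumes "0 < i" "0 < j" "i < n" "j < n"
  shows "init_exch n (X i j) q = hexagon_row n 0 i j q"
proof -
  have out: "(X i j, q) \<in> solid_arrows n \<longleftrightarrow> q = X (i - 1) j \<or> (2 \<le> j \<and> q = X i (j - 1)) \<or>
      (j = 1 \<and> q = Y (n - i)) \<or> q = X (i + 1) (j + 1)"
    using assms by (cases q) (auto simp: solid_arrows_simps)
  have "in": "(q, X i j) \<in> solid_arrows n \<longleftrightarrow> q = X (i + 1) j \<or> q = X i (j + 1) \<or>
      (2 \<le> j \<and> q = X (i - 1) (j - 1)) \<or> (j = 1 \<and> 2 \<le> i \<and> q = Y (n - (i - 1)))"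
  proof (cases q)
    case (X a c)
    have "(X a c, X i j) \<in> solid_arrows n \<longleftrightarrow>
        (a = i + 1 \<and> c = j) \<or> (a = i \<and> c = j + 1) \<or> (2 \<le> j \<and> a = i - 1 \<and> c = j - 1)" (is "?L \<longleftrightarrow> ?R")
    proof
      assume ?L
      then consider "1 \<le> a" "i = a - 1" "j = c" | "2 \<le> c" "i = a" "j = c - 1" | "1 \<le> c" "i = a + 1" "j = c + 1"
        unfolding solid_arrows_simps by blast
      then show ?R
        by cases auto
    next
      assume ?R
      then show ?L
        unfolding solid_arrows_simps using assms by (elim disjE conjE) auto
    qed
    then show ?thesis
      by (auto simp: X)
  next
    case (Y k)
    have "(Y k, X i j) \<in> solid_arrows n \<longleftrightarrow> j = 1 \<and> 2 \<le> i \<and> k = n - (i - 1)"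
      unfolding solid_arrows_simps using assms by auto
    then show ?thesis
      by (auto simp: Y)
  qed
  have dot: "(X i j, q) \<notin> dotted_arrows n" "(q, X i j) \<notin> dotted_arrows n"
    using assms by (auto simp: dotted_arrows_def)
  have white: "X i j \<notin> white n"
    using assms by (auto simp: white_def)
  define O1 where "O1 = {X (i - 1) j, X (i + 1) (j + 1)} \<union> (if j = 1 then {Y (n - i)} else {X i (j - 1)})"
  define I1 where "I1 = {X (i + 1) j, X i (j + 1)} \<union> (if j = 1 then (if i = 1 then {} else {Y (n - (i - 1))})
    else {X (i - 1) (j - 1)})"
  have fin: "finite O1" "finite I1"
    by (simp_all add: O1_def I1_def)
  have "(X i j, q) \<in> solid_arrows n \<longleftrightarrow> q \<in> O1"
    unfolding out O1_def using assms by auto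
  moreover have "(q, X i j) \<in> solid_arrows n \<longleftrightarrow> q \<in> I1"
    unfolding "in" I1_def using assms by auto
  moreover have "O1 \<inter> I1 = {}"
    using assms by (auto simp: O1_def I1_def)
  ultimately have "init_exch n (X i j) q = (\<Sum>v\<in>O1. unit_row v q) - (\<Sum>v\<in>I1. unit_row v q)"
    unfolding sum_unit_row[OF fin(1)] sum_unit_row[OF fin(2)] init_exch_def Let_def using dot white
    by auto
  also have "\<dots> = hexagon_row n 0 i j q"
    using assms by (cases "i = 1"; cases "j = 1") (simp_all add: O1_def I1_def hexagon_row_def vertex_row_def)
  finally show ?thesis .
qed

text \<open>By the value of \<open>max i j\<close>: level \<open>m + 1\<close> is mutated and
  reverses its row, level \<open>m\<close> returns to the hexagon, now with index \<open>T\<close>,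
  and level \<open>m + 2\<close> passes from the hexagon to the shape it has when mutated. Other
  rows have no entry in the block.\<close>

lemma stage_row_step:
  assumes b: "\<And>i j q. 0 < i \<Longrightarrow> 0 < j \<Longrightarrow> max i j \<le> n - T \<Longrightarrow> b (X i j) q = stage_row n T m i j q"
    and T: "0 < T" and m: "m < n - T" and ij: "0 < i" "0 < j" "max i j \<le> n - T"
  shows "mutate_set (block n (Suc m)) b (X i j) q = stage_row n T (Suc m) i j q"
proof -
  let ?B = "block n (Suc m)"
  note rows = in_row_def out_row_def unit_row_eq_vertex_row[of _ _ n T]
  obtain t where t: "T = Suc t"
    using T by (cases T) auto
  \<comment> \<open>The positive and negative parts of the rows of the block.\<close>
  define P where "P v = (case v of X i j \<Rightarrow> out_row n T i j | Y _ \<Rightarrow> \<lambda>_. 0)" for v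
  define M where "M v = (case v of X i j \<Rightarrow> in_row n T i j | Y _ \<Rightarrow> \<lambda>_. 0)" for v
  have B: "X i j \<in> ?B \<longleftrightarrow> 0 < i \<and> 0 < j \<and> max i j = Suc m" for i j
    using m T by (auto simp: block_def max_def split: if_splits)
  have PM: "P v q \<ge> 0 \<and> M v q \<ge> 0 \<and> (P v q = 0 \<or> M v q = 0)"
    and PB: "q \<in> ?B \<Longrightarrow> P v q = 0 \<and> M v q = 0" and rowB: "b v q = P v q - M v q" if vB: "v \<in> ?B" for v q
  proof -
    obtain a c where v: "v = X a c" "0 < a" "0 < c" "a < n" "c < n" "max a c = Suc m"
      using vB by (rule blockE)
    show "P v q \<ge> 0 \<and> M v q \<ge> 0 \<and> (P v q = 0 \<or> M v q = 0)"
      using out_in_disjoint[of a c n T q] v by (simp add: P_def M_def out_row_nonneg in_row_nonneg)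
    show "q \<in> ?B \<Longrightarrow> P v q = 0 \<and> M v q = 0"
      using out_in_block[of q n a c T] v by (simp add: P_def M_def)
    show "b v q = P v q - M v q"
      using b[of a c q] v m by (simp add: P_def M_def stage_row_def)
  qed
  let ?R = "\<lambda>A K \<sigma>. A q + (\<Sum>k\<in>K. (if \<sigma> k = 1 then P k q else - M k q) - \<sigma> k * unit_row k q)"
  have step: "mutate_set ?B b (X i j) q = ?R A K \<sigma>"
    if "max i j \<noteq> Suc m" "K \<subseteq> ?B" "\<And>q. b (X i j) q = A q + (\<Sum>k\<in>K. \<sigma> k * unit_row k q)"
      "\<And>q. q \<in> ?B \<Longrightarrow> A q = 0" "\<And>k. k \<in> K \<Longrightarrow> \<sigma> k = 1 \<or> \<sigma> k = -1" for A K \<sigma>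
  proof (rule mutate_set_row[where p="X i j" and K=K and \<sigma>=\<sigma> and A=A and P=P and M=M])
    show "X i j \<notin> ?B"
      using that(1) by (auto elim: blockE)
  qed (use that PM PB rowB in \<open>simp_all only: finite_block subsetD[OF that(2)]\<close>)
  have bp: "b (X i j) q = stage_row n T m i j q" for q
    by (rule b[OF ij])
  obtain i' j' where ij': "i = Suc i'" "j = Suc j'"
    using ij by (metis Suc_pred)
  consider "max i j = Suc m" | "max i j = m" | "max i j = Suc (Suc m)" |
      "max i j < m \<or> max i j > Suc (Suc m)"
    by linarith
  then show ?thesis
  proof cases
    case 1
    then show ?thesis
      using B[of i j] ij by (simp add: mutate_set_def bp stage_row_def)
  next
    case 4
    have "mutate_set ?B b (X i j) q = ?R (b (X i j)) {} (\<lambda>_. 1)"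
    proof (rule step[where \<sigma>="\<lambda>_. 1"])
      fix q
      assume "q \<in> ?B"
      then show "b (X i j) q = 0"
        using 4 by (auto simp: bp[unfolded ij'] stage_row_def hexagon_row_def vertex_row_block ij' max_def split: if_splits)
    qed (use 4 in auto)
    then show ?thesis
      using 4 unfolding bp by (auto simp: stage_row_def)
  next
    case 2
    have row: "b (X i j) q = in_row n T i j q - out_row n T i j q" for q
      using 2 unfolding bp by (simp add: stage_row_def)
    consider "j < i" | "i < j" | "i = j"
      by linarith
    then show ?thesis
    proof cases
      case a: 1
      have m': "m = Suc i'"
        using 2 a ij' by simp
      let ?\<sigma> = "\<lambda>v. if v = X (i + 1) j then 1 else - 1 :: rat"
      have "mutate_set ?B b (X i j) q = ?R (\<lambda>q. vertex_row n T (i - 1) j q - vertex_row n T (i - 1) (j - 1) q) {X (i + 1) (j + 1), X (i + 1) j} ?\<sigma>"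
        by (rule step; (unfold row)?; use m' a ij' in \<open>auto simp: B[unfolded m'] rows vertex_row_block\<close>)
      then show ?thesis
        using m' a ij' by (simp add: P_def M_def stage_row_def hexagon_row_def rows)
    next
      case a: 2
      have m': "m = Suc j'"
        using 2 a ij' by simp
      let ?\<sigma> = "\<lambda>v. if v = X i (j + 1) then 1 else - 1 :: rat"
      have "mutate_set ?B b (X i j) q = ?R (\<lambda>q. vertex_row n T i (j - 1) q - vertex_row n T (i - 1) (j - 1) q) {X (i + 1) (j + 1), X i (j + 1)} ?\<sigma>"
        by (rule step; (unfold row)?; use m' a ij' in \<open>auto simp: B[unfolded m'] rows vertex_row_block\<close>)
      then show ?thesis
        using m' a ij' by (simp add: P_def M_def stage_row_def hexagon_row_def rows)
    next
      case a: 3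
      have m': "m = Suc j'"
        using 2 a ij' by simp
      let ?\<sigma> = "\<lambda>v. if v = X (i + 1) (j + 1) then - 1 else 1 :: rat"
      have "mutate_set ?B b (X i j) q = ?R (\<lambda>q. - vertex_row n T (i - 1) (j - 1) q) {X (i + 1) (j + 1), X i (j + 1), X (i + 1) j} ?\<sigma>"
        by (rule step; (unfold row)?; use m' a ij' in \<open>auto simp: B[unfolded m'] rows vertex_row_block\<close>)
      then show ?thesis
        using m' a ij' by (simp add: P_def M_def stage_row_def hexagon_row_def rows)
    qed
  next
    case 3
    have row: "b (X i j) q = hexagon_row n t i j q" for q
      using 3 by (simp add: bp stage_row_def t)
    consider "j < i" "j' \<noteq> 0" | "j < i" "j' = 0" | "i < j" "i' \<noteq> 0" | "i < j" "i' = 0" | "i = j"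
      by linarith
    then show ?thesis
    proof cases
      case a: 1
      have m': "i' = Suc m"
        using 3 a ij' by simp
      let ?\<sigma> = "\<lambda>v. if v = X i' j then 1 else - 1 :: rat"
      let ?A = "\<lambda>q. vertex_row n T i j' q + vertex_row n T (i + 1) (j + 1) q -
          vertex_row n T (i + 1) j q - vertex_row n T i (j + 1) q"
      have "mutate_set ?B b (X i j) q = ?R ?A {X i' j, X i' j'} ?\<sigma>"
        by (rule step; (unfold row)?; use m' a ij' in \<open>auto simp: B hexagon_row_def
            vertex_row_block rows(3) vertex_row_inner[of _ _ n t T]\<close>)
      then show ?thesis
        using m' a ij' by (simp add: P_def M_def stage_row_def rows)
    next
      case a: 2
      have m': "i' = Suc m"
        using 3 a ij' by simp
      obtain i'' where i'': "i' = Suc i''"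
        using a ij' by (cases i') auto
      \<comment> \<open>In the first column the border entries still have index \<open>t\<close>.
        They amount to a difference of two \<open>Y\<close>, which combines with the split position
        in the row of \<open>X i' j\<close> to the split position of index \<open>T\<close>.\<close>
      let ?A = "\<lambda>q. vertex_row n t i j' q - vertex_row n t i' j' q + vertex_row n T (i + 1) (j + 1) q -
          vertex_row n T (i + 1) j q - vertex_row n T i (j + 1) q"
      have "mutate_set ?B b (X i j) q = ?R ?A {X i' j} (\<lambda>_. 1)"
        by (rule step[where \<sigma>="\<lambda>_. 1"]; (unfold row)?; use m' a ij' in \<open>auto simp: B hexagon_row_def
            vertex_row_block rows(3) vertex_row_inner[of _ _ n t T]\<close>)
      then show ?thesis
        using m' a ij' i'' by (simp add: P_def M_def stage_row_def in_row_def out_row_def t)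
          (simp add: vertex_row_def)
    next
      case a: 3
      have m': "j' = Suc m"
        using 3 a ij' by simp
      let ?\<sigma> = "\<lambda>v. if v = X i j' then 1 else - 1 :: rat"
      let ?A = "\<lambda>q. vertex_row n T i' j q + vertex_row n T (i + 1) (j + 1) q -
          vertex_row n T (i + 1) j q - vertex_row n T i (j + 1) q"
      have "mutate_set ?B b (X i j) q = ?R ?A {X i j', X i' j'} ?\<sigma>"
        by (rule step; (unfold row)?; use m' a ij' in \<open>auto simp: B hexagon_row_def
            vertex_row_block rows(3) vertex_row_inner[of _ _ n t T]\<close>)
      then show ?thesis
        using m' a ij' by (simp add: P_def M_def stage_row_def rows)
    next
      case a: 4
      have m': "j' = Suc m"
        using 3 a ij' by simp
      obtain j'' where j'': "j' = Suc j''"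
        using a ij' by (cases j') auto
      let ?A = "\<lambda>q. vertex_row n t i' j q - vertex_row n t i' j' q + vertex_row n T (i + 1) (j + 1) q -
          vertex_row n T (i + 1) j q - vertex_row n T i (j + 1) q"
      have "mutate_set ?B b (X i j) q = ?R ?A {X i j'} (\<lambda>_. 1)"
        by (rule step[where \<sigma>="\<lambda>_. 1"]; (unfold row)?; use m' a ij' in \<open>auto simp: B hexagon_row_def
            vertex_row_block rows(3) vertex_row_inner[of _ _ n t T]\<close>)
      then show ?thesis
        using m' a ij' j'' by (simp add: P_def M_def stage_row_def in_row_def out_row_def t)
          (simp add: vertex_row_def)
    next
      case a: 5
      have i': "i' = Suc m" "j' = i'" "j = i"
        using 3 a ij' by auto
      let ?A = "\<lambda>q. vertex_row n T i' j q + vertex_row n T i j' q + vertex_row n T (i + 1) (j + 1) q -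
          vertex_row n T (i + 1) j q - vertex_row n T i (j + 1) q"
      have "mutate_set ?B b (X i j) q = ?R ?A {X i' j'} (\<lambda>_. - 1)"
        by (rule step[where \<sigma>="\<lambda>_. - 1"]; (unfold row)?; use 3 a ij' i' in \<open>auto simp: B hexagon_row_def
            vertex_row_block rows(3) vertex_row_inner[of _ _ n t T]\<close>)
      then show ?thesis
        using 3 a ij' i' by (simp add: P_def M_def stage_row_def rows)
    qed
  qed
qed

subsection \<open>The functions along the mutation sequence\<close>

lemma mutate_func_eq:
  assumes row: "\<And>q. b k q = (\<Sum>v\<in>P. unit_row v q) - (\<Sum>v\<in>Q. unit_row v q)"
    and sets: "P \<subseteq> vertices n" "Q \<subseteq> vertices n" "finite P" "finite Q" "P \<inter> Q = {}"
  shows "mutate_func n b A k x = ((\<Prod>j\<in>P. A j x) + (\<Prod>j\<in>Q. A j x)) / A k x"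
proof -
  have b: "b k q = (if q \<in> P then 1 else if q \<in> Q then - 1 else 0)" for q
    unfolding row sum_unit_row[OF sets(3)] sum_unit_row[OF sets(4)] using sets(5) by auto
  have "{j \<in> vertices n. b k j > 0} = P" "{j \<in> vertices n. b k j < 0} = Q"
    using sets by (auto simp: b split: if_splits)
  moreover have "(\<Prod>j\<in>P. A j x ^ nat \<lfloor>b k j\<rfloor>) = (\<Prod>j\<in>P. A j x)"
    by (rule prod.cong) (auto simp: b)
  moreover have "(\<Prod>j\<in>Q. A j x ^ nat \<lfloor>- b k j\<rfloor>) = (\<Prod>j\<in>Q. A j x)"
    by (rule prod.cong) (use sets(5) in \<open>auto simp: b\<close>)
  ultimately show ?thesis
    by (simp add: mutate_func_def)
qed

text \<open>
  The right-hand side of the exchange relation at \<open>X i j\<close>, where \<open>l\<close> gives the functions after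
  \<open>t\<close> mutations and \<open>h\<close> those after \<open>t + 1\<close> mutations.
\<close>

definition exchange_rhs ::
    "nat \<Rightarrow> nat \<Rightarrow> nat \<Rightarrow> nat \<Rightarrow> (vertex \<Rightarrow> complex) \<Rightarrow> (vertex \<Rightarrow> complex) \<Rightarrow> complex" where
  "exchange_rhs n i j t l h =
     (if i = 1 \<or> j = 1 then l (X 0 (j + t)) * l (Y (n - (i + t))) else h (X (i - 1) (j - 1))) *
       l (X (i + 1) (j + 1)) +
     (if j < i then h (X (i - 1) j) * l (X (i + 1) j)
      else if i < j then h (X i (j - 1)) * l (X i (j + 1))
      else l (X i (j + 1)) * l (X (i + 1) j))"

lemma mutate_func_block:
  assumes row: "\<And>q. b (X i j) q = out_row n (Suc t) i j q - in_row n (Suc t) i j q"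
    and T: "0 < i" "0 < j" "t + max i j < n"
  shows "mutate_func n b A (X i j) x = exchange_rhs n i j t (\<lambda>v. A v x) (\<lambda>v. A v x) / A (X i j) x"
proof -
  define P where "P = insert (X (i + 1) (j + 1))
    (if i = 1 \<or> j = 1 then {X 0 (j + t), Y (n - (i + t))} else {X (i - 1) (j - 1)})"
  define Q where "Q = (if j < i then {X (i - 1) j, X (i + 1) j}
    else if i < j then {X i (j - 1), X i (j + 1)} else {X i (j + 1), X (i + 1) j})"
  have fin: "finite P" "finite Q"
    by (simp_all add: P_def Q_def)
  obtain a c where ac: "i = Suc a" "j = Suc c"
    using T by (metis Suc_pred)
  have "out_row n (Suc t) i j q = (\<Sum>v\<in>P. unit_row v q)" for q
    using T by (auto simp: out_row_def vertex_row_def P_def ac)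
  moreover have "in_row n (Suc t) i j q = (\<Sum>v\<in>Q. unit_row v q)" for q
    unfolding Q_def by (rule in_row_real) (use T in auto)
  ultimately have "b (X i j) q = (\<Sum>v\<in>P. unit_row v q) - (\<Sum>v\<in>Q. unit_row v q)" for q
    by (simp add: row)
  moreover have "P \<subseteq> vertices n" "Q \<subseteq> vertices n"
    using T by (auto simp: P_def Q_def vertices_def)
  moreover have "P \<inter> Q = {}"
    using T by (auto simp: P_def Q_def)
  ultimately have "mutate_func n b A (X i j) x = ((\<Prod>j\<in>P. A j x) + (\<Prod>j\<in>Q. A j x)) / A (X i j) x"
    using fin by (intro mutate_func_eq)
  moreover have "(\<Prod>j\<in>P. A j x) + (\<Prod>j\<in>Q. A j x) = exchange_rhs n i j t (\<lambda>v. A v x) (\<lambda>v. A v x)"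
    using T by (auto simp: P_def Q_def exchange_rhs_def)
  ultimately show ?thesis
    by simp
qed

text \<open>The count after blocks \<open>1, \<dots>, m\<close> of stage \<open>T\<close>. The
  minimum accounts for vertices that dropped out earlier: stage \<open>s\<close> reaches only
  \<open>max i j \<le> n - s\<close>.\<close>

definition mutation_count :: "nat \<Rightarrow> nat \<Rightarrow> nat \<Rightarrow> vertex \<Rightarrow> nat" where
  "mutation_count n T m v = (case v of
      X i j \<Rightarrow> if i = 0 then 0 else if max i j \<le> m then T else min (T - 1) (n - max i j)
    | Y _ \<Rightarrow> 0)"

lemma seed_after_append: "seed_after n (ks @ bs) = fold (mutate n) bs (seed_after n ks)"
  by (simp add: seed_after_def)

lemma count_list_distinct: "distinct bs \<Longrightarrow> count_list bs v = (if v \<in> set bs then 1 else 0)"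
  by (induction bs) auto

text \<open>The indices of the blocks to come, first those of stage \<open>T\<close> above
  \<open>m\<close> and then those of all later stages.\<close>

definition remaining :: "nat \<Rightarrow> nat \<Rightarrow> nat \<Rightarrow> nat list" where
  "remaining n T m = [Suc m..<Suc (n - T)] @ concat (map (\<lambda>r. [1..<r + 1]) (rev [1..<n - T]))"

section \<open>The mutation sequence at one fixed triple, with prescribed values
  \<open>F v t\<close>\<close>

context
  fixes n :: nat and F :: "vertex \<Rightarrow> nat \<Rightarrow> complex" and x :: triple
  assumes F0: "\<And>v. v \<in> vertices n \<Longrightarrow> F v 0 = init_func n v x"
    and F_nonzero: "\<And>i j t. 0 < i \<Longrightarrow> 0 < j \<Longrightarrow> t + max i j < n \<Longrightarrow> F (X i j) t \<noteq> 0"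
    and F_frozen: "\<And>c k t. F (X 0 c) t = F (X 0 c) 0 \<and> F (Y k) t = F (Y k) 0"
    and F_exchange: "\<And>i j t. 0 < i \<Longrightarrow> 0 < j \<Longrightarrow> t + max i j < n \<Longrightarrow>
      F (X i j) t * F (X i j) (Suc t) = exchange_rhs n i j t (\<lambda>v. F v t) (\<lambda>v. F v (Suc t))"
begin

definition good :: "vertex list \<Rightarrow> bool" where
  "good ks \<longleftrightarrow> (\<forall>v\<in>vertices n. func (seed_after n ks) v x = F v (count_list ks v))"

text \<open>The invariant after blocks \<open>1, \<dots>, m\<close> of stage \<open>T\<close>. Rows
  are recorded only for \<open>max i j \<le> n - T\<close>, since no other vertex is mutated from
  this stage on.\<close>

definition state :: "nat \<Rightarrow> nat \<Rightarrow> vertex list \<Rightarrow> bool" where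
  "state T m ks \<longleftrightarrow>
     (\<forall>i j q. 0 < i \<longrightarrow> 0 < j \<longrightarrow> max i j \<le> n - T \<longrightarrow> exch (seed_after n ks) (X i j) q = stage_row n T m i j q) \<and>
     (\<forall>v\<in>vertices n. count_list ks v = mutation_count n T m v) \<and> good ks"

lemma state_init: "state 1 0 []"
proof -
  have "init_exch n (X i j) q = stage_row n 1 0 i j q" if "0 < i" "0 < j" "max i j \<le> n - 1" for i j q
  proof (cases "max i j = 1")
    case True
    with that have "i = 1" "j = 1"
      by auto
    then show ?thesis
      using that init_exch_row[of i j n q] hexagon_row_first[of n 0 q] by (auto simp: stage_row_def)
  next
    case False
    then show ?thesis
      using that init_exch_row[of i j n q] by (auto simp: stage_row_def max_def split: if_splits)
  qed
  moreover have "mutation_count n 1 0 v = 0" if "v \<in> vertices n" for v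
    using that by (auto simp: mutation_count_def vertices_def)
  ultimately show ?thesis
    by (auto simp: state_def good_def seed_after_def init_seed_def F0)
qed

text \<open>Rows completed with index \<open>T\<close> are the hexagons from which stage
  \<open>T + 1\<close> starts; only at the corner does the description change, and there the two
  coincide.\<close>

lemma state_next_stage:
  assumes "state T (n - T) ks" "0 < T" "T \<le> n"
  shows "state (Suc T) 0 ks"
proof -
  have "stage_row n T (n - T) i j q = stage_row n (Suc T) 0 i j q"
    if "0 < i" "0 < j" "max i j \<le> n - Suc T" for i j q
  proof (cases "max i j = 1")
    case True
    with that have "i = 1" "j = 1"
      by auto
    then show ?thesis
      using that hexagon_row_first[of n T q] by (auto simp: stage_row_def)
  next
    case False
    then show ?thesis
      using that by (auto simp: stage_row_def max_def split: if_splits)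
  qed
  moreover have "mutation_count n T (n - T) v = mutation_count n (Suc T) 0 v" if "v \<in> vertices n" for v
    using that assms(2,3) by (auto simp: mutation_count_def vertices_def max_def min_def)
  moreover have "max i j \<le> n - T" if "max i j \<le> n - Suc T" for i j
    using that by linarith
  ultimately show ?thesis
    using assms(1) unfolding state_def by metis
qed

lemma state_block:
  assumes st: "state T m ks" and T: "0 < T" "m < n - T"
    and bs: "distinct bs" "set bs = block n (Suc m)"
  shows "state T (Suc m) (ks @ bs)"
    and "\<And>p. good (ks @ take p bs)"
    and "\<And>p. p < length bs \<Longrightarrow> \<exists>i j. bs ! p = X i j \<and> 0 < i \<and> 0 < j \<and>
      count_list (ks @ take p bs) (X i j) + max i j < n"
    and "exch (seed_after n (ks @ bs)) = mutate_set (block n (Suc m)) (exch (seed_after n ks))"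
proof -
  let ?S = "seed_after n ks" and ?B = "block n (Suc m)"
  obtain t where t: "T = Suc t"
    using T by (cases T) auto
  have row: "exch ?S (X i j) q = stage_row n T m i j q" if "0 < i" "0 < j" "max i j \<le> n - T" for i j q
    using st that by (auto simp: state_def)
  have count: "count_list ks v = mutation_count n T m v" if "v \<in> vertices n" for v
    using st that by (auto simp: state_def)
  have func: "func ?S v x = F v (mutation_count n T m v)" if "v \<in> vertices n" for v
    using st that by (auto simp: state_def good_def count)
  have zero: "exch ?S u w = 0" if u: "u \<in> ?B" and w: "w \<in> ?B" for u w
  proof -
    obtain a c where a: "u = X a c" "0 < a" "0 < c" "max a c = Suc m"
      using u by (rule blockE)
    then show ?thesis
      using row[of a c w] T(2) w out_in_block[of w n a c T] by (simp add: stage_row_def)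
  qed
  have sub: "set (take p bs) \<subseteq> ?B" "distinct (take p bs)" for p
    using bs set_take_subset[of p bs] by auto
  have fm: "exch (seed_after n (ks @ take p bs)) = mutate_set (set (take p bs)) (exch ?S)"
    "func (seed_after n (ks @ take p bs)) = (\<lambda>v. if v \<in> set (take p bs) then mutate_func n (exch ?S) (func ?S) v else func ?S v)"
    for p
    unfolding seed_after_append
    by (rule fold_mutate[OF sub(2)]; use zero sub(1)[of p] in blast)+
  have cnt: "count_list (ks @ take p bs) v = count_list ks v + (if v \<in> set (take p bs) then 1 else 0)" for p v
    using count_list_distinct[OF sub(2)] by simp
  have inB: "mutation_count n T m v = t \<and> v \<in> vertices n \<and> mutate_func n (exch ?S) (func ?S) v x = F v T" if v: "v \<in> ?B" for v
  proof -
    obtain i j where ij: "v = X i j" "0 < i" "0 < j" "i < n" "j < n" "max i j = Suc m"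
      using v by (rule blockE)
    have le: "T + max i j \<le> n" "t + max i j < n"
      using T ij t by auto
    have c: "mutation_count n T m (X i j) = t"
      using ij T t by (auto simp: mutation_count_def)
    have vert: "X i j \<in> vertices n"
      using ij by (auto simp: vertices_def)
    have r: "exch ?S (X i j) q = out_row n T i j q - in_row n T i j q" for q
      using row[of i j q] ij T by (simp add: stage_row_def)
    \<comment> \<open>Neighbours one level up have undergone \<open>t\<close> mutations, those one
      level down already \<open>T = t + 1\<close>; this is the division between \<open>l\<close> and
      \<open>h\<close> in \<open>exchange_rhs\<close>.\<close>
    have up: "func ?S (X a c) x = F (X a c) t" if ac: "max a c = Suc (Suc m) \<or> max a c = Suc m" "0 < a" "0 < c" for a c
    proof -
      have "\<not> max a c \<le> m" "t \<le> n - max a c" "max a c \<le> n"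
        using ac(1) T(2) t by linarith+
      then have "mutation_count n T m (X a c) = t" "X a c \<in> vertices n"
        using ac(2,3) t by (auto simp: mutation_count_def vertices_def simp del: max.bounded_iff)
      then show ?thesis
        using func by metis
    qed
    have down: "func ?S (X a c) x = F (X a c) T" if ac: "max a c = m" "0 < a" "0 < c" for a c
    proof -
      have "mutation_count n T m (X a c) = T" "X a c \<in> vertices n"
        using ac T(2) by (auto simp: mutation_count_def vertices_def)
      then show ?thesis
        using func by metis
    qed
    have "exchange_rhs n i j t (\<lambda>v. func ?S v x) (\<lambda>v. func ?S v x) =
        exchange_rhs n i j t (\<lambda>v. F v t) (\<lambda>v. F v (Suc t))"
    proof -
      have "func ?S (X (i + 1) (j + 1)) x = F (X (i + 1) (j + 1)) t"
        by (rule up) (use ij in auto)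
      moreover have "func ?S (X 0 (j + t)) x = F (X 0 (j + t)) t" "func ?S (Y (n - (i + t))) x = F (Y (n - (i + t))) t"
        using F_frozen[of "j + t" t "n - (i + t)"] func[of "X 0 (j + t)"] func[of "Y (n - (i + t))"] ij(2,3) le
        by (auto simp: vertices_def mutation_count_def)
      moreover have "func ?S (X (i - 1) (j - 1)) x = F (X (i - 1) (j - 1)) (Suc t)" if "\<not> (i = 1 \<or> j = 1)"
        unfolding t[symmetric] by (rule down) (use that ij in \<open>auto simp: max_def split: if_splits\<close>)
      moreover have "func ?S (X (i - 1) j) x = F (X (i - 1) j) (Suc t)" "func ?S (X (i + 1) j) x = F (X (i + 1) j) t"
        if "j < i"
        using that ij t down[of "i - 1" j] up[of "i + 1" j] by (auto simp: max_def split: if_splits)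
      moreover have "func ?S (X i (j - 1)) x = F (X i (j - 1)) (Suc t)" "func ?S (X i (j + 1)) x = F (X i (j + 1)) t"
        if "i < j"
        using that ij t down[of i "j - 1"] up[of i "j + 1"] by (auto simp: max_def split: if_splits)
      moreover have "func ?S (X i (j + 1)) x = F (X i (j + 1)) t" "func ?S (X (i + 1) j) x = F (X (i + 1) j) t"
        if "i = j"
        using that ij up[of i "j + 1"] up[of "i + 1" j] by auto
      ultimately show ?thesis
        unfolding exchange_rhs_def by auto
    qed
    moreover have "func ?S (X i j) x = F (X i j) t"
      using func[OF vert] c by simp
    ultimately have "F v t * mutate_func n (exch ?S) (func ?S) v x = F v t * F v T"
      unfolding ij(1) mutate_func_block[where b="exch ?S", OF r[unfolded t] ij(2,3) le(2)] t
      using F_exchange[OF ij(2,3) le(2)] F_nonzero[OF ij(2,3) le(2)] by simp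
    then show ?thesis
      using F_nonzero[OF ij(2,3) le(2)] c vert ij(1) by simp
  qed
  show good: "good (ks @ take p bs)" for p
    unfolding good_def fm cnt
  proof
    fix v
    assume v: "v \<in> vertices n"
    show "(if v \<in> set (take p bs) then mutate_func n (exch ?S) (func ?S) v else func ?S v) x =
        F v (count_list ks v + (if v \<in> set (take p bs) then 1 else 0))"
    proof (cases "v \<in> set (take p bs)")
      case True
      then have "v \<in> ?B"
        using sub(1) by blast
      then show ?thesis
        using True inB[of v] count[OF v] t by simp
    next
      case False
      then show ?thesis
        using func[OF v] count[OF v] by simp
    qed
  qed
  show exch: "exch (seed_after n (ks @ bs)) = mutate_set ?B (exch ?S)"
    using fm(1)[of "length bs"] bs(2) by simp
  show "\<exists>i j. bs ! p = X i j \<and> 0 < i \<and> 0 < j \<and> count_list (ks @ take p bs) (X i j) + max i j < n"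
    if p: "p < length bs" for p
  proof -
    have "bs ! p \<in> ?B"
      using p bs(2) nth_mem by blast
    then obtain i j where ij: "bs ! p = X i j" "0 < i" "0 < j" "i < n" "j < n" "max i j = Suc m"
      by (rule blockE)
    moreover have "bs ! p \<notin> set (take p bs)"
      using bs(1) p by (auto simp: in_set_conv_nth nth_eq_iff_index_eq)
    moreover have "count_list ks (X i j) = t"
      using inB[OF \<open>bs ! p \<in> ?B\<close>] count ij(1) by auto
    ultimately show ?thesis
      using cnt[of p "X i j"] T t by auto
  qed
  show "state T (Suc m) (ks @ bs)"
    unfolding state_def
  proof (intro conjI allI impI ballI)
    fix i j q
    assume "0 < i" "0 < j" "max i j \<le> n - T"
    then show "exch (seed_after n (ks @ bs)) (X i j) q = stage_row n T (Suc m) i j q"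
      unfolding exch using stage_row_step[of n T "exch ?S" m, OF row T] by blast
  next
    fix v
    assume v: "v \<in> vertices n"
    have B: "v \<in> set bs \<longleftrightarrow> (\<exists>i j. v = X i j \<and> 0 < i \<and> 0 < j \<and> max i j = Suc m)"
    proof -
      have "(1 \<le> i \<and> i \<le> n - 1 \<and> 1 \<le> j \<and> j \<le> n - 1 \<and> max i j = Suc m) =
          (0 < i \<and> 0 < j \<and> max i j = Suc m)" for i j
        using T by (intro iffI; elim conjE; intro conjI; linarith)
      then show ?thesis
        unfolding bs(2) block_def mem_Collect_eq by simp
    qed
    show "count_list (ks @ bs) v = mutation_count n T (Suc m) v"
    proof (cases "v \<in> set bs")
      case True
      then show ?thesis
        using cnt[of "length bs" v] count[OF v] inB[of v] bs(2) t B
        by (auto simp: mutation_count_def)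
    next
      case False
      then have "mutation_count n T m v = mutation_count n T (Suc m) v"
        using v unfolding B by (auto simp: mutation_count_def vertices_def le_Suc_eq)
      then show ?thesis
        using cnt[of "length bs" v] count[OF v] False by simp
    qed
  next
    show "good (ks @ bs)"
      using good[of "length bs"] by simp
  qed
qed

text \<open>If stage \<open>T\<close> is complete, the next block opens stage \<open>T + 1\<close>,
  which is then nonempty; so at most one change of stage has to be made.\<close>

lemma remaining_Cons:
  assumes "state T m ks" "0 < T" "T \<le> n" "m \<le> n - T" "remaining n T m = m' # ms"
  obtains T' k where "state T' k ks" "0 < T'" "T' \<le> n" "k < n - T'" "m' = Suc k" "ms = remaining n T' (Suc k)"
proof (cases "m < n - T")
  case True
  then have "m' = Suc m" "ms = remaining n T (Suc m)"
    using assms(5) by (auto simp: remaining_def upt_conv_Cons simp del: upt_Suc)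
  then show thesis
    using assms True that by blast
next
  case False
  then have m: "m = n - T"
    using assms(4) by simp
  have "n - T \<ge> 2"
  proof (rule ccontr)
    assume "\<not> n - T \<ge> 2"
    then show False
      using assms(5) m by (simp add: remaining_def)
  qed
  then have "rev [1..<n - T] = (n - Suc T) # rev [1..<n - Suc T]"
    using upt_Suc_append[of 1 "n - Suc T"] by (simp add: Suc_diff_Suc)
  then have "remaining n T m = remaining n (Suc T) 0"
    using m by (simp add: remaining_def del: upt_Suc)
  also have "\<dots> = Suc 0 # remaining n (Suc T) (Suc 0)"
    using \<open>n - T \<ge> 2\<close> by (simp add: remaining_def upt_conv_Cons del: upt_Suc)
  finally have "m' = Suc 0" "ms = remaining n (Suc T) (Suc 0)"
    using assms(5) by auto
  moreover have "state (Suc T) 0 ks"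
    using state_next_stage assms(1-3) m by simp
  ultimately show thesis
    using that[of "Suc T" 0] \<open>n - T \<ge> 2\<close> by simp
qed

lemma state_schedule:
  assumes "state T m ks" "0 < T" "T \<le> n" "m \<le> n - T"
    and "list_all2 (\<lambda>m b. distinct b \<and> set b = block n m) (remaining n T m) bs"
  shows "(\<forall>p\<le>length (concat bs). good (ks @ take p (concat bs))) \<and>
    (\<forall>p<length (concat bs). \<exists>i j. concat bs ! p = X i j \<and> 0 < i \<and> 0 < j \<and>
      count_list (ks @ take p (concat bs)) (X i j) + max i j < n) \<and>
    exch (seed_after n (ks @ concat bs)) =
      fold (\<lambda>m. mutate_set (block n m)) (remaining n T m) (exch (seed_after n ks)) \<and>
    (\<forall>i\<in>{1..n}. \<forall>j\<in>{1..n}. count_list (ks @ concat bs) (X i j) = n - max i j)"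
  using assms
proof (induction bs arbitrary: T m ks)
  case Nil
  then have r: "remaining n T m = []"
    by simp
  have m: "m = n - T"
  proof (rule ccontr)
    assume "m \<noteq> n - T"
    then have "Suc m \<in> set (remaining n T m)"
      using Nil.prems(4) by (auto simp: remaining_def)
    then show False
      using r by simp
  qed
  have "n - T < 2"
  proof (rule ccontr)
    assume "\<not> n - T < 2"
    then have "1 \<in> set (remaining n T m)"
      by (auto simp: remaining_def)
    then show False
      using r by simp
  qed
  have "count_list ks (X i j) = n - max i j" if "i \<in> {1..n}" "j \<in> {1..n}" for i j
  proof -
    have "count_list ks (X i j) = mutation_count n T m (X i j)"
      using Nil.prems(1) that by (auto simp: state_def vertices_def)
    then show ?thesis
      using that m \<open>n - T < 2\<close> Nil.prems(2,3) by (auto simp: mutation_count_def max_def min_def)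
  qed
  then show ?case
    using Nil.prems(1) by (simp add: state_def r)
next
  case (Cons b bs)
  then obtain m' ms where ms: "remaining n T m = m' # ms"
    by (auto simp: list_all2_Cons2)
  obtain T' k where T': "state T' k ks" "0 < T'" "T' \<le> n" "k < n - T'" "m' = Suc k" "ms = remaining n T' (Suc k)"
    using remaining_Cons[OF Cons.prems(1-4) ms] .
  have b: "distinct b" "set b = block n (Suc k)"
    and rest: "list_all2 (\<lambda>m b. distinct b \<and> set b = block n m) (remaining n T' (Suc k)) bs"
    using Cons.prems(5) ms T'(5,6) by auto
  note blk = state_block[OF T'(1,2,4) b]
  note IH = Cons.IH[OF blk(1) T'(2,3) _ rest]
  show ?case
  proof (intro conjI allI impI)
    fix p
    show "good (ks @ take p (concat (b # bs)))" if "p \<le> length (concat (b # bs))"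
    proof (cases "p \<le> length b")
      case True
      then show ?thesis
        using blk(2)[of p] by simp
    next
      case False
      then show ?thesis
        using IH that T'(4) by auto
    qed
    show "\<exists>i j. concat (b # bs) ! p = X i j \<and> 0 < i \<and> 0 < j \<and>
        count_list (ks @ take p (concat (b # bs))) (X i j) + max i j < n" if "p < length (concat (b # bs))"
    proof (cases "p < length b")
      case True
      then show ?thesis
        using blk(3)[of p] by (auto simp: nth_append)
    next
      case False
      then have "p - length b < length (concat bs)"
        using that by simp
      then show ?thesis
        using IH T'(4) False by (auto simp: nth_append)
    qed
  next
    show "exch (seed_after n (ks @ concat (b # bs))) =
        fold (\<lambda>m. mutate_set (block n m)) (remaining n T m) (exch (seed_after n ks))"
      using IH T'(4) by (simp add: ms T'(5,6) blk(4))
    show "\<forall>i\<in>{1..n}. \<forall>j\<in>{1..n}. count_list (ks @ concat (b # bs)) (X i j) = n - max i j"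
      using IH T'(4) by simp
  qed
qed

lemma mutation_schedule_functions:
  assumes "n \<ge> 1" "mutation_schedule n ks"
  shows "\<And>p v. p \<le> length ks \<Longrightarrow> v \<in> vertices n \<Longrightarrow>
      func (seed_after n (take p ks)) v x = F v (count_list (take p ks) v)"
    and "\<And>p. p < length ks \<Longrightarrow> \<exists>i j. ks ! p = X i j \<and> 0 < i \<and> 0 < j \<and>
      count_list (take p ks) (X i j) + max i j < n"
    and "exch (seed_after n ks) = fold (\<lambda>m. mutate_set (block n m)) (remaining n 1 0) (init_exch n)"
    and "\<And>i j. i \<in> {1..n} \<Longrightarrow> j \<in> {1..n} \<Longrightarrow> count_list ks (X i j) = n - max i j"
proof -
  have "concat (map (\<lambda>r. [1..<r + 1]) (rev [1..<n])) = remaining n 1 0"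
  proof (cases "n = 1")
    case False
    then have "rev [1..<n] = (n - 1) # rev [1..<n - 1]"
      using assms(1) upt_Suc_append[of 1 "n - 1"] by simp
    then show ?thesis
      by (simp add: remaining_def del: upt_Suc)
  qed (simp add: remaining_def)
  then obtain bs where bs: "ks = concat bs"
    "list_all2 (\<lambda>m b. distinct b \<and> set b = block n m) (remaining n 1 0) bs"
    using assms(2) unfolding mutation_schedule_def by auto
  note main = state_schedule[OF state_init _ assms(1) _ bs(2)]
  show "func (seed_after n (take p ks)) v x = F v (count_list (take p ks) v)"
    if "p \<le> length ks" "v \<in> vertices n" for p v
    using main that by (auto simp: bs(1) good_def)
  show "\<exists>i j. ks ! p = X i j \<and> 0 < i \<and> 0 < j \<and> count_list (take p ks) (X i j) + max i j < n"
    if "p < length ks" for p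
    using main that by (auto simp: bs(1))
  show "exch (seed_after n ks) = fold (\<lambda>m. mutate_set (block n m)) (remaining n 1 0) (init_exch n)"
    using main by (simp add: bs(1) seed_after_def init_seed_def)
  show "count_list ks (X i j) = n - max i j" if "i \<in> {1..n}" "j \<in> {1..n}" for i j
    using main that by (simp add: bs(1))
qed

end

subsection \<open>A triple of flags on which the bracket functions do not vanish\<close>

text \<open>A Gram matrix of the powers of \<open>x\<close> on the nodes
  \<open>1, \<dots>, n\<close> with positive weight; it is symmetric and depends only on
  \<open>i + k\<close>.\<close>

definition moment :: "nat \<Rightarrow> nat \<Rightarrow> nat \<Rightarrow> complex" where
  "moment n i k = (\<Sum>x=1..n. of_nat x ^ (i + k + n))"

definition opposite_basis :: "nat \<Rightarrow> flag_basis" where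
  "opposite_basis n k = (\<lambda>j. (if k \<le> n then 1 else - 1) * Defs.unit_vec (2 * n + 1 - k) j)"

text \<open>The first \<open>n\<close> vectors span the graph of a symmetric map between two
  complementary Lagrangian subspaces, up to the signs of the form; symmetry of the moments makes it
  isotropic.\<close>

definition moment_basis :: "nat \<Rightarrow> flag_basis" where
  "moment_basis n k = (\<lambda>j.
     if k \<le> n then (if j \<le> n then moment n k j else if j = 2 * n + 1 - k then (-1) ^ (k - 1) else 0)
     else if j = 2 * n + 1 - k then (-1) ^ (k - 1) else 0)"

lemma symp_form_scale: "symp_form n (\<lambda>j. a * x j) (\<lambda>j. b * y j) = a * b * symp_form n x y"
  unfolding symp_form_def by (simp add: sum_distrib_left algebra_simps)

lemma symp_basis_opposite: "symp_basis n (opposite_basis n)"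
  unfolding symp_basis_def
proof (intro ballI)
  fix i j
  assume ij: "i \<in> {1..2 * n}" "j \<in> {1..2 * n}"
  have u: "symp_form n (Defs.unit_vec (2 * n + 1 - i)) (Defs.unit_vec (2 * n + 1 - j)) =
      (if i + j = 2 * n + 1 then (-1) ^ (2 * n - i) else 0)"
    using ij by (subst symp_form_unit_vec) auto
  have "symp_form n (opposite_basis n i) (opposite_basis n j) =
      (if i \<le> n then 1 else - 1) * (if j \<le> n then 1 else - 1) *
      (if i + j = 2 * n + 1 then (-1) ^ (2 * n - i) else 0)"
    unfolding opposite_basis_def symp_form_scale u ..
  also have "\<dots> = (if i + j = 2 * n + 1 then - ((-1) ^ (2 * n - i)) else 0)"
    using ij by auto
  also have "(-1::complex) ^ (2 * n - i) = - ((-1) ^ (i - 1))"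
  proof -
    have "(-1::complex) ^ (2 * n - i) = (-1) ^ i"
      by (rule power_neg1_eq) (use ij in auto)
    then show ?thesis
      using ij by (cases i) auto
  qed
  finally show "symp_form n (opposite_basis n i) (opposite_basis n j) =
      symp_form n (Defs.unit_vec i) (Defs.unit_vec j)"
    using ij by (simp add: symp_form_unit_vec)
qed

lemma symp_form_moment_basis_left:
  assumes "i \<in> {1..n}"
  shows "symp_form n (moment_basis n i) z =
    (\<Sum>k=1..n. (-1) ^ (k - 1) * moment n i k * z (2 * n + 1 - k)) - z i"
proof -
  have "symp_form n (moment_basis n i) z =
      (\<Sum>k=1..n. (-1) ^ (k - 1) * moment n i k * z (2 * n + 1 - k) - (if k = i then z i else 0))"
    unfolding symp_form_def
    by (rule sum.cong) (use assms in \<open>auto simp: moment_basis_def right_diff_distrib\<close>)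
  then show ?thesis
    using assms by (simp add: sum_subtractf)
qed

lemma moment_commute: "moment n i k = moment n k i"
  by (simp add: moment_def add.commute)

lemma symp_basis_moment: "symp_basis n (moment_basis n)"
  unfolding symp_basis_def
proof (intro ballI)
  fix i j
  assume ij: "i \<in> {1..2 * n}" "j \<in> {1..2 * n}"
  have small: "symp_form n (moment_basis n i) (moment_basis n j) = (if j \<le> n then moment_basis n i j else 0) - moment_basis n j i"
    if i: "i \<in> {1..n}" and j: "j \<in> {1..2 * n}" for i j
  proof -
    have "(\<Sum>k=1..n. (-1) ^ (k - 1) * moment n i k * moment_basis n j (2 * n + 1 - k)) =
        (\<Sum>k=1..n. if k = j then moment n i k else 0)"
      by (rule sum.cong) (use i j in \<open>auto simp: moment_basis_def\<close>)
    also have "\<dots> = (if j \<le> n then moment_basis n i j else 0)"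
      using i j by (auto simp: moment_basis_def)
    finally show ?thesis
      unfolding symp_form_moment_basis_left[OF i] by simp
  qed
  consider "i \<le> n" "j \<le> n" | "i \<le> n" "j > n" | "i > n" "j \<le> n" | "i > n" "j > n"
    by linarith
  then have "symp_form n (moment_basis n i) (moment_basis n j) = (if i + j = 2 * n + 1 then (-1) ^ (i - 1) else 0)"
  proof cases
    case 1
    then show ?thesis
      using small[of i j] ij moment_commute[of n i j] by (simp add: moment_basis_def)
  next
    case 2
    have "- ((-1::complex) ^ (2 * n - i)) = (-1) ^ (i - 1)"
    proof -
      have "(-1::complex) ^ (2 * n - i) = (-1) ^ i"
        by (rule power_neg1_eq) (use ij in auto)
      then show ?thesis
        using ij by (cases i) auto
    qed
    then show ?thesis
      using small[of i j] ij 2 by (auto simp: moment_basis_def)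
  next
    case 3
    then show ?thesis
      unfolding symp_form_antisym[of n "moment_basis n i"]
      using small[of j i] ij by (auto simp: moment_basis_def)
  next
    case 4
    then show ?thesis
      using ij unfolding symp_form_def by (auto simp: moment_basis_def intro!: sum.neutral)
  qed
  then show "symp_form n (moment_basis n i) (moment_basis n j) = symp_form n (Defs.unit_vec i) (Defs.unit_vec j)"
    using ij by (simp add: symp_form_unit_vec)
qed

text \<open>Solid minors of the matrix of moments are positive definite up to a positive weight.\<close>

lemma moment_kernel:
  assumes zero: "\<And>r. r \<in> {1..p} \<Longrightarrow> (\<Sum>s=1..p. moment n (a + r) (b + s) * y s) = 0"
    and p: "p \<le> n" "b \<le> n" and s: "s \<in> {1..p}"
  shows "y s = 0"
proof -
  \<comment> \<open>The kernel vector is read as a polynomial without constant term. The form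
    \<open>y^* M y\<close> of the minor is the sum over the nodes of a positive weight times
    \<open>|g x|^2\<close>, so \<open>g\<close> vanishes at every node.\<close>
  define g where "g x = (\<Sum>s=1..p. y s * of_nat x ^ s)" for x :: nat
  have "(\<Sum>r=1..p. cnj (y r) * (\<Sum>s=1..p. moment n (a + r) (b + s) * y s)) =
      (\<Sum>r=1..p. \<Sum>s=1..p. \<Sum>x=1..n. of_nat x ^ (a + b + n) * (cnj (y r) * of_nat x ^ r) * (y s * of_nat x ^ s))"
    unfolding moment_def sum_distrib_left sum_distrib_right
    by (intro sum.cong refl) (simp add: power_add algebra_simps)
  also have "\<dots> = (\<Sum>r=1..p. \<Sum>x=1..n. \<Sum>s=1..p. of_nat x ^ (a + b + n) * (cnj (y r) * of_nat x ^ r) * (y s * of_nat x ^ s))"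
    by (rule sum.cong[OF refl], rule sum.swap)
  also have "\<dots> = (\<Sum>x=1..n. \<Sum>r=1..p. \<Sum>s=1..p. of_nat x ^ (a + b + n) * (cnj (y r) * of_nat x ^ r) * (y s * of_nat x ^ s))"
    by (rule sum.swap)
  also have "\<dots> = (\<Sum>x=1..n. of_nat x ^ (a + b + n) * (cnj (g x) * g x))"
  proof (rule sum.cong[OF refl])
    fix x
    have "cnj (g x) * g x = (\<Sum>r=1..p. \<Sum>s=1..p. cnj (y r) * of_nat x ^ r * (y s * of_nat x ^ s))"
      unfolding g_def cnj_sum by (simp add: sum_product)
    then show "(\<Sum>r=1..p. \<Sum>s=1..p. of_nat x ^ (a + b + n) * (cnj (y r) * of_nat x ^ r) * (y s * of_nat x ^ s)) =
        of_nat x ^ (a + b + n) * (cnj (g x) * g x)"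
      by (simp add: sum_distrib_left mult.assoc)
  qed
  also have "\<dots> = of_real (\<Sum>x=1..n. real x ^ (a + b + n) * (cmod (g x))\<^sup>2)"
  proof -
    have "cnj (g x) * g x = of_real ((cmod (g x))\<^sup>2)" for x
      unfolding complex_norm_square by (rule mult.commute)
    then show ?thesis
      by simp
  qed
  finally have "complex_of_real (\<Sum>x=1..n. real x ^ (a + b + n) * (cmod (g x))\<^sup>2) = 0"
    using zero by simp
  then have "(\<Sum>x=1..n. real x ^ (a + b + n) * (cmod (g x))\<^sup>2) = 0"
    using of_real_eq_0_iff by blast
  then have g0: "g x = 0" if "x \<in> {1..n}" for x
    using that by (subst (asm) sum_nonneg_eq_0_iff) auto
  define c where "c i = (if i \<in> {1..p} then y i else 0)" for i
  have poly: "(\<Sum>i\<le>n. c i * z ^ i) = (\<Sum>i=1..p. y i * z ^ i)" for z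
    using p(1) by (intro sum.mono_neutral_cong_right) (auto simp: c_def)
  \<comment> \<open>The point 0 is a root as well, which makes \<open>n + 1\<close> roots against
    degree at most \<open>n\<close>.\<close>
  have "of_nat ` {0..n} \<subseteq> {z. (\<Sum>i\<le>n. c i * z ^ i) = 0}"
  proof
    fix z :: complex
    assume "z \<in> of_nat ` {0..n}"
    then obtain x where x: "z = of_nat x" "x \<le> n"
      by auto
    then show "z \<in> {z. (\<Sum>i\<le>n. c i * z ^ i) = 0}"
      using g0[of x] unfolding poly g_def by (cases "x = 0") (auto intro!: sum.neutral)
  qed
  moreover have "card (of_nat ` {0..n} :: complex set) = Suc n"
    by (subst card_image) (auto simp: inj_on_def)
  ultimately have "\<not> (finite {z. (\<Sum>i\<le>n. c i * z ^ i) = 0} \<and> card {z. (\<Sum>i\<le>n. c i * z ^ i) = 0} \<le> n)"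
    using card_mono[of "{z. (\<Sum>i\<le>n. c i * z ^ i) = 0}" "of_nat ` {0..n}"] by linarith
  then have "c s = 0"
    using polyfun_rootbound[of c s n] s p(1) by auto
  then show ?thesis
    using s by (simp add: c_def)
qed

text \<open>A kernel vector gives a combination \<open>y\<close> of vectors of \<open>W\<close> and
  \<open>U\<close> orthogonal to those of \<open>U\<close> and \<open>V\<close> in the first list.
  Orthogonality to coordinate vectors says that coordinates of \<open>y\<close> vanish; what remains
  is a homogeneous system whose matrix is a solid minor of moments.\<close>

lemma gram_nonzero:
  assumes dims: "a + b + c + d = 4 * n" "b \<le> a" "a \<le> 2 * n" "n \<le> c" "c \<le> 2 * n" "d \<le> n" "n \<le> a" "b + c \<le> 2 * n"
  shows "gram n a b c d (Defs.unit_vec, opposite_basis n, moment_basis n) \<noteq> 0"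
proof
  let ?N = "2 * n" and ?W = "moment_basis n" and ?V = "opposite_basis n"
  define k where "k = b + c"
  define xs where "xs = flag_vectors Defs.unit_vec b @ flag_vectors ?V c"
  define ws where "ws = flag_vectors ?W (?N - d) @ flag_vectors Defs.unit_vec (?N - a)"
  define A where "A = mat k k (\<lambda>(i, j). dot ?N (xs ! i) (map (sharp ?N) ws ! j))"
  have len: "length xs = k" "length ws = k" "k = ?N - d + (?N - a)"
    using dims by (auto simp: xs_def ws_def k_def)
  assume "gram n a b c d (Defs.unit_vec, ?V, ?W) = 0"
  then have "det A = 0"
    using pairing_wedges_eq_det[of xs k "map (sharp ?N) ws" ?N] len
    by (simp add: gram_def xs_def ws_def A_def dual_vectors_def)
  then obtain v where v: "v \<in> carrier_vec k" "v \<noteq> 0\<^sub>v k" "A *\<^sub>v v = 0\<^sub>v k"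
    using det_0_iff_vec_prod_zero[of A k] by (auto simp: A_def)
  define \<alpha> where "\<alpha> l = v $ (l - 1)" for l
  define \<beta> where "\<beta> l = v $ (?N - d + (l - 1))" for l
  define z where "z j = (\<Sum>l=1..?N - d. \<alpha> l * ?W l j)" for j
  define y where "y j = z j + (\<Sum>l=1..?N - a. \<beta> l * Defs.unit_vec l j)" for j
  have form_sum: "symp_form n x (\<lambda>j. \<Sum>l\<in>I. h l * w l j) = (\<Sum>l\<in>I. h l * symp_form n x (w l))"
    for x and I :: "nat set" and h w
    unfolding symp_form_eq_dot dot_def sharp_def
    by (simp only: sum_distrib_left, subst sum.swap) (simp add: algebra_simps)
  have form_add: "symp_form n x (\<lambda>j. f j + g j) = symp_form n x f + symp_form n x g" for x f g
    by (simp add: symp_form_def algebra_simps sum.distrib sum_subtractf)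
  have shift: "(\<Sum>l=1..m. f (l - 1)) = (\<Sum>l<m. f l)" for m and f :: "nat \<Rightarrow> complex"
    by (rule sum.reindex_bij_witness[of _ Suc "\<lambda>l. l - 1"]) auto
  have ortho: "symp_form n x y = 0" if x: "x \<in> set xs" for x
  proof -
    obtain i where i: "i < k" "xs ! i = x"
      using x len(1) by (auto simp: in_set_conv_nth)
    have "(\<Sum>j<k. dot ?N (xs ! i) (map (sharp ?N) ws ! j) * v $ j) = (A *\<^sub>v v) $ i"
      using i v(1) by (simp add: A_def scalar_prod_def atLeast0LessThan)
    then have "0 = (\<Sum>j<k. symp_form n x (ws ! j) * v $ j)"
      using i v(3) len by (simp add: symp_form_eq_dot)
    also have "\<dots> = (\<Sum>j<?N - d. symp_form n x (ws ! j) * v $ j) +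
        (\<Sum>j<?N - a. symp_form n x (ws ! (?N - d + j)) * v $ (?N - d + j))"
      unfolding len(3) lessThan_atLeast0
      by (subst sum.atLeastLessThan_concat[symmetric, of 0 "?N - d"])
         (auto simp: sum.shift_bounds_nat_ivl[of _ 0, simplified] add.commute)
    also have "(\<Sum>j<?N - d. symp_form n x (ws ! j) * v $ j) = (\<Sum>l=1..?N - d. \<alpha> l * symp_form n x (?W l))"
      unfolding \<alpha>_def
      by (rule sum.reindex_bij_witness[of _ "\<lambda>l. l - 1" Suc]) (auto simp: ws_def nth_append)
    also have "(\<Sum>j<?N - a. symp_form n x (ws ! (?N - d + j)) * v $ (?N - d + j)) =
        (\<Sum>l=1..?N - a. \<beta> l * symp_form n x (Defs.unit_vec l))"
      unfolding \<beta>_def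
      by (rule sum.reindex_bij_witness[of _ "\<lambda>l. l - 1" Suc]) (auto simp: ws_def nth_append)
    finally show ?thesis
      unfolding y_def z_def form_add form_sum by simp
  qed
  have form_unit: "symp_form n (Defs.unit_vec i) y = (-1) ^ (i - 1) * y (?N + 1 - i)" if "i \<in> {1..?N}" for i
    using that by (simp add: symp_form_eq_dot dot_unit_vec sharp_def)
  have y_high: "y (?N + 1 - i) = 0" if "i \<in> {1..b}" for i
  proof -
    have "Defs.unit_vec i \<in> set xs"
      using that by (auto simp: xs_def set_flag_vectors)
    then show ?thesis
      using ortho form_unit[of i] that dims by auto
  qed
  have y_low: "y i = 0" if i: "i \<in> {1..c}" for i
  proof -
    have "?V i \<in> set xs"
      using i by (auto simp: xs_def set_flag_vectors)
    then have "symp_form n (\<lambda>j. (if i \<le> n then 1 else - 1) * Defs.unit_vec (?N + 1 - i) j) (\<lambda>j. 1 * y j) = 0"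
      using ortho by (simp add: opposite_basis_def)
    moreover have "?N + 1 - i \<in> {1..?N}" "?N + 1 - (?N + 1 - i) = i"
      using i dims by auto
    ultimately show ?thesis
      unfolding symp_form_scale using form_unit[of "?N + 1 - i"] by (simp split: if_splits)
  qed
  have zy: "z j = y j" if "?N - a < j" for j
    unfolding y_def using that by (auto simp: Defs.unit_vec_def intro!: sum.neutral)
  \<comment> \<open>Products with \<open>?W i\<close> read off the coefficient of the partner
    \<open>2n + 1 - i\<close>. For \<open>i \<le> d\<close> the partner lies beyond
    \<open>2n - d\<close>, so the product is 0.\<close>
  have W0: "symp_form n (?W i) z = (if i + l = ?N + 1 then \<alpha> l * (-1) ^ (i - 1) else 0)"
    if i: "i \<in> {1..?N}" and l: "i + l = ?N + 1 \<and> l \<le> ?N - d \<or> i \<le> d \<and> i + l \<noteq> ?N + 1" for i l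
  proof -
    have "symp_form n (?W i) z = (\<Sum>m=1..?N - d. if i + m = ?N + 1 then \<alpha> m * (-1) ^ (i - 1) else 0)"
      unfolding z_def form_sum
      by (rule sum.cong[OF refl])
         (use i symp_basis_dot[OF symp_basis_moment, of i n] in \<open>auto simp: symp_form_eq_dot\<close>)
    also have "\<dots> = (\<Sum>m=1..?N - d. if m = ?N + 1 - i then \<alpha> (?N + 1 - i) * (-1) ^ (i - 1) else 0)"
      using i by (intro sum.cong) auto
    finally have "symp_form n (?W i) z =
        (if ?N + 1 - i \<in> {1..?N - d} then \<alpha> (?N + 1 - i) * (-1) ^ (i - 1) else 0)"
      by simp
    moreover have "?N + 1 - i = l" if "i + l = ?N + 1"
      using that by simp
    ultimately show ?thesis
      using i l dims by (cases "i + l = ?N + 1") auto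
  qed
  have z_eq: "z i = (\<Sum>l=1..n. (-1) ^ (l - 1) * moment n i l * z (?N + 1 - l))" if "i \<in> {1..d}" for i
    using W0[of i 0] symp_form_moment_basis_left[of i n z] that dims by auto
  define u where "u l = (-1) ^ (l - 1) * z (?N + 1 - l)" for l
  have u_out: "u l = 0" if "l \<in> {1..n}" "l \<notin> {b + 1..?N - c}" for l
  proof -
    have "z (?N + 1 - l) = y (?N + 1 - l)"
      using that dims by (intro zy) auto
    moreover have "y (?N + 1 - l) = 0"
    proof (cases "l \<le> b")
      case False
      then have "?N + 1 - l \<in> {1..c}"
        using that dims by auto
      then show ?thesis
        by (rule y_low)
    qed (use that y_high[of l] in auto)
    ultimately show ?thesis
      by (simp add: u_def)
  qed
  have z_eq': "z i = (\<Sum>s=1..?N - c - b. moment n i (b + s) * u (b + s))" if "i \<in> {1..d}" for i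
  proof -
    have "z i = (\<Sum>l=1..n. moment n i l * u l)"
      unfolding z_eq[OF that] u_def by (simp add: algebra_simps)
    also have "\<dots> = (\<Sum>l\<in>{b + 1..?N - c}. moment n i l * u l)"
      using u_out dims by (intro sum.mono_neutral_right) auto
    also have "\<dots> = (\<Sum>s=1..?N - c - b. moment n i (b + s) * u (b + s))"
      by (rule sum.reindex_bij_witness[of _ "\<lambda>s. b + s" "\<lambda>l. l - b"]) auto
    finally show ?thesis .
  qed
  \<comment> \<open>The equations with \<open>2n - a < i \<le> d\<close> have left side 0. Their
    number \<open>a + d - 2n\<close> equals the number \<open>2n - b - c\<close> of unknowns, so the
    minor is square.\<close>
  have "u (b + s) = 0" if "s \<in> {1..?N - c - b}" for s
  proof (rule moment_kernel[where p="?N - c - b" and a="?N - a" and b=b and n=n and y="\<lambda>s. u (b + s)"])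
    fix r
    assume r: "r \<in> {1..?N - c - b}"
    have "z (?N - a + r) = y (?N - a + r)"
      using r by (intro zy) auto
    also have "\<dots> = 0"
      using r dims by (intro y_low) auto
    finally have "z (?N - a + r) = 0" .
    moreover have "?N - a + r \<in> {1..d}"
      using r dims by auto
    ultimately show "(\<Sum>s=1..?N - c - b. moment n (?N - a + r) (b + s) * u (b + s)) = 0"
      using z_eq' by simp
  qed (use that dims in auto)
  note u_in = this
  have u0: "u l = 0" if "l \<in> {1..n}" for l
  proof (cases "l \<in> {b + 1..?N - c}")
    case True
    then have "l - b \<in> {1..?N - c - b}" "b + (l - b) = l"
      by auto
    then show ?thesis
      using u_in by metis
  qed (rule u_out[OF that])
  have z0: "z j = 0" if j: "j \<in> {1..?N}" for j
  proof (cases "j \<le> n")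
    case False
    then have "?N + 1 - j \<in> {1..n}" "?N + 1 - (?N + 1 - j) = j"
      using j by auto
    then show ?thesis
      using u0[of "?N + 1 - j"] by (simp add: u_def)
  next
    case True
    show ?thesis
    proof (cases "j \<le> d")
      case True
      then show ?thesis
        using z_eq[of j] j u0 unfolding u_def by (auto intro!: sum.neutral)
    next
      case False
      have "z j = y j"
        using False dims by (intro zy) auto
      then show ?thesis
        using y_low[of j] j True dims by auto
    qed
  qed
  have \<alpha>0: "\<alpha> l = 0" if "l \<in> {1..?N - d}" for l
  proof -
    have "symp_form n (?W (?N + 1 - l)) z = 0"
      unfolding symp_form_def
    proof (intro sum.neutral ballI)
      fix k
      assume "k \<in> {1..n}"
      then have "k \<in> {1..?N}" "?N + 1 - k \<in> {1..?N}"
        by auto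
      then show "(-1) ^ (k - 1) * (?W (?N + 1 - l) k * z (?N + 1 - k) - ?W (?N + 1 - l) (?N + 1 - k) * z k) = 0"
        using z0 by simp
    qed
    moreover have "?N + 1 - l \<in> {1..?N}" "?N + 1 - l + l = ?N + 1" "l \<le> ?N - d"
      using that by auto
    ultimately show ?thesis
      using W0[of "?N + 1 - l" l] by simp
  qed
  have \<beta>0: "\<beta> l = 0" if l: "l \<in> {1..?N - a}" for l
  proof -
    have "(\<Sum>m=1..?N - a. \<beta> m * Defs.unit_vec m l) = (\<Sum>m=1..?N - a. if m = l then \<beta> l else 0)"
      by (rule sum.cong) (auto simp: Defs.unit_vec_def)
    moreover have "l \<in> {1..?N}" "l \<in> {1..c}"
      using l dims by auto
    ultimately show ?thesis
      using z0[of l] y_low[of l] l unfolding y_def by simp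
  qed
  have "v $ j = 0" if "j < k" for j
  proof (cases "j < ?N - d")
    case True
    then show ?thesis
      using \<alpha>0[of "Suc j"] by (simp add: \<alpha>_def)
  next
    case False
    then have "Suc (j - (?N - d)) \<in> {1..?N - a}" "?N - d + (j - (?N - d)) = j"
      using that len(3) by auto
    then show ?thesis
      using \<beta>0[of "Suc (j - (?N - d))"] by (simp add: \<beta>_def)
  qed
  then have "v = 0\<^sub>v k"
    using v(1) by (intro eq_vecI) auto
  with v(2) show False
    by simp
qed

subsection \<open>Polynomial functions\<close>

lemma poly_funs_sum: "(\<And>i. i \<in> I \<Longrightarrow> f i \<in> poly_funs n) \<Longrightarrow> (\<lambda>x. \<Sum>i\<in>I. f i x) \<in> poly_funs n"
proof (induction I rule: infinite_finite_induct)
  case (insert i I)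
  then show ?case
    using poly_funs.add[of "f i" n "\<lambda>x. \<Sum>i\<in>I. f i x"] by simp
qed (simp_all add: poly_funs.const)

lemma poly_funs_prod: "(\<And>i. i \<in> I \<Longrightarrow> f i \<in> poly_funs n) \<Longrightarrow> (\<lambda>x. \<Prod>i\<in>I. f i x) \<in> poly_funs n"
proof (induction I rule: infinite_finite_induct)
  case (insert i I)
  then show ?case
    using poly_funs.mult[of "f i" n "\<lambda>x. \<Prod>i\<in>I. f i x"] by simp
qed (simp_all add: poly_funs.const)

lemma poly_funs_wedge:
  assumes "\<And>T. (\<lambda>x. \<alpha> x T) \<in> poly_funs n" "\<And>T. (\<lambda>x. \<beta> x T) \<in> poly_funs n"
  shows "(\<lambda>x. (\<alpha> x \<^bold>\<and> \<beta> x) S) \<in> poly_funs n"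
  unfolding wedge_def by (intro poly_funs_sum poly_funs.mult poly_funs.const assms)

lemma poly_funs_flag_form:
  assumes "\<And>i k. i \<in> {1..2 * n} \<Longrightarrow> k \<in> {1..2 * n} \<Longrightarrow> (\<lambda>x. B x i k) \<in> poly_funs n" "a \<le> 2 * n"
  shows "(\<lambda>x. flag_form (2 * n) (B x) a S) \<in> poly_funs n"
  using assms(2)
proof (induction a arbitrary: S)
  case 0
  then show ?case
    by (simp add: poly_funs.const)
next
  case (Suc a)
  have "(\<lambda>x. ext_vec (2 * n) (B x (Suc a)) T) \<in> poly_funs n" for T
    unfolding ext_vec_def by (intro poly_funs_sum poly_funs.mult poly_funs.const assms(1)) (use Suc.prems in auto)
  with Suc show ?case
    unfolding flag_form.simps by (intro poly_funs_wedge) auto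
qed

lemma poly_funs_flag_forms:
  assumes "a \<le> 2 * n"
  shows "(\<lambda>x. flag_form (2 * n) (fst x) a S) \<in> poly_funs n"
    "(\<lambda>x. flag_form (2 * n) (fst (snd x)) a S) \<in> poly_funs n"
    "(\<lambda>x. flag_form (2 * n) (snd (snd x)) a S) \<in> poly_funs n"
  using assms poly_funs.coord1 poly_funs.coord2 poly_funs.coord3
  by (auto intro!: poly_funs_flag_form simp: case_prod_unfold)

lemma poly_funs_tensor_apply:
  assumes "\<And>T. (\<lambda>x. f x (ext_basis T)) \<in> poly_funs n" "\<And>T. (\<lambda>x. g x (ext_basis T)) \<in> poly_funs n"
    "\<And>S. (\<lambda>x. \<omega> x S) \<in> poly_funs n"
  shows "(\<lambda>x. tensor_apply M (f x) (g x) (comult p q (\<omega> x))) \<in> poly_funs n"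
proof -
  have "(\<lambda>x. comult p q (\<omega> x) T R) \<in> poly_funs n" for T R
  proof (cases "T \<inter> R = {} \<and> card T = p \<and> card R = q")
    case True
    show ?thesis
      unfolding comult_def if_P[OF True] by (intro poly_funs.mult poly_funs.const assms(3))
  next
    case False
    show ?thesis
      unfolding comult_def if_not_P[OF False] by (rule poly_funs.const)
  qed
  then show ?thesis
    unfolding tensor_apply_def by (intro poly_funs_sum poly_funs.mult assms(1,2))
qed

text \<open>The open sets in \<open>generically\<close> are given by polynomials; the brackets
  themselves have to supply them.\<close>

lemma bracket3_poly:
  assumes "a \<le> 2 * n" "b \<le> 2 * n" "c \<le> 2 * n"
  shows "bracket3 n a b c \<in> poly_funs n"
proof -
  let ?U = "\<lambda>x :: triple. flag_form (2 * n) (fst x)" and ?V = "\<lambda>x :: triple. flag_form (2 * n) (fst (snd x))"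
    and ?W = "\<lambda>x :: triple. flag_form (2 * n) (snd (snd x))"
  have "bracket3 n a b c = (\<lambda>x.
     if a + b + c = 2 * n then vol (2 * n) (?U x a \<^bold>\<and> ?V x b \<^bold>\<and> ?W x c)
     else if a + b + c = 2 * (2 * n) then
       (-1) ^ a * tensor_apply (2 * n) (\<lambda>\<alpha>. vol (2 * n) (?V x b \<^bold>\<and> \<alpha>)) (\<lambda>\<beta>. vol (2 * n) (?W x c \<^bold>\<and> \<beta>))
         (comult (2 * n - b) (2 * n - c) (?U x a))
     else 0)"
    by (rule ext) (simp add: bracket3_def Let_def case_prod_unfold)
  moreover have "(\<lambda>x. vol (2 * n) (?U x a \<^bold>\<and> ?V x b \<^bold>\<and> ?W x c)) \<in> poly_funs n"
    unfolding vol_def by (intro poly_funs_wedge poly_funs_flag_forms assms)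
  moreover have "(\<lambda>x. (-1) ^ a * tensor_apply (2 * n) (\<lambda>\<alpha>. vol (2 * n) (?V x b \<^bold>\<and> \<alpha>))
      (\<lambda>\<beta>. vol (2 * n) (?W x c \<^bold>\<and> \<beta>)) (comult (2 * n - b) (2 * n - c) (?U x a))) \<in> poly_funs n"
    unfolding vol_def
    by (intro poly_funs.mult poly_funs_tensor_apply poly_funs.const poly_funs_wedge poly_funs_flag_forms assms)
  ultimately show ?thesis
    by (cases "a + b + c = 2 * n"; cases "a + b + c = 2 * (2 * n)")
       (simp_all only: if_True if_False simp_thms poly_funs.const)
qed

lemma bracket4_poly:
  assumes "a \<le> 2 * n" "b \<le> 2 * n" "c \<le> 2 * n" "d \<le> 2 * n"
  shows "bracket4 n a b c d \<in> poly_funs n"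
proof -
  let ?U = "\<lambda>x :: triple. flag_form (2 * n) (fst x)" and ?V = "\<lambda>x :: triple. flag_form (2 * n) (fst (snd x))"
    and ?W = "\<lambda>x :: triple. flag_form (2 * n) (snd (snd x))"
  have m: "max a b \<le> 2 * n" "min a b \<le> 2 * n"
    using assms by auto
  have "bracket4 n a b c d = (\<lambda>x.
     if max a b = 2 * n then bracket3 n (min a b) c d x
     else if min a b = 0 then bracket3 n (max a b) c d x
     else tensor_apply (2 * n) (\<lambda>\<alpha>. vol (2 * n) (?U x (min a b) \<^bold>\<and> \<alpha> \<^bold>\<and> ?W x d))
       (\<lambda>\<beta>. vol (2 * n) (?U x (max a b) \<^bold>\<and> \<beta>)) (comult (max a b + c - 2 * n) (2 * n - max a b) (?V x c)))"
    by (rule ext, rename_tac x, case_tac x) (simp only: bracket4_def Let_def prod.case fst_conv snd_conv)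
  moreover have "(\<lambda>x. tensor_apply (2 * n) (\<lambda>\<alpha>. vol (2 * n) (?U x (min a b) \<^bold>\<and> \<alpha> \<^bold>\<and> ?W x d))
       (\<lambda>\<beta>. vol (2 * n) (?U x (max a b) \<^bold>\<and> \<beta>)) (comult (max a b + c - 2 * n) (2 * n - max a b) (?V x c))) \<in> poly_funs n"
    unfolding vol_def
    by (intro poly_funs_tensor_apply poly_funs.const poly_funs_wedge poly_funs_flag_forms assms m)
  moreover have "(\<lambda>x. bracket3 n (min a b) c d x) \<in> poly_funs n" "(\<lambda>x. bracket3 n (max a b) c d x) \<in> poly_funs n"
    using bracket3_poly m assms by simp_all
  ultimately show ?thesis
    by (cases "max a b = 2 * n"; cases "min a b = 0") (simp_all only: if_True if_False simp_thms)
qed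

subsection \<open>The theorem\<close>

lemma bracket4_commute: "bracket4 n a b c d = bracket4 n b a c d"
  unfolding bracket4_def by (simp add: max.commute[of a b] min.commute[of a b])

section \<open>The claimed functions and their exchange relations\<close>

definition seed_function :: "nat \<Rightarrow> vertex \<Rightarrow> nat \<Rightarrow> triple \<Rightarrow> complex" where
  "seed_function n v t = (case v of
      X i j \<Rightarrow> if i = 0 then init_func n v
        else if j \<le> i then bracket4 n (2 * n - t) (n - i - t) (n + i - j + t) (j + t)
        else bracket4 n (n - i - t) (2 * n + i - j - t) (n + t) (j + t)
    | Y k \<Rightarrow> init_func n v)"

text \<open>One formula for both sides of the diagonal: of the truncated differences
  \<open>i - j\<close> and \<open>j - i\<close> at least one is 0. The exchange relations can so be
  matched with a single octahedron.\<close>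

lemma seed_function_eq:
  assumes "0 < i" "t + max i j \<le> n"
  shows "seed_function n (X i j) t = bracket4 n (2 * n - t - (j - i)) (n - i - t) (n + (i - j) + t) (j + t)"
proof (cases "j \<le> i")
  case False
  then have "seed_function n (X i j) t = bracket4 n (n - i - t) (2 * n + i - j - t) (n + t) (j + t)"
    using assms(1) by (simp add: seed_function_def)
  also have "\<dots> = bracket4 n (2 * n + i - j - t) (n - i - t) (n + t) (j + t)"
    by (rule bracket4_commute)
  also have "2 * n + i - j - t = 2 * n - t - (j - i)"
    using False assms by auto
  also have "n + t = n + (i - j) + t"
    using False by simp
  finally show ?thesis .
qed (use assms in \<open>simp add: seed_function_def\<close>)

lemma seed_function_0:
  assumes "v \<in> vertices n"
  shows "seed_function n v 0 x = init_func n v x"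
proof -
  obtain U V W where "x = (U, V, W)"
    using prod_cases3 by blast
  then show ?thesis
    using assms by (auto simp: seed_function_def bracket4_def Let_def vertices_def split: vertex.split)
qed

lemma seed_function_frozen:
  "seed_function n (X 0 c) t x = seed_function n (X 0 c) 0 x \<and> seed_function n (Y k) t x = seed_function n (Y k) 0 x"
  by (simp add: seed_function_def)

lemma seed_function_exchange:
  assumes x: "x \<in> symp_triples n" and ij: "0 < i" "0 < j" "t + max i j < n"
  defines "F \<equiv> \<lambda>v t. seed_function n v t x"
  shows "F (X i j) t * F (X i j) (Suc t) = exchange_rhs n i j t (\<lambda>v. F v t) (\<lambda>v. F v (Suc t))"
proof -
  obtain U V W where UVW: "x = (U, V, W)" "symp_basis n U" "symp_basis n V" "symp_basis n W"
    using x by (auto simp: symp_triples_def)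
  \<comment> \<open>The indices \<open>a\<close>, \<open>b\<close> are those after the mutation and
    \<open>c\<close>, \<open>d\<close> those before it, so that every index of the octahedron is one
    of these or its successor.\<close>
  define a where "a = 2 * n - Suc t - (j - i)"
  define b where "b = n - i - Suc t"
  define c where "c = n + (i - j) + t"
  define d where "d = j + t"
  let ?B = "\<lambda>a b c d. bracket4 n a b c d x"
  have n: "n \<ge> 1" "t + i < n" "t + j < n"
    using ij by auto
  have octahedron: "?B (Suc a) (Suc b) c d * ?B a b (Suc c) (Suc d) =
    ?B a (Suc b) (Suc c) d * ?B (Suc a) b c (Suc d) + ?B a (Suc b) c (Suc d) * ?B (Suc a) b (Suc c) d"
    unfolding UVW(1)
    by (rule bracket4_octahedron[OF UVW(2-4)]) (use n ij in \<open>auto simp: a_def b_def c_def d_def\<close>)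
  have F: "F (X p q) s = ?B A B C D"
    if "0 < p" "s + max p q \<le> n" "2 * n - s - (q - p) = A" "n - p - s = B" "n + (p - q) + s = C" "q + s = D"
    for p q s A B C D
    unfolding F_def seed_function_eq[OF that(1,2)] that(3-6) ..
  have 1: "F (X i j) t = ?B (Suc a) (Suc b) c d"
    by (rule F) (use n ij in \<open>auto simp: a_def b_def c_def d_def\<close>)
  have 2: "F (X i j) (Suc t) = ?B a b (Suc c) (Suc d)"
    by (rule F) (use n ij in \<open>auto simp: a_def b_def c_def d_def\<close>)
  have 3: "F (X (i + 1) (j + 1)) t = ?B (Suc a) b c (Suc d)"
    by (rule F) (use n ij in \<open>auto simp: a_def b_def c_def d_def\<close>)
  \<comment> \<open>For \<open>i = 1\<close> or \<open>j = 1\<close> the neighbour would lie on the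
    border; there the index pairs add up to \<open>2n\<close> and the bracket splits into two frozen
    functions.\<close>
  have 4: "(if i = 1 \<or> j = 1 then F (X 0 (j + t)) t * F (Y (n - (i + t))) t else F (X (i - 1) (j - 1)) (Suc t)) =
    ?B a (Suc b) (Suc c) d"
  proof (cases "i = 1 \<or> j = 1")
    case True
    then have sums: "Suc b + Suc c = 2 * n" "a + d = 2 * n"
      using n ij by (auto simp: a_def b_def c_def d_def)
    have eq: "a = 2 * n - (j + t)" "Suc b = n - (i + t)" "Suc c = 2 * n - (n - (i + t))"
      using sums n by (auto simp: d_def b_def)
    have "?B a (Suc b) (Suc c) d = bracket3 n a 0 d x * vol (2 * n) (flag_form (2 * n) U (Suc b) \<^bold>\<and> flag_form (2 * n) V (Suc c))"
      unfolding UVW(1) by (rule bracket4_factor[OF UVW(2-4)]) (use n sums in \<open>auto simp: a_def b_def\<close>)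
    also have "\<dots> = F (X 0 (j + t)) t * F (Y (n - (i + t))) t"
      unfolding eq F_def UVW(1) by (simp add: seed_function_def d_def)
    finally show ?thesis
      using True by simp
  next
    case False
    then have "F (X (i - 1) (j - 1)) (Suc t) = ?B a (Suc b) (Suc c) d"
      by (intro F) (use n ij in \<open>auto simp: a_def b_def c_def d_def\<close>)
    with False show ?thesis
      by simp
  qed
  have 5: "(if j < i then F (X (i - 1) j) (Suc t) * F (X (i + 1) j) t
       else if i < j then F (X i (j - 1)) (Suc t) * F (X i (j + 1)) t
       else F (X i (j + 1)) t * F (X (i + 1) j) t) = ?B a (Suc b) c (Suc d) * ?B (Suc a) b (Suc c) d"
  proof -
    consider "j < i" | "i < j" | "i = j"
      by linarith
    then show ?thesis
    proof cases
      case 1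
      then have "F (X (i - 1) j) (Suc t) = ?B a (Suc b) c (Suc d)" "F (X (i + 1) j) t = ?B (Suc a) b (Suc c) d"
        by (intro F; use 1 n ij in \<open>auto simp: a_def b_def c_def d_def\<close>)+
      with 1 show ?thesis
        by simp
    next
      case 2
      then have "F (X i (j - 1)) (Suc t) = ?B (Suc a) b (Suc c) d" "F (X i (j + 1)) t = ?B a (Suc b) c (Suc d)"
        by (intro F; use 2 n ij in \<open>auto simp: a_def b_def c_def d_def\<close>)+
      with 2 show ?thesis
        by simp
    next
      case 3
      then have "F (X i (j + 1)) t = ?B a (Suc b) c (Suc d)" "F (X (i + 1) j) t = ?B (Suc a) b (Suc c) d"
        by (intro F; use 3 n ij in \<open>auto simp: a_def b_def c_def d_def\<close>)+
      with 3 show ?thesis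
        by simp
    qed
  qed
  show ?thesis
    unfolding exchange_rhs_def 1 2 3 4 5 by (rule octahedron)
qed

text \<open>The product of all functions that are ever divided by is one polynomial, so the same
  open set serves every step of every schedule.\<close>

lemma seed_functions_generically_nonzero:
  assumes "n \<ge> 1"
  obtains f where "f \<in> poly_funs n" "\<exists>x\<in>symp_triples n. f x \<noteq> 0"
    "\<And>x i j t. f x \<noteq> 0 \<Longrightarrow> 0 < i \<Longrightarrow> 0 < j \<Longrightarrow> t + max i j < n \<Longrightarrow> seed_function n (X i j) t x \<noteq> 0"
proof -
  define I where "I = {(i, j, t). 0 < i \<and> 0 < j \<and> t + max i j < n}"
  define f where "f x = (\<Prod>p\<in>I. seed_function n (X (fst p) (fst (snd p))) (snd (snd p)) x)" for x
  have fin: "finite I"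
    by (rule finite_subset[of _ "{..n} \<times> {..n} \<times> {..n}"]) (auto simp: I_def)
  have "seed_function n (X i j) t \<in> poly_funs n" if "(i, j, t) \<in> I" for i j t
    using that by (auto simp: I_def seed_function_eq intro!: bracket4_poly)
  then have "f \<in> poly_funs n"
    unfolding f_def by (intro poly_funs_prod) auto
  moreover have "\<exists>x\<in>symp_triples n. f x \<noteq> 0"
  proof
    let ?x = "(Defs.unit_vec, opposite_basis n, moment_basis n)"
    show "?x \<in> symp_triples n"
      by (simp add: symp_triples_def symp_basis_unit_vec symp_basis_opposite symp_basis_moment)
    have "seed_function n (X i j) t ?x \<noteq> 0" if "(i, j, t) \<in> I" for i j t
    proof -
      have ij: "0 < i" "0 < j" "t + i < n" "t + j < n" "t + max i j \<le> n"
        using that by (auto simp: I_def)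
      have "seed_function n (X i j) t ?x = (-1) ^ (2 * n - t - (j - i)) *
          gram n (2 * n - t - (j - i)) (n - i - t) (n + (i - j) + t) (j + t) ?x"
        unfolding seed_function_eq[OF ij(1,5)]
        by (rule bracket4_eq_gram[OF symp_basis_unit_vec symp_basis_opposite symp_basis_moment])
           (use ij assms in auto)
      moreover have "gram n (2 * n - t - (j - i)) (n - i - t) (n + (i - j) + t) (j + t) ?x \<noteq> 0"
        by (rule gram_nonzero) (use ij in auto)
      ultimately show ?thesis
        by simp
    qed
    then show "f ?x \<noteq> 0"
      unfolding f_def using fin by auto
  qed
  moreover have "seed_function n (X i j) t x \<noteq> 0"
    if "f x \<noteq> 0" "0 < i" "0 < j" "t + max i j < n" for x i j t
  proof -
    have "(i, j, t) \<in> I"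
      using that(2-4) by (simp add: I_def)
    moreover have "\<forall>p\<in>I. seed_function n (X (fst p) (fst (snd p))) (snd (snd p)) x \<noteq> 0"
      using that(1) fin unfolding f_def by simp
    ultimately show ?thesis
      by fastforce
  qed
  ultimately show thesis
    by (rule that)
qed

theorem theorem3p7:
  fixes n :: nat and ks :: "vertex list"
  assumes "n \<ge> 1"
    and "mutation_schedule n ks"
  shows
    (* Clauses: every step is a legitimate mutation (unfrozen vertex, nonzero function);
       independence of the order within blocks; number of mutations; part (1); part (2). *)
    "(\<forall>p<length ks. ks ! p \<in> vertices n - frozen n \<and>
        generically n (\<lambda>x. func (seed_after n (take p ks)) (ks ! p) x \<noteq> 0)) \<and>

     (\<forall>ks'. mutation_schedule n ks' \<longrightarrow>
        exch (seed_after n ks') = exch (seed_after n ks) \<and>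
        (\<forall>v\<in>vertices n. rat_eq n (func (seed_after n ks') v) (func (seed_after n ks) v))) \<and>

     (\<forall>i\<in>{1..n}. \<forall>j\<in>{1..n}. count_list ks (X i j) = n - max i j) \<and>

     (\<forall>i\<in>{1..n}. \<forall>j\<in>{1..n}. j \<le> i \<longrightarrow>
        (\<forall>t\<le>n - i. \<forall>p\<le>length ks. count_list (take p ks) (X i j) = t \<longrightarrow>
           rat_eq n (func (seed_after n (take p ks)) (X i j))
             (bracket4 n (2 * n - t) (n - i - t) (n + i - j + t) (j + t))) \<and>
        rat_eq n (func (init_seed n) (X i j)) (bracket3 n (n - i) (n + i - j) j) \<and>
        rat_eq n (func (seed_after n ks) (X i j)) (bracket3 n (n + i) (2 * n - j) (n - i + j)) \<and>
        (\<forall>x\<in>symp_triples n.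
           bracket3 n (n + i) (2 * n - j) (n - i + j) x = bracket3 n (n - i) j (n + i - j) x)) \<and>

     (\<forall>i\<in>{1..n}. \<forall>j\<in>{1..n}. i < j \<longrightarrow>
        (\<forall>t\<le>n - j. \<forall>p\<le>length ks. count_list (take p ks) (X i j) = t \<longrightarrow>
           rat_eq n (func (seed_after n (take p ks)) (X i j))
             (bracket4 n (n - i - t) (2 * n + i - j - t) (n + t) (j + t))) \<and>
        rat_eq n (func (init_seed n) (X i j)) (bracket4 n (n - i) (2 * n + i - j) n j) \<and>
        rat_eq n (func (seed_after n ks) (X i j)) (bracket4 n (j - i) (n + i) (2 * n - j) n) \<and>
        (\<forall>x\<in>symp_triples n.
           bracket4 n (j - i) (n + i) (2 * n - j) n x = bracket4 n (n - i) (2 * n + i - j) j n x))"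
proof -
  obtain f where f: "f \<in> poly_funs n" "\<exists>x\<in>symp_triples n. f x \<noteq> 0"
    and f_nz: "\<And>x i j t. f x \<noteq> 0 \<Longrightarrow> 0 < i \<Longrightarrow> 0 < j \<Longrightarrow> t + max i j < n \<Longrightarrow> seed_function n (X i j) t x \<noteq> 0"
    using seed_functions_generically_nonzero[OF assms(1)] by blast
  have genI: "generically n P" if "\<And>x. x \<in> symp_triples n \<Longrightarrow> f x \<noteq> 0 \<Longrightarrow> P x" for P
    unfolding generically_def using f that by blast
  have rat_eqI: "rat_eq n g h" if "\<And>x. x \<in> symp_triples n \<Longrightarrow> f x \<noteq> 0 \<Longrightarrow> g x = h x" for g h
    unfolding rat_eq_def by (rule genI) (rule that)
  have main: "func (seed_after n (take p ls)) v x = seed_function n v (count_list (take p ls) v) x"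
    if "x \<in> symp_triples n" "f x \<noteq> 0" "mutation_schedule n ls" "p \<le> length ls" "v \<in> vertices n" for x ls p v
    by (rule mutation_schedule_functions(1)[where F="\<lambda>v t. seed_function n v t x", OF seed_function_0
          f_nz[OF that(2)] seed_function_frozen seed_function_exchange[OF that(1)] assms(1) that(3-5)])
  \<comment> \<open>The exchange matrix and the counts do not depend on the triple, but the run was
    followed at a point; any point with \<open>f\<close> nonzero will do.\<close>
  obtain x0 where x0: "x0 \<in> symp_triples n" "f x0 \<noteq> 0"
    using f(2) by blast
  note F = seed_function_0 f_nz[OF x0(2)] seed_function_frozen seed_function_exchange[OF x0(1)] assms(1)
  have steps: "\<exists>i j. ls ! p = X i j \<and> 0 < i \<and> 0 < j \<and> count_list (take p ls) (X i j) + max i j < n"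
    if "mutation_schedule n ls" "p < length ls" for ls p
    by (rule mutation_schedule_functions(2)[where F="\<lambda>v t. seed_function n v t x0", OF F that])
  have exch: "exch (seed_after n ls) = fold (\<lambda>m. mutate_set (block n m)) (remaining n 1 0) (init_exch n)"
    if "mutation_schedule n ls" for ls
    by (rule mutation_schedule_functions(3)[where F="\<lambda>v t. seed_function n v t x0", OF F that])
  have count: "count_list ls (X i j) = n - max i j"
    if "mutation_schedule n ls" "i \<in> {1..n}" "j \<in> {1..n}" for ls i j
    by (rule mutation_schedule_functions(4)[where F="\<lambda>v t. seed_function n v t x0", OF F that])
  have vert: "X i j \<in> vertices n" if "i \<in> {1..n}" "j \<in> {1..n}" for i j
    using that by (auto simp: vertices_def)
  have full: "func (seed_after n ls) (X i j) x = seed_function n (X i j) (n - max i j) x"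
    if "x \<in> symp_triples n" "f x \<noteq> 0" "mutation_schedule n ls" "i \<in> {1..n}" "j \<in> {1..n}" for x ls i j
    using main[OF that(1-3) le_refl vert[OF that(4,5)]] count[OF that(3-5)] by simp
  have dual3: "bracket3 n (n + i) (2 * n - j) (n - i + j) x = bracket3 n (n - i) j (n + i - j) x"
    if x_in: "x \<in> symp_triples n" and "i \<in> {1..n}" "j \<in> {1..n}" "j \<le> i" for i j x
  proof -
    obtain U V W where x: "x = (U, V, W)" "symp_basis n U" "symp_basis n V" "symp_basis n W"
      using x_in by (auto simp: symp_triples_def)
    have "2 * n - (n + i) = n - i" "2 * n - (2 * n - j) = j" "2 * n - (n - i + j) = n + i - j"
      using that by auto
    then show ?thesis
      using bracket3_dual[OF x(2-4) assms(1), of "n + i" "2 * n - j" "n - i + j"] that by (auto simp: x(1))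
  qed
  have dual4: "bracket4 n (j - i) (n + i) (2 * n - j) n x = bracket4 n (n - i) (2 * n + i - j) j n x"
    if x_in: "x \<in> symp_triples n" and "i \<in> {1..n}" "j \<in> {1..n}" "i < j" for i j x
  proof -
    obtain U V W where x: "x = (U, V, W)" "symp_basis n U" "symp_basis n V" "symp_basis n W"
      using x_in by (auto simp: symp_triples_def)
    have "2 * n - (j - i) = 2 * n + i - j" "2 * n - (n + i) = n - i" "2 * n - (2 * n - j) = j" "2 * n - n = n"
      using that by auto
    then show ?thesis
      using bracket4_dual[OF x(2-4) assms(1), of "n + i" "j - i" "2 * n - j" n] that
        bracket4_commute[of n "j - i"] bracket4_commute[of n "n - i"] by (auto simp: x(1))
  qed
  have end1: "seed_function n (X i j) (n - max i j) x = bracket3 n (n + i) (2 * n - j) (n - i + j) x"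
    if x: "x \<in> symp_triples n" and ij: "i \<in> {1..n}" "j \<in> {1..n}" "j \<le> i" for i j x
  proof -
    obtain U V W where UVW: "x = (U, V, W)" "symp_basis n U" "symp_basis n V" "symp_basis n W"
      using x by (auto simp: symp_triples_def)
    have "seed_function n (X i j) (n - max i j) x = bracket4 n (n + i) 0 (2 * n - j) (n - i + j) x"
    proof -
      have "2 * n - (n - i) = n + i" "n + i - j + (n - i) = 2 * n - j" "j + (n - i) = n - i + j"
        using ij by auto
      then show ?thesis
        using ij by (simp add: seed_function_def)
    qed
    also have "\<dots> = bracket3 n (n + i) (2 * n - j) (n - i + j) x"
    proof (cases "i = n")
      \<comment> \<open>For \<open>i = n\<close> the larger index is \<open>2n\<close>, and the
        first branch of \<open>bracket4\<close> gives \<open>[0;2n-j;j]\<close>; exchanging the last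
        two flags and then dualising leads to the stated bracket.\<close>
      case True
      then have "bracket4 n (n + i) 0 (2 * n - j) (n - i + j) x = bracket3 n 0 (2 * n - j) j x"
        by (simp add: UVW(1) bracket4_def Let_def)
      also have "\<dots> = bracket3 n 0 j (2 * n - j) x"
        unfolding UVW(1) by (rule bracket3_swap_two[OF UVW(2-4)]) (use ij in auto)
      also have "\<dots> = bracket3 n (n + i) (2 * n - j) (n - i + j) x"
        using dual3[OF x ij] True by (simp add: mult_2)
      finally show ?thesis .
    qed (use ij in \<open>simp add: UVW(1) bracket4_def Let_def\<close>)
    finally show ?thesis .
  qed
  have end2: "seed_function n (X i j) (n - max i j) x = bracket4 n (j - i) (n + i) (2 * n - j) n x"
    if "i \<in> {1..n}" "j \<in> {1..n}" "i < j" for i j x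
  proof -
    have "n - i - (n - j) = j - i" "2 * n + i - j - (n - j) = n + i" "n + (n - j) = 2 * n - j" "j + (n - j) = n"
      using that by auto
    then show ?thesis
      using that by (simp add: seed_function_def)
  qed
  show ?thesis
  proof (intro conjI allI impI ballI)
    fix p
    assume p: "p < length ks"
    obtain i j where ij: "ks ! p = X i j" "0 < i" "0 < j" "count_list (take p ks) (X i j) + max i j < n"
      using steps[OF assms(2) p] by blast
    then show unfrozen: "ks ! p \<in> vertices n - frozen n"
      by (auto simp: vertices_def frozen_def)
    show "generically n (\<lambda>x. func (seed_after n (take p ks)) (ks ! p) x \<noteq> 0)"
    proof (rule genI)
      fix x
      assume x: "x \<in> symp_triples n" "f x \<noteq> 0"
      have "func (seed_after n (take p ks)) (X i j) x = seed_function n (X i j) (count_list (take p ks) (X i j)) x"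
        by (rule main[OF x assms(2)]) (use p unfrozen ij(1) in auto)
      then show "func (seed_after n (take p ks)) (ks ! p) x \<noteq> 0"
        using f_nz[OF x(2) ij(2-4)] ij(1) by simp
    qed
  next
    fix ks'
    assume ks': "mutation_schedule n ks'"
    show "exch (seed_after n ks') = exch (seed_after n ks)"
      using exch[OF ks'] exch[OF assms(2)] by simp
    fix v
    assume v: "v \<in> vertices n"
    show "rat_eq n (func (seed_after n ks') v) (func (seed_after n ks) v)"
    proof (rule rat_eqI)
      fix x
      assume x: "x \<in> symp_triples n" "f x \<noteq> 0"
      show "func (seed_after n ks') v x = func (seed_after n ks) v x"
      proof (cases "\<exists>i j. v = X i j \<and> 0 < i")
        case True
        then show ?thesis
          using full[OF x ks'] full[OF x assms(2)] v by (auto simp: vertices_def)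
      next
        case False
        \<comment> \<open>On frozen vertices the claimed function is constant in \<open>t\<close>,
          so the counts need not be compared.\<close>
        then have "seed_function n v t x = seed_function n v 0 x" for t
          by (auto simp: seed_function_def split: vertex.split)
        then show ?thesis
          using main[OF x ks' le_refl v] main[OF x assms(2) le_refl v] by (metis take_all_iff le_refl)
      qed
    qed
  next
    fix i j
    assume "i \<in> {1..n}" "j \<in> {1..n}"
    then show "count_list ks (X i j) = n - max i j"
      by (rule count[OF assms(2)])
  next
    fix i j t p
    assume "i \<in> {1..n}" "j \<in> {1..n}" "j \<le> i" "p \<le> length ks" "count_list (take p ks) (X i j) = t"
    then show "rat_eq n (func (seed_after n (take p ks)) (X i j))
        (bracket4 n (2 * n - t) (n - i - t) (n + i - j + t) (j + t))"
      using main[OF _ _ assms(2), of _ p "X i j"] vert[of i j]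
      by (intro rat_eqI) (simp add: seed_function_def)
  next
    fix i j
    assume ij: "i \<in> {1..n}" "j \<in> {1..n}" "j \<le> i"
    then show "rat_eq n (func (init_seed n) (X i j)) (bracket3 n (n - i) (n + i - j) j)"
      by (intro rat_eqI) (auto simp: init_seed_def)
    show "rat_eq n (func (seed_after n ks) (X i j)) (bracket3 n (n + i) (2 * n - j) (n - i + j))"
      using full[OF _ _ assms(2) ij(1,2)] end1[OF _ ij] by (intro rat_eqI) simp
    fix x
    assume "x \<in> symp_triples n"
    then show "bracket3 n (n + i) (2 * n - j) (n - i + j) x = bracket3 n (n - i) j (n + i - j) x"
      using ij by (rule dual3)
  next
    fix i j t p
    assume "i \<in> {1..n}" "j \<in> {1..n}" "i < j" "p \<le> length ks" "count_list (take p ks) (X i j) = t"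
    then show "rat_eq n (func (seed_after n (take p ks)) (X i j))
        (bracket4 n (n - i - t) (2 * n + i - j - t) (n + t) (j + t))"
      using main[OF _ _ assms(2), of _ p "X i j"] vert[of i j]
      by (intro rat_eqI) (simp add: seed_function_def)
  next
    fix i j
    assume ij: "i \<in> {1..n}" "j \<in> {1..n}" "i < j"
    then show "rat_eq n (func (init_seed n) (X i j)) (bracket4 n (n - i) (2 * n + i - j) n j)"
      by (intro rat_eqI) (auto simp: init_seed_def)
    show "rat_eq n (func (seed_after n ks) (X i j)) (bracket4 n (j - i) (n + i) (2 * n - j) n)"
      using full[OF _ _ assms(2) ij(1,2)] end2[OF ij] by (intro rat_eqI) simp
    fix x
    assume "x \<in> symp_triples n"
    then show "bracket4 n (j - i) (n + i) (2 * n - j) n x = bracket4 n (n - i) (2 * n + i - j) j n x"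
      using ij by (rule dual4)
  qed
qed

end
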